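(* Let $G$ be a connected abelian Lie group. Then there exist a sequence of finite abelian groups $(H_n)_{n<\omega}$ and an ultrafilter $D$ on $\omega$ such that $(L^1(G),* )$ metrically embeds into the metric ultraproduct $\prod_{D}(\ell^1(H_n),* )$.
   Context: For a locally compact group $G$ with a fixed left Haar measure $\mu$, $(L^1(G),* )$ denotes the real Banach lattice $L^1(G,\mu)$ equipped with convolution $(f*g)(x)=\int_G f(y)g(y^{-1}x)\,d\mu(y)$; for a finite (discrete) group $H$, $(\ell^1(H),* )$ is the same with counting measure. These are regarded as metric structures in continuous first-order logic in the language $\mathcal{L}_{\mathrm{cnv}}=\{+,0,\wedge,\vee,\|\cdot\|,*\}$ with metric $d(f,g)=\|f-g\|_1$ (formally on unit balls; maps are extended linearly to the whole spaces). A metric embedding is an isometric map preserving all function and relation symbols of the language (here: a linear isometry preserving lattice operations and convolution). $\prod_D$ denotes the ultraproduct of metric structures (equivalently the Banach-space ultraproduct with coordinatewise lattice operations and convolution). *)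

theory Defs
  imports "HOL-Analysis.Analysis" "HOL-Algebra.Group"
begin

section \<open>Lie groups\<close>

text \<open>
  \<open>Ck_on k S f\<close>: \<open>f\<close> is \<open>k\<close> times continuously (Frechet) differentiable on \<open>S\<close>; meaningful for
  open \<open>S\<close>.
\<close>

fun Ck_on :: "nat \<Rightarrow> 'e::real_normed_vector set \<Rightarrow> ('e \<Rightarrow> 'f::real_normed_vector) \<Rightarrow> bool" where
  "Ck_on 0 S f \<longleftrightarrow> continuous_on S f"
| "Ck_on (Suc k) S f \<longleftrightarrow>
     (\<forall>x\<in>S. f differentiable (at x)) \<and>
     (\<forall>v. Ck_on k S (\<lambda>x. frechet_derivative f (at x) v))"

definition smooth_on :: "'e::real_normed_vector set \<Rightarrow> ('e \<Rightarrow> 'f::real_normed_vector) \<Rightarrow> bool" where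
  "smooth_on S f \<longleftrightarrow> (\<forall>k. Ck_on k S f)"

type_synonym ('a, 'e) chart = "'a set \<times> ('a \<Rightarrow> 'e)"

definition is_chart :: "'a topology \<Rightarrow> ('a, 'e::euclidean_space) chart \<Rightarrow> bool" where
  "is_chart T c \<longleftrightarrow> (case c of (U, \<phi>) \<Rightarrow>
     openin T U \<and> open (\<phi> ` U) \<and>
     homeomorphic_map (subtopology T U) (top_of_set (\<phi> ` U)) \<phi>)"

definition smooth_atlas :: "'a topology \<Rightarrow> ('a, 'e::euclidean_space) chart set \<Rightarrow> bool" where
  "smooth_atlas T A \<longleftrightarrow>
     (\<forall>c\<in>A. is_chart T c) \<and>
     (\<Union>c\<in>A. fst c) = topspace T \<and>
     (\<forall>(U, \<phi>)\<in>A. \<forall>(V, \<psi>)\<in>A. smooth_on (\<phi> ` (U \<inter> V)) (\<psi> \<circ> inv_into U \<phi>))"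

definition prod_atlas ::
  "('a, 'e) chart set \<Rightarrow> ('b, 'f) chart set \<Rightarrow> ('a \<times> 'b, 'e \<times> 'f) chart set" where
  "prod_atlas A B = {(U \<times> V, map_prod \<phi> \<psi>) | U \<phi> V \<psi>. (U, \<phi>) \<in> A \<and> (V, \<psi>) \<in> B}"

definition smooth_map ::
  "'a topology \<Rightarrow> ('a, 'e::euclidean_space) chart set \<Rightarrow>
   'b topology \<Rightarrow> ('b, 'f::euclidean_space) chart set \<Rightarrow> ('a \<Rightarrow> 'b) \<Rightarrow> bool" where
  "smooth_map T A T' B f \<longleftrightarrow>
     continuous_map T T' f \<and>
     (\<forall>(U, \<phi>)\<in>A. \<forall>(V, \<psi>)\<in>B.
        smooth_on (\<phi> ` {x \<in> U. f x \<in> V}) (\<psi> \<circ> f \<circ> inv_into U \<phi>))"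

text \<open>
  A Lie group whose dimension is \<open>DIM('e)\<close> or zero. Types of class \<open>euclidean_space\<close> have positive
  dimension, so zero-dimensional manifolds, i.e. countable discrete spaces, are a case of their own.
\<close>

definition lie_group ::
  "'e::euclidean_space itself \<Rightarrow> ('a, 'm) monoid_scheme \<Rightarrow> 'a topology \<Rightarrow> bool" where
  "lie_group _ G T \<longleftrightarrow>
     group G \<and> topspace T = carrier G \<and> Hausdorff_space T \<and> second_countable T \<and>
     (T = discrete_topology (carrier G) \<or>
      (\<exists>A :: ('a, 'e) chart set.
         smooth_atlas T A \<and>
         smooth_map (prod_topology T T) (prod_atlas A A) T A (\<lambda>(x, y). x \<otimes>\<^bsub>G\<^esub> y) \<and>
         smooth_map T A T A (\<lambda>x. inv\<^bsub>G\<^esub> x)))"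


section \<open>Haar measure\<close>

definition left_haar_measure ::
  "('a, 'm) monoid_scheme \<Rightarrow> 'a topology \<Rightarrow> 'a measure \<Rightarrow> bool" where
  "left_haar_measure G T \<mu> \<longleftrightarrow>
     space \<mu> = topspace T \<and>
     sets \<mu> = sigma_sets (topspace T) {U. openin T U} \<and>
     emeasure \<mu> (space \<mu>) \<noteq> 0 \<and>
     (\<forall>K. compactin T K \<longrightarrow> emeasure \<mu> K < \<infinity>) \<and>
     (\<forall>B\<in>sets \<mu>. emeasure \<mu> B = (INF U\<in>{U. openin T U \<and> B \<subseteq> U}. emeasure \<mu> U)) \<and>
     (\<forall>U. openin T U \<longrightarrow>
        emeasure \<mu> U = (SUP K\<in>{K. compactin T K \<and> K \<subseteq> U}. emeasure \<mu> K)) \<and>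
     (\<forall>g\<in>carrier G. \<forall>B\<in>sets \<mu>. emeasure \<mu> ((\<lambda>x. g \<otimes>\<^bsub>G\<^esub> x) ` B) = emeasure \<mu> B)"


section \<open>Structures for the language of Banach lattices with convolution\<close>

record 'a cnv_structure =
  cnv_carrier :: "'a set"
  cnv_zero :: 'a
  cnv_add :: "'a \<Rightarrow> 'a \<Rightarrow> 'a"
  cnv_scale :: "real \<Rightarrow> 'a \<Rightarrow> 'a"
  cnv_inf :: "'a \<Rightarrow> 'a \<Rightarrow> 'a"
  cnv_sup :: "'a \<Rightarrow> 'a \<Rightarrow> 'a"
  cnv_norm :: "'a \<Rightarrow> real"
  cnv_conv :: "'a \<Rightarrow> 'a \<Rightarrow> 'a"

definition cnv_dist :: "'a cnv_structure \<Rightarrow> 'a \<Rightarrow> 'a \<Rightarrow> real" where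
  "cnv_dist A x y = cnv_norm A (cnv_add A x (cnv_scale A (- 1) y))"

definition metric_embedding :: "'a cnv_structure \<Rightarrow> 'b cnv_structure \<Rightarrow> ('a \<Rightarrow> 'b) \<Rightarrow> bool" where
  "metric_embedding A B \<Phi> \<longleftrightarrow>
     (\<forall>x\<in>cnv_carrier A. \<Phi> x \<in> cnv_carrier B) \<and>
     \<Phi> (cnv_zero A) = cnv_zero B \<and>
     (\<forall>c. \<forall>x\<in>cnv_carrier A. \<Phi> (cnv_scale A c x) = cnv_scale B c (\<Phi> x)) \<and>
     (\<forall>x\<in>cnv_carrier A. cnv_norm B (\<Phi> x) = cnv_norm A x) \<and>
     (\<forall>x\<in>cnv_carrier A. \<forall>y\<in>cnv_carrier A.
        \<Phi> (cnv_add A x y) = cnv_add B (\<Phi> x) (\<Phi> y) \<and>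
        \<Phi> (cnv_inf A x y) = cnv_inf B (\<Phi> x) (\<Phi> y) \<and>
        \<Phi> (cnv_sup A x y) = cnv_sup B (\<Phi> x) (\<Phi> y) \<and>
        \<Phi> (cnv_conv A x y) = cnv_conv B (\<Phi> x) (\<Phi> y) \<and>
        cnv_dist B (\<Phi> x) (\<Phi> y) = cnv_dist A x y)"

definition metrically_embeds :: "'a cnv_structure \<Rightarrow> 'b cnv_structure \<Rightarrow> bool" where
  "metrically_embeds A B \<longleftrightarrow> (\<exists>\<Phi>. metric_embedding A B \<Phi>)"


section \<open>The convolution algebra of a group with a measure\<close>

definition convolution ::
  "('a, 'm) monoid_scheme \<Rightarrow> 'a measure \<Rightarrow> ('a \<Rightarrow> real) \<Rightarrow> ('a \<Rightarrow> real) \<Rightarrow> 'a \<Rightarrow> real" where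
  "convolution G \<mu> f g x = (\<integral>y. f y * g (inv\<^bsub>G\<^esub> y \<otimes>\<^bsub>G\<^esub> x) \<partial>\<mu>)"

definition L1_rel :: "'a measure \<Rightarrow> (('a \<Rightarrow> real) \<times> ('a \<Rightarrow> real)) set" where
  "L1_rel \<mu> = {(f, g). integrable \<mu> f \<and> integrable \<mu> g \<and> (AE x in \<mu>. f x = g x)}"

text \<open>
  The elements are almost-everywhere classes of integrable functions. The unions below range over
  all representatives; they collapse to a single class because the operations respect \<open>L1_rel\<close>.
\<close>

definition L1_conv ::
  "('a, 'm) monoid_scheme \<Rightarrow> 'a measure \<Rightarrow> ('a \<Rightarrow> real) set cnv_structure" where
  "L1_conv G \<mu> = \<lparr>
     cnv_carrier = {f. integrable \<mu> f} // L1_rel \<mu>,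
     cnv_zero = L1_rel \<mu> `` {\<lambda>x. 0},
     cnv_add = (\<lambda>X Y. \<Union>f\<in>X. \<Union>g\<in>Y. L1_rel \<mu> `` {\<lambda>x. f x + g x}),
     cnv_scale = (\<lambda>c X. \<Union>f\<in>X. L1_rel \<mu> `` {\<lambda>x. c * f x}),
     cnv_inf = (\<lambda>X Y. \<Union>f\<in>X. \<Union>g\<in>Y. L1_rel \<mu> `` {\<lambda>x. min (f x) (g x)}),
     cnv_sup = (\<lambda>X Y. \<Union>f\<in>X. \<Union>g\<in>Y. L1_rel \<mu> `` {\<lambda>x. max (f x) (g x)}),
     cnv_norm = (\<lambda>X. the_elem ((\<lambda>f. \<integral>x. \<bar>f x\<bar> \<partial>\<mu>) ` X)),
     cnv_conv = (\<lambda>X Y. \<Union>f\<in>X. \<Union>g\<in>Y. L1_rel \<mu> `` {convolution G \<mu> f g}) \<rparr>"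

definition l1_conv :: "('a, 'm) monoid_scheme \<Rightarrow> ('a \<Rightarrow> real) set cnv_structure" where
  "l1_conv H = L1_conv H (count_space (carrier H))"


section \<open>Metric ultraproducts\<close>

definition ultrafilter :: "'i filter \<Rightarrow> bool" where
  "ultrafilter D \<longleftrightarrow>
     D \<noteq> bot \<and> (\<forall>P. eventually P D \<or> eventually (\<lambda>i. \<not> P i) D)"

definition bounded_families :: "('i \<Rightarrow> 'a cnv_structure) \<Rightarrow> ('i \<Rightarrow> 'a) set" where
  "bounded_families A =
     {x. (\<forall>i. x i \<in> cnv_carrier (A i)) \<and> (\<exists>C. \<forall>i. cnv_norm (A i) (x i) \<le> C)}"

definition ultra_rel ::
  "'i filter \<Rightarrow> ('i \<Rightarrow> 'a cnv_structure) \<Rightarrow> (('i \<Rightarrow> 'a) \<times> ('i \<Rightarrow> 'a)) set" where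
  "ultra_rel D A =
     {(x, y). x \<in> bounded_families A \<and> y \<in> bounded_families A \<and>
        ((\<lambda>i. cnv_dist (A i) (x i) (y i)) \<longlongrightarrow> 0) D}"

definition ultraproduct ::
  "'i filter \<Rightarrow> ('i \<Rightarrow> 'a cnv_structure) \<Rightarrow> ('i \<Rightarrow> 'a) set cnv_structure" where
  "ultraproduct D A = \<lparr>
     cnv_carrier = bounded_families A // ultra_rel D A,
     cnv_zero = ultra_rel D A `` {\<lambda>i. cnv_zero (A i)},
     cnv_add = (\<lambda>X Y. \<Union>x\<in>X. \<Union>y\<in>Y. ultra_rel D A `` {\<lambda>i. cnv_add (A i) (x i) (y i)}),
     cnv_scale = (\<lambda>c X. \<Union>x\<in>X. ultra_rel D A `` {\<lambda>i. cnv_scale (A i) c (x i)}),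
     cnv_inf = (\<lambda>X Y. \<Union>x\<in>X. \<Union>y\<in>Y. ultra_rel D A `` {\<lambda>i. cnv_inf (A i) (x i) (y i)}),
     cnv_sup = (\<lambda>X Y. \<Union>x\<in>X. \<Union>y\<in>Y. ultra_rel D A `` {\<lambda>i. cnv_sup (A i) (x i) (y i)}),
     cnv_norm = (\<lambda>X. the_elem ((\<lambda>x. Lim D (\<lambda>i. cnv_norm (A i) (x i))) ` X)),
     cnv_conv = (\<lambda>X Y. \<Union>x\<in>X. \<Union>y\<in>Y. ultra_rel D A `` {\<lambda>i. cnv_conv (A i) (x i) (y i)}) \<rparr>"

end

theory Submission
  imports Defs
begin

text \<open>
  Let \<open>p\<^sub>n : G \<rightarrow> H\<^sub>n\<close> be maps into finite abelian groups with measurable fibres and push \<open>f\<close> in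
  \<open>L\<^sup>1(G)\<close> forward to \<open>h \<mapsto> \<integral> f\<close> over the fibre of \<open>h\<close>. If the \<open>p\<^sub>n\<close> eventually separate disjoint
  compact sets, the norms of the push-forwards tend to the norm of \<open>f\<close>; as the push-forward is a
  positive contraction, this already makes it asymptotically a lattice homomorphism. If moreover
  every \<open>y\<close> is a limit of points \<open>y\<^sub>n\<close> with \<open>p\<^sub>n(y\<^sub>n x) = p\<^sub>n(y) p\<^sub>n(x)\<close>, continuity of translation in
  \<open>L\<^sup>1\<close> and dominated convergence make it asymptotically multiplicative.

  For a connected abelian Lie group the approximants \<open>\<phi>\<^sup>-\<^sup>1(v / 2\<^sup>n)\<close> raised to the power \<open>2\<^sup>n\<close>, for a
  chart \<open>\<phi>\<close> centred at the identity, converge to an open surjective homomorphism from the model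
  space onto \<open>G\<close> with discrete kernel. In coordinates adapted to that lattice, \<open>G\<close> is a product of
  lines and circles, and rounding to a grid gives the maps \<open>p\<^sub>n\<close>.
\<close>

section \<open>Ultrafilters\<close>

text \<open>Rounding is not a homomorphism: floors add only up to 0 or 1, and in a finite group this
  is no small error, since point masses at distinct elements are at l1-distance 2. The error has to
  be moved back into G, where translation is continuous in L^1: rounding y down to its grid corner
  makes the floors add exactly. On a line there is a second obstacle, the wrap-around modulo the
  order of the finite cyclic group. It is harmless because functions carried by compact sets are
  dense, so separation is asked only eventually, for fixed compact sets. Likewise dominated
  convergence stands in for any uniformity in y. On the Lie side two derivatives of the
  multiplication are enough. In a centred chart the product is addition up to a quadratic error; a
  discrepancy of order 4^-n grows under the power 2^n only to order 2^-n; and commutativity lets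
  such powers be taken factor by factor. All limits are ordinary limits in n, so any ultrafilter
  finer than \<open>sequentially\<close> serves.\<close>

lemma ultrafilter_below:
  fixes F :: "'i filter"
  assumes "F \<noteq> bot"
  obtains D where "ultrafilter D" "D \<le> F"
proof -
  define S where "S = {D. D \<noteq> bot \<and> D \<le> F}"
  \<comment> \<open>Finer filters are smaller, so the order is reversed: Zorn's lemma then gives a
    minimal proper filter below \<open>F\<close>.\<close>
  have po: "partial_order_on S (relation_of (\<ge>) S)"
    by (rule partial_order_on_relation_ofI) auto
  have ch: "\<exists>u\<in>S. \<forall>a\<in>C. u \<le> a" if C: "C \<in> Chains (relation_of (\<ge>) S)" for C
  proof (cases "C = {}")
    case True
    then show ?thesis using assms by (auto simp: S_def)
  next
    case False
    have CS: "C \<subseteq> S" and tot: "\<And>a b. a \<in> C \<Longrightarrow> b \<in> C \<Longrightarrow> a \<le> b \<or> b \<le> a"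
      using C by (auto simp: Chains_def relation_of_def)
    \<comment> \<open>On a chain, an event holds eventually along the infimum only if it does so
      along some member; for the event \<open>False\<close> that member would be
      \<open>bot\<close>.\<close>
    have "Inf C \<noteq> bot"
    proof
      assume "Inf C = bot"
      then have "eventually (\<lambda>x. False) (Inf C)" by simp
      moreover have "eventually P (Inf C) \<longleftrightarrow> (\<exists>b\<in>C. eventually P b)" for P
        using eventually_Inf_base[OF False, of P] tot
        by (metis inf.absorb1 inf.absorb2 order_refl)
      ultimately obtain b where "b \<in> C" "eventually (\<lambda>x. False) b" by auto
      with CS show False by (auto simp: S_def trivial_limit_def)
    qed
    moreover have "Inf C \<le> F"
      using False CS by (auto simp: S_def intro: Inf_lower2)
    ultimately show ?thesis by (auto simp: S_def Inf_lower intro!: bexI[of _ "Inf C"])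
  qed
  obtain D where D: "D \<in> S" "\<And>a. a \<in> S \<Longrightarrow> a \<le> D \<Longrightarrow> a = D"
    using predicate_Zorn[OF po] ch by blast
  have "ultrafilter D"
    unfolding ultrafilter_def
  proof (intro conjI allI)
    show "D \<noteq> bot" using D by (auto simp: S_def)
    fix P
    show "eventually P D \<or> eventually (\<lambda>i. \<not> P i) D"
    \<comment> \<open>Either \<open>P\<close> clashes with \<open>D\<close>, and then its complement
      is in \<open>D\<close>, or restricting to \<open>P\<close> keeps the filter proper, and
      minimality forces \<open>D\<close> to contain \<open>P\<close> already.\<close>
    proof (cases "inf D (principal {i. P i}) = bot")
      case True
      then have "eventually (\<lambda>i. False) (inf D (principal {i. P i}))" by simp
      then show ?thesis by (simp add: eventually_inf_principal)
    next
      case False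
      then have "inf D (principal {i. P i}) = D"
        using D by (auto simp: S_def intro!: D(2) intro: le_infI1)
      then have "D \<le> principal {i. P i}" by (metis inf_le2)
      then show ?thesis by (simp add: le_principal)
    qed
  qed
  with D show thesis using that by (auto simp: S_def)
qed

section \<open>The operations of \<open>L\<^sup>1\<close> on representatives\<close>

abbreviation L1_class :: "'a measure \<Rightarrow> ('a \<Rightarrow> real) \<Rightarrow> ('a \<Rightarrow> real) set" where
  "L1_class \<mu> f \<equiv> L1_rel \<mu> `` {f}"

lemma equiv_L1_rel: "equiv {f. integrable \<mu> f} (L1_rel \<mu>)"
  unfolding L1_rel_def by (auto simp: equiv_def refl_on_def sym_def trans_def)

lemma L1_class_eq_iff:
  assumes "integrable \<mu> f" "integrable \<mu> g"
  shows "L1_class \<mu> f = L1_class \<mu> g \<longleftrightarrow> (AE x in \<mu>. f x = g x)"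
  using assms eq_equiv_class_iff[OF equiv_L1_rel, of f \<mu> g] by (simp add: L1_rel_def)

lemma L1_class_cong:
  assumes "integrable \<mu> f" "integrable \<mu> g" "AE x in \<mu>. f x = g x"
  shows "L1_class \<mu> f = L1_class \<mu> g"
  using assms L1_class_eq_iff by blast

lemma mem_L1_class_self: "integrable \<mu> f \<Longrightarrow> f \<in> L1_class \<mu> f"
  by (simp add: L1_rel_def)

lemma L1_relD:
  assumes "(f, g) \<in> L1_rel \<mu>"
  shows "integrable \<mu> f" "integrable \<mu> g" "AE x in \<mu>. f x = g x"
  using assms by (auto simp: L1_rel_def)

text \<open>The operations of \<open>L1_conv\<close> are unions over all representatives. Such a
  union is a single class once all representatives contribute the same one, and it is not empty
  because \<open>f\<close> itself is a representative.\<close>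

lemma UN_L1_class:
  assumes "\<And>g. g \<in> L1_class \<mu> f \<Longrightarrow> F g = C" and "integrable \<mu> f"
  shows "(\<Union>g\<in>L1_class \<mu> f. F g) = C"
  using assms mem_L1_class_self[OF assms(2)] by auto

lemma UN_L1_class2:
  assumes "\<And>f' g'. f' \<in> L1_class \<mu> f \<Longrightarrow> g' \<in> L1_class \<mu> g \<Longrightarrow> F f' g' = C"
    and "integrable \<mu> f" "integrable \<mu> g"
  shows "(\<Union>f'\<in>L1_class \<mu> f. \<Union>g'\<in>L1_class \<mu> g. F f' g') = C"
  by (intro UN_L1_class assms)

lemma cnv_carrier_L1: "cnv_carrier (L1_conv G \<mu>) = L1_class \<mu> ` {f. integrable \<mu> f}"
  by (auto simp: L1_conv_def quotient_def)

lemma cnv_zero_L1: "cnv_zero (L1_conv G \<mu>) = L1_class \<mu> (\<lambda>x. 0)"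
  by (simp add: L1_conv_def)

lemma L1_class_lift:
  assumes "f' \<in> L1_class \<mu> f" and "integrable \<mu> (\<lambda>x. F (f' x))" "integrable \<mu> (\<lambda>x. F (f x))"
  shows "L1_class \<mu> (\<lambda>x. F (f' x)) = L1_class \<mu> (\<lambda>x. F (f x))"
proof -
  have "AE x in \<mu>. f x = f' x" using assms(1) by (auto dest: L1_relD)
  then have "AE x in \<mu>. F (f' x) = F (f x)" by eventually_elim simp
  then show ?thesis using assms by (intro L1_class_cong)
qed

lemma L1_class_lift2:
  assumes "f' \<in> L1_class \<mu> f" "g' \<in> L1_class \<mu> g"
    and "integrable \<mu> (\<lambda>x. F (f' x) (g' x))" "integrable \<mu> (\<lambda>x. F (f x) (g x))"
  shows "L1_class \<mu> (\<lambda>x. F (f' x) (g' x)) = L1_class \<mu> (\<lambda>x. F (f x) (g x))"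
proof -
  have "AE x in \<mu>. f x = f' x" "AE x in \<mu>. g x = g' x" using assms by (auto dest: L1_relD)
  then have "AE x in \<mu>. F (f' x) (g' x) = F (f x) (g x)" by eventually_elim simp
  then show ?thesis using assms by (intro L1_class_cong)
qed

context
  fixes \<mu> :: "'a measure" and f g :: "'a \<Rightarrow> real"
  assumes fg: "integrable \<mu> f" "integrable \<mu> g"
begin

lemma cnv_add_L1:
  "cnv_add (L1_conv G \<mu>) (L1_class \<mu> f) (L1_class \<mu> g) = L1_class \<mu> (\<lambda>x. f x + g x)"
  unfolding L1_conv_def cnv_structure.simps
  by (intro UN_L1_class2 L1_class_lift2[where F="(+)"] fg) (auto dest: L1_relD)

lemma cnv_scale_L1:
  "cnv_scale (L1_conv G \<mu>) c (L1_class \<mu> f) = L1_class \<mu> (\<lambda>x. c * f x)"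
  unfolding L1_conv_def cnv_structure.simps
  by (intro UN_L1_class L1_class_lift[where F="\<lambda>a. c * a"] fg) (auto dest: L1_relD)

lemma cnv_inf_L1:
  "cnv_inf (L1_conv G \<mu>) (L1_class \<mu> f) (L1_class \<mu> g) = L1_class \<mu> (\<lambda>x. min (f x) (g x))"
  unfolding L1_conv_def cnv_structure.simps
  by (intro UN_L1_class2 L1_class_lift2[where F=min] fg) (auto dest: L1_relD)

lemma cnv_sup_L1:
  "cnv_sup (L1_conv G \<mu>) (L1_class \<mu> f) (L1_class \<mu> g) = L1_class \<mu> (\<lambda>x. max (f x) (g x))"
  unfolding L1_conv_def cnv_structure.simps
  by (intro UN_L1_class2 L1_class_lift2[where F=max] fg) (auto dest: L1_relD)

lemma cnv_norm_L1: "cnv_norm (L1_conv G \<mu>) (L1_class \<mu> f) = (\<integral>x. \<bar>f x\<bar> \<partial>\<mu>)"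
proof -
  have "(\<lambda>f. \<integral>x. \<bar>f x\<bar> \<partial>\<mu>) ` (L1_class \<mu> f) = {\<integral>x. \<bar>f x\<bar> \<partial>\<mu>}"
  proof -
    have "(\<integral>x. \<bar>g x\<bar> \<partial>\<mu>) = (\<integral>x. \<bar>f x\<bar> \<partial>\<mu>)" if "g \<in> L1_class \<mu> f" for g
      using that by (intro integral_cong_AE) (auto dest: L1_relD)
    then have "(\<lambda>f. \<integral>x. \<bar>f x\<bar> \<partial>\<mu>) ` (L1_class \<mu> f) = (\<lambda>_. \<integral>x. \<bar>f x\<bar> \<partial>\<mu>) ` (L1_class \<mu> f)"
      by (rule image_cong[OF refl])
    also have "\<dots> = {\<integral>x. \<bar>f x\<bar> \<partial>\<mu>}"
      by (rule image_constant) (rule mem_L1_class_self[OF fg(1)])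
    finally show ?thesis .
  qed
  then show ?thesis by (simp add: L1_conv_def)
qed

end

lemma cnv_dist_L1:
  assumes "integrable \<mu> f" "integrable \<mu> g"
  shows "cnv_dist (L1_conv G \<mu>) (L1_class \<mu> f) (L1_class \<mu> g) = (\<integral>x. \<bar>f x - g x\<bar> \<partial>\<mu>)"
  using assms by (simp add: cnv_dist_def cnv_scale_L1 cnv_add_L1 cnv_norm_L1)

section \<open>Group algebras of finite groups\<close>

context
  fixes H :: "'b monoid"
  assumes fin: "finite (carrier H)"
begin

abbreviation (input) l1_class :: "('b \<Rightarrow> real) \<Rightarrow> ('b \<Rightarrow> real) set" where
  "l1_class \<equiv> L1_class (count_space (carrier H))"

lemma integrable_count_space_fin: "integrable (count_space (carrier H)) (f :: 'b \<Rightarrow> real)"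
  by (rule integrable_count_space[OF fin])

lemma cnv_carrier_l1: "cnv_carrier (l1_conv H) = range l1_class"
  by (simp add: l1_conv_def cnv_carrier_L1 integrable_count_space_fin)

text \<open>Representatives are total functions whose values off the carrier are forgotten; on the
  carrier, counting measure has no nonempty null set.\<close>

lemma l1_class_eq_iff: "l1_class f = l1_class g \<longleftrightarrow> (\<forall>x\<in>carrier H. f x = g x)"
  by (simp add: L1_class_eq_iff integrable_count_space_fin AE_count_space)

lemma l1_zero: "cnv_zero (l1_conv H) = l1_class (\<lambda>x. 0)"
  by (simp add: l1_conv_def cnv_zero_L1)

lemma l1_add: "cnv_add (l1_conv H) (l1_class f) (l1_class g) = l1_class (\<lambda>x. f x + g x)"
  by (simp add: l1_conv_def cnv_add_L1 integrable_count_space_fin)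

lemma l1_scale: "cnv_scale (l1_conv H) c (l1_class f) = l1_class (\<lambda>x. c * f x)"
  by (simp add: l1_conv_def cnv_scale_L1 integrable_count_space_fin)

lemma l1_inf: "cnv_inf (l1_conv H) (l1_class f) (l1_class g) = l1_class (\<lambda>x. min (f x) (g x))"
  by (simp add: l1_conv_def cnv_inf_L1 integrable_count_space_fin)

lemma l1_sup: "cnv_sup (l1_conv H) (l1_class f) (l1_class g) = l1_class (\<lambda>x. max (f x) (g x))"
  by (simp add: l1_conv_def cnv_sup_L1 integrable_count_space_fin)

lemma l1_norm: "cnv_norm (l1_conv H) (l1_class f) = (\<Sum>x\<in>carrier H. \<bar>f x\<bar>)"
  by (simp add: l1_conv_def cnv_norm_L1 integrable_count_space_fin
      lebesgue_integral_count_space_finite fin)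

lemma l1_dist: "cnv_dist (l1_conv H) (l1_class f) (l1_class g) = (\<Sum>x\<in>carrier H. \<bar>f x - g x\<bar>)"
  by (simp add: l1_conv_def cnv_dist_L1 integrable_count_space_fin
      lebesgue_integral_count_space_finite fin)

text \<open>Representatives agree only on the carrier; the group laws keep the argument of
  \<open>g\<close> inside it.\<close>

lemma l1_convolution:
  assumes "group H"
  shows "cnv_conv (l1_conv H) (l1_class f) (l1_class g) =
    l1_class (\<lambda>x. \<Sum>y\<in>carrier H. f y * g (inv\<^bsub>H\<^esub> y \<otimes>\<^bsub>H\<^esub> x))"
proof -
  interpret group H by fact
  show ?thesis
    unfolding l1_conv_def L1_conv_def cnv_structure.simps
  proof (intro UN_L1_class2 integrable_count_space_fin)
    fix f' g' assume "f' \<in> l1_class f" "g' \<in> l1_class g"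
    then have "\<And>x. x \<in> carrier H \<Longrightarrow> f x = f' x" "\<And>x. x \<in> carrier H \<Longrightarrow> g x = g' x"
      by (auto dest!: L1_relD(3) simp: AE_count_space)
    then show "l1_class (convolution H (count_space (carrier H)) f' g') =
      l1_class (\<lambda>x. \<Sum>y\<in>carrier H. f y * g (inv\<^bsub>H\<^esub> y \<otimes>\<^bsub>H\<^esub> x))"
      by (simp add: l1_class_eq_iff convolution_def lebesgue_integral_count_space_finite fin)
  qed
qed

end

section \<open>Metric ultraproducts of finite group algebras\<close>

definition l1norm :: "'b monoid \<Rightarrow> ('b \<Rightarrow> real) \<Rightarrow> real" where
  "l1norm H f = (\<Sum>x\<in>carrier H. \<bar>f x\<bar>)"

definition fin_conv :: "'b monoid \<Rightarrow> ('b \<Rightarrow> real) \<Rightarrow> ('b \<Rightarrow> real) \<Rightarrow> 'b \<Rightarrow> real" where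
  "fin_conv H f g x = (\<Sum>y\<in>carrier H. f y * g (inv\<^bsub>H\<^esub> y \<otimes>\<^bsub>H\<^esub> x))"

lemma l1norm_nonneg: "0 \<le> l1norm H f"
  by (simp add: l1norm_def sum_nonneg)

lemma l1norm_triangle: "l1norm H (\<lambda>x. f x + g x) \<le> l1norm H f + l1norm H g"
  by (simp add: l1norm_def sum.distrib[symmetric] sum_mono)

lemma l1norm_bound2:
  assumes "\<And>x. x \<in> carrier H \<Longrightarrow> \<bar>h x\<bar> \<le> \<bar>f x\<bar> + \<bar>g x\<bar>"
  shows "l1norm H h \<le> l1norm H f + l1norm H g"
  using assms by (simp add: l1norm_def sum.distrib[symmetric] sum_mono)

lemma l1norm_scale: "l1norm H (\<lambda>x. c * f x) = \<bar>c\<bar> * l1norm H f"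
  by (simp add: l1norm_def sum_distrib_left abs_mult)

lemma (in group) sum_translate:
  assumes "a \<in> carrier G"
  shows "(\<Sum>x\<in>carrier G. f (inv a \<otimes> x)) = (\<Sum>x\<in>carrier G. f x)"
  using assms
  by (intro sum.reindex_bij_witness[where i="\<lambda>x. a \<otimes> x" and j="\<lambda>x. inv a \<otimes> x"])
    (auto simp: m_assoc[symmetric])

text \<open>After the sums are exchanged, the inner one runs over a translate of the whole group, so
  it equals \<open>l1norm H g\<close> whatever \<open>y\<close> is.\<close>

lemma l1norm_conv:
  assumes "group H"
  shows "l1norm H (fin_conv H f g) \<le> l1norm H f * l1norm H g"
proof -
  interpret group H by fact
  have "l1norm H (fin_conv H f g) \<le> (\<Sum>x\<in>carrier H. \<Sum>y\<in>carrier H. \<bar>f y\<bar> * \<bar>g (inv\<^bsub>H\<^esub> y \<otimes>\<^bsub>H\<^esub> x)\<bar>)"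
    unfolding l1norm_def fin_conv_def
    by (intro sum_mono order.trans[OF sum_abs]) (simp add: abs_mult)
  also have "\<dots> = (\<Sum>y\<in>carrier H. \<bar>f y\<bar> * (\<Sum>x\<in>carrier H. \<bar>g (inv\<^bsub>H\<^esub> y \<otimes>\<^bsub>H\<^esub> x)\<bar>))"
    by (subst sum.swap) (simp add: sum_distrib_left)
  also have "\<dots> = l1norm H f * l1norm H g"
    using sum_translate[where f="\<lambda>x. \<bar>g x\<bar>"] by (simp add: l1norm_def sum_distrib_right)
  finally show ?thesis .
qed

text \<open>Bilinear telescoping: each term puts the difference into one factor and keeps the other,
  so close bounded families have close products.\<close>

lemma fin_conv_diff:
  "fin_conv H f g x - fin_conv H f' g' x =
    fin_conv H (\<lambda>x. f x - f' x) g x + fin_conv H f' (\<lambda>x. g x - g' x) x"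
  by (simp add: fin_conv_def sum_subtractf[symmetric] sum.distrib[symmetric] algebra_simps)

text \<open>Nontriviality of \<open>D\<close> makes limits along \<open>D\<close> unique, as the
  \<open>Lim\<close> in the ultraproduct norm requires.\<close>

locale finite_group_sequence =
  fixes H :: "nat \<Rightarrow> 'b monoid" and D :: "nat filter"
  assumes grp: "\<And>n. group (H n)" and fin: "\<And>n. finite (carrier (H n))"
    and nontriv: "D \<noteq> bot"
begin

abbreviation urel where "urel \<equiv> ultra_rel D (\<lambda>n. l1_conv (H n))"

abbreviation bfam where "bfam \<equiv> bounded_families (\<lambda>n. l1_conv (H n))"

abbreviation hcls where "hcls n \<equiv> L1_class (count_space (carrier (H n)))"

text \<open>Every bounded family of classes has this form, so the ultraproduct can be handled
  through functions instead of classes of families of classes.\<close>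

definition fam :: "(nat \<Rightarrow> 'b \<Rightarrow> real) \<Rightarrow> nat \<Rightarrow> ('b \<Rightarrow> real) set" where
  "fam \<phi> n = hcls n (\<phi> n)"

definition bdd :: "(nat \<Rightarrow> 'b \<Rightarrow> real) \<Rightarrow> bool" where
  "bdd \<phi> \<longleftrightarrow> (\<exists>C. \<forall>n. l1norm (H n) (\<phi> n) \<le> C)"

definition ucls :: "(nat \<Rightarrow> 'b \<Rightarrow> real) \<Rightarrow> (nat \<Rightarrow> ('b \<Rightarrow> real) set) set" where
  "ucls \<phi> = urel `` {fam \<phi>}"

abbreviation UP where "UP \<equiv> ultraproduct D (\<lambda>n. l1_conv (H n))"

definition close :: "(nat \<Rightarrow> 'b \<Rightarrow> real) \<Rightarrow> (nat \<Rightarrow> 'b \<Rightarrow> real) \<Rightarrow> bool" where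
  "close \<phi> \<psi> \<longleftrightarrow> ((\<lambda>n. l1norm (H n) (\<lambda>x. \<phi> n x - \<psi> n x)) \<longlongrightarrow> 0) D"

lemma fam_bounded_iff: "fam \<phi> \<in> bfam \<longleftrightarrow> bdd \<phi>"
  unfolding bounded_families_def bdd_def fam_def
  by (simp add: cnv_carrier_l1[OF fin] l1_norm[OF fin] l1norm_def)

lemma bounded_family_is_fam:
  assumes "x \<in> bfam"
  obtains \<phi> where "x = fam \<phi>" "bdd \<phi>"
proof -
  have "\<forall>n. \<exists>f. x n = hcls n f"
    using assms by (simp add: bounded_families_def cnv_carrier_l1[OF fin] image_iff)
  then obtain \<phi> where "\<And>n. x n = hcls n (\<phi> n)" by metis
  then have "x = fam \<phi>" by (auto simp: fam_def)
  with that assms fam_bounded_iff show thesis by metis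
qed

lemma fam_ultra_rel_iff:
  "(fam \<phi>, fam \<psi>) \<in> urel \<longleftrightarrow> bdd \<phi> \<and> bdd \<psi> \<and> close \<phi> \<psi>"
  unfolding ultra_rel_def by (simp add: fam_bounded_iff close_def l1norm_def) (simp add: fam_def l1_dist[OF fin])

lemma close_refl: "close \<phi> \<phi>"
  by (simp add: close_def l1norm_def)

lemma close_sym: "close \<phi> \<psi> \<Longrightarrow> close \<psi> \<phi>"
  by (simp add: close_def l1norm_def abs_minus_commute)

lemma closeI:
  assumes "\<And>n. l1norm (H n) (\<lambda>x. \<phi> n x - \<psi> n x) \<le> e n" "(e \<longlongrightarrow> 0) D"
  shows "close \<phi> \<psi>"
  unfolding close_def
  by (rule tendsto_sandwich[OF _ _ tendsto_const assms(2)]) (simp_all add: l1norm_nonneg assms(1))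

lemma close_trans:
  assumes "close \<phi> \<psi>" "close \<psi> \<theta>"
  shows "close \<phi> \<theta>"
proof (rule closeI)
  show "l1norm (H n) (\<lambda>x. \<phi> n x - \<theta> n x) \<le>
      l1norm (H n) (\<lambda>x. \<phi> n x - \<psi> n x) + l1norm (H n) (\<lambda>x. \<psi> n x - \<theta> n x)" for n
    by (rule l1norm_bound2) auto
  show "((\<lambda>n. l1norm (H n) (\<lambda>x. \<phi> n x - \<psi> n x) + l1norm (H n) (\<lambda>x. \<psi> n x - \<theta> n x)) \<longlongrightarrow> 0) D"
    using tendsto_add[OF assms[unfolded close_def]] by simp
qed

lemma equiv_ultra_rel:
  "equiv (bfam) (urel)"
proof (rule equivI)
  show "urel \<subseteq>
    bfam \<times> bfam"
    by (auto simp: ultra_rel_def)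
  show "refl_on (bfam) (urel)"
  proof (rule refl_onI)
    fix x assume "x \<in> bfam"
    then show "(x, x) \<in> urel"
      by (elim bounded_family_is_fam) (simp add: fam_ultra_rel_iff close_refl)
  qed
  show "sym (urel)"
  proof (rule symI)
    fix x y assume *: "(x, y) \<in> urel"
    then obtain \<phi> \<psi> where "x = fam \<phi>" "y = fam \<psi>"
      by (auto simp: ultra_rel_def elim!: bounded_family_is_fam)
    then show "(y, x) \<in> urel"
      using * by (simp add: fam_ultra_rel_iff close_sym)
  qed
  show "trans (urel)"
  proof (rule transI)
    fix x y z
    assume *: "(x, y) \<in> urel" "(y, z) \<in> urel"
    then obtain \<phi> \<psi> \<theta> where "x = fam \<phi>" "y = fam \<psi>" "z = fam \<theta>"
      unfolding ultra_rel_def by simp (metis bounded_family_is_fam)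
    then show "(x, z) \<in> urel"
      using * by (auto simp: fam_ultra_rel_iff intro: close_trans)
  qed
qed

lemma ucls_eq_iff:
  assumes "bdd \<phi>" "bdd \<psi>"
  shows "ucls \<phi> = ucls \<psi> \<longleftrightarrow> close \<phi> \<psi>"
  unfolding ucls_def
  using eq_equiv_class_iff[OF equiv_ultra_rel, of "fam \<phi>" "fam \<psi>"] assms
  by (simp add: fam_bounded_iff fam_ultra_rel_iff)

lemma mem_uclsE:
  assumes "x \<in> ucls \<phi>"
  obtains \<psi> where "x = fam \<psi>" "bdd \<psi>" "close \<phi> \<psi>"
proof -
  have "(fam \<phi>, x) \<in> urel" using assms by (simp add: ucls_def)
  moreover then obtain \<psi> where "x = fam \<psi>"
    by (auto simp: ultra_rel_def elim!: bounded_family_is_fam)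
  ultimately show thesis using that by (simp add: fam_ultra_rel_iff)
qed

lemma fam_mem_ucls: "bdd \<phi> \<Longrightarrow> fam \<phi> \<in> ucls \<phi>"
  by (simp add: ucls_def fam_ultra_rel_iff close_refl)

lemma ucls_in_carrier: "bdd \<phi> \<Longrightarrow> ucls \<phi> \<in> cnv_carrier UP"
  by (simp add: ultraproduct_def ucls_def quotientI fam_bounded_iff)

lemma ultraproduct_zero: "cnv_zero UP = ucls (\<lambda>n x. 0)"
  by (simp add: ultraproduct_def ucls_def fam_def[abs_def] l1_zero[OF fin])

text \<open>An operation that keeps families bounded and respects \<open>close\<close> sends all
  members of \<open>ucls \<phi>\<close> to the same class, so the union over them collapses.\<close>

lemma ultraproduct_lift:
  assumes op: "\<And>n f. A n (hcls n f) =
      hcls n (F n f)"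
    and bd: "\<And>\<phi>. bdd \<phi> \<Longrightarrow> bdd (\<lambda>n. F n (\<phi> n))"
    and cl: "\<And>\<phi> \<phi>'. bdd \<phi> \<Longrightarrow> bdd \<phi>' \<Longrightarrow> close \<phi> \<phi>' \<Longrightarrow>
       close (\<lambda>n. F n (\<phi> n)) (\<lambda>n. F n (\<phi>' n))"
    and "bdd \<phi>"
  shows "(\<Union>x\<in>ucls \<phi>. urel `` {\<lambda>i. A i (x i)}) =
    ucls (\<lambda>n. F n (\<phi> n))"
proof -
  have "urel `` {\<lambda>i. A i (x i)} = ucls (\<lambda>n. F n (\<phi> n))"
    if x: "x \<in> ucls \<phi>" for x
  proof -
    obtain \<phi>' where x: "x = fam \<phi>'" "bdd \<phi>'" "close \<phi> \<phi>'" by (rule mem_uclsE[OF x])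
    have "(\<lambda>i. A i (x i)) = fam (\<lambda>n. F n (\<phi>' n))"
      by (auto simp: fam_def x op)
    then have "urel `` {\<lambda>i. A i (x i)} = ucls (\<lambda>n. F n (\<phi>' n))"
      by (simp add: ucls_def)
    also have "\<dots> = ucls (\<lambda>n. F n (\<phi> n))"
      using x assms by (subst ucls_eq_iff) (auto intro: close_sym)
    finally show ?thesis .
  qed
  then show ?thesis using fam_mem_ucls[OF \<open>bdd \<phi>\<close>] by blast
qed

lemma ultraproduct_lift2:
  assumes op: "\<And>n f g. A n (hcls n f) (hcls n g) =
      hcls n (F n f g)"
    and bd: "\<And>\<phi> \<psi>. bdd \<phi> \<Longrightarrow> bdd \<psi> \<Longrightarrow> bdd (\<lambda>n. F n (\<phi> n) (\<psi> n))"
    and cl: "\<And>\<phi> \<psi> \<phi>' \<psi>'. bdd \<phi> \<Longrightarrow> bdd \<psi> \<Longrightarrow> bdd \<phi>' \<Longrightarrow> bdd \<psi>' \<Longrightarrow> close \<phi> \<phi>' \<Longrightarrow> close \<psi> \<psi>' \<Longrightarrow>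
       close (\<lambda>n. F n (\<phi> n) (\<psi> n)) (\<lambda>n. F n (\<phi>' n) (\<psi>' n))"
    and bdd: "bdd \<phi>" "bdd \<psi>"
  shows "(\<Union>x\<in>ucls \<phi>. \<Union>y\<in>ucls \<psi>. urel `` {\<lambda>i. A i (x i) (y i)}) =
    ucls (\<lambda>n. F n (\<phi> n) (\<psi> n))"
proof -
  have "urel `` {\<lambda>i. A i (x i) (y i)} = ucls (\<lambda>n. F n (\<phi> n) (\<psi> n))"
    if x: "x \<in> ucls \<phi>" and y: "y \<in> ucls \<psi>" for x y
  proof -
    obtain \<phi>' where x: "x = fam \<phi>'" "bdd \<phi>'" "close \<phi> \<phi>'" by (rule mem_uclsE[OF x])
    obtain \<psi>' where y: "y = fam \<psi>'" "bdd \<psi>'" "close \<psi> \<psi>'" by (rule mem_uclsE[OF y])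
    have "(\<lambda>i. A i (x i) (y i)) = fam (\<lambda>n. F n (\<phi>' n) (\<psi>' n))"
      by (auto simp: fam_def x y op)
    then have "urel `` {\<lambda>i. A i (x i) (y i)} = ucls (\<lambda>n. F n (\<phi>' n) (\<psi>' n))"
      by (simp add: ucls_def)
    also have "\<dots> = ucls (\<lambda>n. F n (\<phi> n) (\<psi> n))"
      using x y bdd by (subst ucls_eq_iff) (auto intro: close_sym bd cl)
    finally show ?thesis .
  qed
  then show ?thesis using fam_mem_ucls[OF bdd(1)] fam_mem_ucls[OF bdd(2)] by blast
qed

text \<open>Covers addition and both lattice operations at once. The Lipschitz bound gives closeness
  directly, and compared with the point \<open>(0, 0)\<close>, where \<open>F\<close> vanishes, it
  also gives boundedness.\<close>

lemma ultraproduct_lipschitz: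
  assumes op: "\<And>n f g. A n (hcls n f) (hcls n g) =
      hcls n (\<lambda>x. F (f x) (g x))"
    and lip: "\<And>a b a' b'. \<bar>F a b - F a' b'\<bar> \<le> \<bar>a - a'\<bar> + \<bar>b - b'\<bar>" and F0: "F 0 0 = 0"
    and bdd: "bdd \<phi>" "bdd \<psi>"
  shows "(\<Union>x\<in>ucls \<phi>. \<Union>y\<in>ucls \<psi>. urel `` {\<lambda>i. A i (x i) (y i)}) =
    ucls (\<lambda>n x. F (\<phi> n x) (\<psi> n x))"
proof (rule ultraproduct_lift2[where F="\<lambda>n f g x. F (f x) (g x)", OF op _ _ bdd])
  fix \<phi> \<psi> assume "bdd \<phi>" "bdd \<psi>"
  then obtain C C' where C: "\<And>n. l1norm (H n) (\<phi> n) \<le> C" "\<And>n. l1norm (H n) (\<psi> n) \<le> C'"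
    by (auto simp: bdd_def)
  have "l1norm (H n) (\<lambda>x. F (\<phi> n x) (\<psi> n x)) \<le> C + C'" for n
  proof -
    have "l1norm (H n) (\<lambda>x. F (\<phi> n x) (\<psi> n x)) \<le> l1norm (H n) (\<phi> n) + l1norm (H n) (\<psi> n)"
      using lip[of _ _ 0 0] by (intro l1norm_bound2) (simp add: F0)
    with C[of n] show ?thesis by linarith
  qed
  then show "bdd (\<lambda>n x. F (\<phi> n x) (\<psi> n x))" by (auto simp: bdd_def)
next
  fix \<phi> \<psi> \<phi>' \<psi>' assume "close \<phi> \<phi>'" "close \<psi> \<psi>'"
  then show "close (\<lambda>n x. F (\<phi> n x) (\<psi> n x)) (\<lambda>n x. F (\<phi>' n x) (\<psi>' n x))"
    by (intro closeI[where e="\<lambda>n. l1norm (H n) (\<lambda>x. \<phi> n x - \<phi>' n x) + l1norm (H n) (\<lambda>x. \<psi> n x - \<psi>' n x)"])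
      (auto simp: close_def intro!: l1norm_bound2 lip tendsto_add_zero)
qed

lemma ultraproduct_add:
  assumes "bdd \<phi>" "bdd \<psi>"
  shows "cnv_add UP (ucls \<phi>) (ucls \<psi>) = ucls (\<lambda>n x. \<phi> n x + \<psi> n x)"
  unfolding ultraproduct_def cnv_structure.simps
  by (rule ultraproduct_lipschitz[where F="(+)", OF l1_add[OF fin] _ _ assms]) auto

lemma ultraproduct_inf:
  assumes "bdd \<phi>" "bdd \<psi>"
  shows "cnv_inf UP (ucls \<phi>) (ucls \<psi>) = ucls (\<lambda>n x. min (\<phi> n x) (\<psi> n x))"
  unfolding ultraproduct_def cnv_structure.simps
  by (rule ultraproduct_lipschitz[where F="min", OF l1_inf[OF fin] _ _ assms]) (auto simp: min_def)

lemma ultraproduct_sup: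
  assumes "bdd \<phi>" "bdd \<psi>"
  shows "cnv_sup UP (ucls \<phi>) (ucls \<psi>) = ucls (\<lambda>n x. max (\<phi> n x) (\<psi> n x))"
  unfolding ultraproduct_def cnv_structure.simps
  by (rule ultraproduct_lipschitz[where F="max", OF l1_sup[OF fin] _ _ assms]) (auto simp: max_def)

lemma bdd_scale: "bdd \<phi> \<Longrightarrow> bdd (\<lambda>n x. c * \<phi> n x)"
  unfolding bdd_def l1norm_scale by (meson abs_ge_zero mult_left_mono)

lemma ultraproduct_scale:
  assumes "bdd \<phi>"
  shows "cnv_scale UP c (ucls \<phi>) = ucls (\<lambda>n x. c * \<phi> n x)"
  unfolding ultraproduct_def cnv_structure.simps
proof (rule ultraproduct_lift[where F="\<lambda>n f x. c * f x", OF l1_scale[OF fin] bdd_scale _ assms])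
  fix \<phi> \<phi>' assume *: "close \<phi> \<phi>'"
  have "l1norm (H n) (\<lambda>x. c * \<phi> n x - c * \<phi>' n x) = \<bar>c\<bar> * l1norm (H n) (\<lambda>x. \<phi> n x - \<phi>' n x)" for n
    by (simp flip: l1norm_scale right_diff_distrib)
  then show "close (\<lambda>n x. c * \<phi> n x) (\<lambda>n x. c * \<phi>' n x)"
    using * by (auto simp: close_def intro: tendsto_mult_right_zero)
qed

text \<open>Submultiplicativity of the norm bounds the product family; in the telescoped difference
  each term has one bounded and one vanishing factor.\<close>

lemma ultraproduct_conv:
  assumes "bdd \<phi>" "bdd \<psi>"
  shows "cnv_conv UP (ucls \<phi>) (ucls \<psi>) = ucls (\<lambda>n. fin_conv (H n) (\<phi> n) (\<psi> n))"
  unfolding ultraproduct_def cnv_structure.simps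
proof (rule ultraproduct_lift2[where F="\<lambda>n. fin_conv (H n)", OF _ _ _ assms])
  fix n f g
  show "cnv_conv (l1_conv (H n)) (hcls n f) (hcls n g) =
      hcls n (fin_conv (H n) f g)"
    unfolding l1_convolution[OF fin grp] fin_conv_def ..
next
  fix \<phi> \<psi> assume "bdd \<phi>" "bdd \<psi>"
  then obtain C C' where C: "\<And>n. l1norm (H n) (\<phi> n) \<le> C" "\<And>n. l1norm (H n) (\<psi> n) \<le> C'"
    by (auto simp: bdd_def)
  have "0 \<le> C" using C(1)[of 0] l1norm_nonneg[of "H 0" "\<phi> 0"] by linarith
  then have "l1norm (H n) (fin_conv (H n) (\<phi> n) (\<psi> n)) \<le> C * C'" for n
    by (intro order.trans[OF l1norm_conv[OF grp]] mult_mono C l1norm_nonneg)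
  then show "bdd (\<lambda>n. fin_conv (H n) (\<phi> n) (\<psi> n))" by (auto simp: bdd_def)
next
  fix \<phi> \<psi> \<phi>' \<psi>' assume "bdd \<phi>'" "bdd \<psi>" and cl: "close \<phi> \<phi>'" "close \<psi> \<psi>'"
  then obtain C C' where C: "\<And>n. l1norm (H n) (\<phi>' n) \<le> C" "\<And>n. l1norm (H n) (\<psi> n) \<le> C'"
    by (auto simp: bdd_def)
  have "0 \<le> C" using C(1)[of 0] l1norm_nonneg[of "H 0" "\<phi>' 0"] by linarith
  show "close (\<lambda>n. fin_conv (H n) (\<phi> n) (\<psi> n)) (\<lambda>n. fin_conv (H n) (\<phi>' n) (\<psi>' n))"
  proof (rule closeI)
    fix n
    have "l1norm (H n) (\<lambda>x. fin_conv (H n) (\<phi> n) (\<psi> n) x - fin_conv (H n) (\<phi>' n) (\<psi>' n) x) \<le>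
       l1norm (H n) (\<lambda>x. \<phi> n x - \<phi>' n x) * l1norm (H n) (\<psi> n) + l1norm (H n) (\<phi>' n) * l1norm (H n) (\<lambda>x. \<psi> n x - \<psi>' n x)"
      unfolding fin_conv_diff
      by (intro order.trans[OF l1norm_triangle] add_mono l1norm_conv grp)
    also have "\<dots> \<le> l1norm (H n) (\<lambda>x. \<phi> n x - \<phi>' n x) * C' + C * l1norm (H n) (\<lambda>x. \<psi> n x - \<psi>' n x)"
      by (intro add_mono mult_mono C l1norm_nonneg order_refl \<open>0 \<le> C\<close>)
    finally show "l1norm (H n) (\<lambda>x. fin_conv (H n) (\<phi> n) (\<psi> n) x - fin_conv (H n) (\<phi>' n) (\<psi>' n) x) \<le>
       l1norm (H n) (\<lambda>x. \<phi> n x - \<phi>' n x) * C' + C * l1norm (H n) (\<lambda>x. \<psi> n x - \<psi>' n x)" .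
  next
    show "((\<lambda>n. l1norm (H n) (\<lambda>x. \<phi> n x - \<phi>' n x) * C' + C * l1norm (H n) (\<lambda>x. \<psi> n x - \<psi>' n x)) \<longlongrightarrow> 0) D"
      using cl unfolding close_def
      by (intro tendsto_add_zero tendsto_mult_left_zero tendsto_mult_right_zero)
  qed
qed

text \<open>By the reverse triangle inequality, close families have norms with the same limit, so
  \<open>the_elem\<close> in the definition of the norm is applied to a singleton.\<close>

lemma ultraproduct_norm:
  assumes "bdd \<phi>" and lim: "((\<lambda>n. l1norm (H n) (\<phi> n)) \<longlongrightarrow> c) D"
  shows "cnv_norm UP (ucls \<phi>) = c"
proof -
  have "Lim D (\<lambda>i. cnv_norm (l1_conv (H i)) (x i)) = c" if x: "x \<in> ucls \<phi>" for x
  proof -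
    obtain \<psi> where x: "x = fam \<psi>" "bdd \<psi>" "close \<phi> \<psi>" by (rule mem_uclsE[OF x])
    have "\<bar>l1norm (H n) (\<psi> n) - l1norm (H n) (\<phi> n)\<bar> \<le> l1norm (H n) (\<lambda>x. \<phi> n x - \<psi> n x)" for n
    proof -
      have "l1norm (H n) (\<psi> n) \<le> l1norm (H n) (\<phi> n) + l1norm (H n) (\<lambda>x. \<phi> n x - \<psi> n x)"
        "l1norm (H n) (\<phi> n) \<le> l1norm (H n) (\<psi> n) + l1norm (H n) (\<lambda>x. \<phi> n x - \<psi> n x)"
        by (rule l1norm_bound2; simp)+
      then show ?thesis by linarith
    qed
    then have "((\<lambda>n. l1norm (H n) (\<psi> n) - l1norm (H n) (\<phi> n)) \<longlongrightarrow> 0) D"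
      by (intro Lim_null_comparison[OF always_eventually x(3)[unfolded close_def]]) simp
    from tendsto_add[OF this lim] have "((\<lambda>n. l1norm (H n) (\<psi> n)) \<longlongrightarrow> c) D" by simp
    moreover have "cnv_norm (l1_conv (H i)) (x i) = l1norm (H i) (\<psi> i)" for i
      by (simp add: x fam_def l1_norm[OF fin] l1norm_def)
    ultimately show ?thesis using tendsto_Lim[OF nontriv] by simp
  qed
  then have "(\<lambda>x. Lim D (\<lambda>i. cnv_norm (l1_conv (H i)) (x i))) ` ucls \<phi> = (\<lambda>_. c) ` ucls \<phi>"
    by (rule image_cong[OF refl])
  also have "\<dots> = {c}" by (rule image_constant) (rule fam_mem_ucls[OF assms(1)])
  finally show ?thesis by (simp add: ultraproduct_def)
qed

end

section \<open>Haar measure on abelian groups\<close>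

locale topological_abelian_group = comm_group G for G :: "('a, 'm) monoid_scheme" (structure) +
  fixes T :: "'a topology"
  assumes top: "topspace T = carrier G"
    and cmult: "continuous_map (prod_topology T T) T (\<lambda>(x, y). x \<otimes> y)"
    and cinv: "continuous_map T T (\<lambda>x. inv x)"
begin

lemma continuous_translate: "g \<in> carrier G \<Longrightarrow> continuous_map T T (\<lambda>x. g \<otimes> x)"
  using continuous_map_compose[OF _ cmult, of T "\<lambda>x. (g, x)"]
  by (simp add: continuous_map_pairedI top o_def)

lemma openin_translate_vimage:
  assumes "g \<in> carrier G" "openin T V"
  shows "openin T {x \<in> carrier G. g \<otimes> x \<in> V}"
  using continuous_translate[OF assms(1)] assms(2) by (simp add: continuous_map_def top)

lemma openin_translate:
  assumes g: "g \<in> carrier G" and V: "openin T V"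
  shows "openin T ((\<lambda>x. g \<otimes> x) ` V)"
proof -
  have "V \<subseteq> carrier G" using openin_subset[OF V] top by simp
  have "(\<lambda>x. g \<otimes> x) ` V = {x \<in> carrier G. inv g \<otimes> x \<in> V}"
  proof (intro equalityI subsetI)
    fix x assume "x \<in> (\<lambda>x. g \<otimes> x) ` V"
    then show "x \<in> {x \<in> carrier G. inv g \<otimes> x \<in> V}"
      using g \<open>V \<subseteq> carrier G\<close> by (auto simp: m_assoc[symmetric] subset_iff)
  next
    fix x assume "x \<in> {x \<in> carrier G. inv g \<otimes> x \<in> V}"
    then have "x = g \<otimes> (inv g \<otimes> x)" "inv g \<otimes> x \<in> V" using g by (auto simp: m_assoc[symmetric])
    then show "x \<in> (\<lambda>x. g \<otimes> x) ` V" by (rule image_eqI)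
  qed
  then show ?thesis using openin_translate_vimage[OF _ V, of "inv g"] g by simp
qed

text \<open>Open rectangles form a basis of the product topology; intersecting the two sides gives
  one neighbourhood for both arguments.\<close>

lemma openin_nbhd_pair:
  assumes F: "continuous_map (prod_topology T T) T F" and V: "openin T V" "F (\<one>, \<one>) \<in> V"
  obtains W where "openin T W" "\<one> \<in> W" "\<And>x y. x \<in> W \<Longrightarrow> y \<in> W \<Longrightarrow> F (x, y) \<in> V"
proof -
  define Z where "Z = {z \<in> topspace (prod_topology T T). F z \<in> V}"
  have Z1: "openin (prod_topology T T) Z"
    unfolding Z_def using F V by (simp add: continuous_map_def)
  have Z2: "(\<one>, \<one>) \<in> Z"
    unfolding Z_def using V by (simp add: top)
  obtain W1 W2 where W: "openin T W1" "openin T W2" "\<one> \<in> W1" "\<one> \<in> W2" "W1 \<times> W2 \<subseteq> Z"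
    using Z1[unfolded openin_prod_topology_alt, rule_format, OF Z2] by (elim exE conjE)
  show thesis
  proof (rule that[of "W1 \<inter> W2"])
    show "openin T (W1 \<inter> W2)" "\<one> \<in> W1 \<inter> W2" using W by auto
    fix x y assume "x \<in> W1 \<inter> W2" "y \<in> W1 \<inter> W2"
    then have "(x, y) \<in> W1 \<times> W2" by simp
    from subsetD[OF W(5) this] show "F (x, y) \<in> V" by (simp add: Z_def)
  qed
qed

lemma continuous_div: "continuous_map (prod_topology T T) T (\<lambda>(x, y). x \<otimes> inv y)"
proof -
  have "continuous_map (prod_topology T T) (prod_topology T T) (\<lambda>z. (fst z, inv (snd z)))"
    using continuous_map_compose[OF continuous_map_snd cinv, of T]
    by (intro continuous_map_pairedI continuous_map_fst) (simp_all add: o_def)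
  from continuous_map_compose[OF this cmult]
  show ?thesis by (simp add: o_def case_prod_beta')
qed

end

locale haar_measure_group = topological_abelian_group G T
  for G :: "('a, 'm) monoid_scheme" (structure) and T +
  fixes \<mu> :: "'a measure"
  assumes haus: "Hausdorff_space T"
    and sc: "second_countable T"
    and haar: "left_haar_measure G T \<mu>"
begin

lemma space_mu: "space \<mu> = carrier G"
  using haar top by (simp add: left_haar_measure_def)

lemma sets_mu: "sets \<mu> = sigma_sets (carrier G) {U. openin T U}"
  using haar top by (simp add: left_haar_measure_def)

lemma open_in_sets: "openin T U \<Longrightarrow> U \<in> sets \<mu>"
  unfolding sets_mu by (rule sigma_sets.Basic) simp

lemma compact_in_sets:
  assumes "compactin T K" shows "K \<in> sets \<mu>"
proof -
  have "closedin T K" using assms haus by (rule compactin_imp_closedin[rotated])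
  then have "openin T (topspace T - K)" "K \<subseteq> topspace T"
    by (auto simp: closedin_def)
  then have "space \<mu> - (topspace T - K) \<in> sets \<mu>" by (intro sets.compl_sets open_in_sets)
  moreover have "space \<mu> - (topspace T - K) = K" using \<open>K \<subseteq> topspace T\<close> by (auto simp: space_mu top)
  ultimately show ?thesis by simp
qed

lemma compact_finite: "compactin T K \<Longrightarrow> emeasure \<mu> K < \<infinity>"
  using haar by (simp add: left_haar_measure_def)

lemma mu_outer_regular:
  "B \<in> sets \<mu> \<Longrightarrow> emeasure \<mu> B = (INF U\<in>{U. openin T U \<and> B \<subseteq> U}. emeasure \<mu> U)"
  using haar unfolding left_haar_measure_def by blast

lemma mu_inner_regular_open:
  "openin T U \<Longrightarrow> emeasure \<mu> U = (SUP K\<in>{K. compactin T K \<and> K \<subseteq> U}. emeasure \<mu> K)"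
  using haar unfolding left_haar_measure_def by blast

lemma mu_translate:
  "g \<in> carrier G \<Longrightarrow> B \<in> sets \<mu> \<Longrightarrow> emeasure \<mu> ((\<lambda>x. g \<otimes> x) ` B) = emeasure \<mu> B"
  using haar unfolding left_haar_measure_def by blast

lemma measurable_muI:
  assumes "f \<in> space N \<rightarrow> carrier G" "\<And>U. openin T U \<Longrightarrow> f -` U \<inter> space N \<in> sets N"
  shows "f \<in> measurable N \<mu>"
proof -
  have sub: "{U. openin T U} \<subseteq> Pow (carrier G)"
    using openin_subset[of T] top by blast
  have "f \<in> measurable N (sigma (carrier G) {U. openin T U})"
    using assms sub by (intro measurable_measure_of) auto
  also have "measurable N (sigma (carrier G) {U. openin T U}) = measurable N \<mu>"
    using sub by (intro measurable_cong_sets refl) (simp add: sets_mu)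
  finally show ?thesis .
qed

lemma continuous_measurable:
  assumes "continuous_map T T f" shows "f \<in> measurable \<mu> \<mu>"
proof (rule measurable_muI)
  show "f \<in> space \<mu> \<rightarrow> carrier G" using assms by (auto simp: continuous_map_def space_mu top)
  fix U assume "openin T U"
  then have "openin T {x \<in> topspace T. f x \<in> U}" using assms by (simp add: continuous_map_def)
  moreover have "f -` U \<inter> space \<mu> = {x \<in> topspace T. f x \<in> U}" by (auto simp: space_mu top)
  ultimately show "f -` U \<inter> space \<mu> \<in> sets \<mu>" using open_in_sets by simp
qed

text \<open>The product sigma-algebra only has to contain countable unions of measurable rectangles.
  Second countability is what reduces an open set of the product topology to such a union.\<close>

lemma continuous2_measurable:
  assumes F: "continuous_map (prod_topology T T) T F"
  shows "F \<in> measurable (\<mu> \<Otimes>\<^sub>M \<mu>) \<mu>"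
proof (rule measurable_muI)
  show "F \<in> space (\<mu> \<Otimes>\<^sub>M \<mu>) \<rightarrow> carrier G"
    using F by (auto simp: continuous_map_def space_pair_measure space_mu top)
  fix U assume U: "openin T U"
  obtain B where B: "countable B" "\<And>V. V \<in> B \<Longrightarrow> openin T V"
      "\<And>U x. openin T U \<Longrightarrow> x \<in> U \<Longrightarrow> \<exists>V\<in>B. x \<in> V \<and> V \<subseteq> U"
    using sc unfolding second_countable_def by auto
  define W where "W = F -` U \<inter> space (\<mu> \<Otimes>\<^sub>M \<mu>)"
  have W: "openin (prod_topology T T) W"
  proof -
    have "W = {z \<in> topspace (prod_topology T T). F z \<in> U}"
      by (auto simp: W_def space_pair_measure space_mu top)
    then show ?thesis using F U by (simp add: continuous_map_def)
  qed
  have "W = (\<Union>(V, V')\<in>{(V, V')\<in>B \<times> B. V \<times> V' \<subseteq> W}. V \<times> V')"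
  proof (intro equalityI subsetI)
    fix z assume "z \<in> W"
    then obtain U1 U2 where U12: "openin T U1" "openin T U2" "z \<in> U1 \<times> U2" "U1 \<times> U2 \<subseteq> W"
      using W unfolding openin_prod_topology_alt by (metis SigmaI prod.collapse)
    obtain V where V: "V \<in> B" "fst z \<in> V" "V \<subseteq> U1" using B(3)[of U1 "fst z"] U12 by auto
    obtain V' where V': "V' \<in> B" "snd z \<in> V'" "V' \<subseteq> U2" using B(3)[of U2 "snd z"] U12 by auto
    have "V \<times> V' \<subseteq> W" using V V' U12 by blast
    with V V' show "z \<in> (\<Union>(V, V')\<in>{(V, V')\<in>B \<times> B. V \<times> V' \<subseteq> W}. V \<times> V')"
      by (intro UN_I[of "(V, V')"]) (auto simp: mem_Times_iff)
  qed auto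
  also have "\<dots> \<in> sets (\<mu> \<Otimes>\<^sub>M \<mu>)"
  proof (rule sets.countable_UN')
    show "countable {(V, V')\<in>B \<times> B. V \<times> V' \<subseteq> W}"
      by (rule countable_subset[of _ "B \<times> B"]) (auto simp: B(1))
  qed (auto intro!: pair_measureI open_in_sets B(2))
  finally show "F -` U \<inter> space (\<mu> \<Otimes>\<^sub>M \<mu>) \<in> sets (\<mu> \<Otimes>\<^sub>M \<mu>)" by (simp add: W_def)
qed

end

text \<open>Sigma-finiteness, on which Fubini's theorem for the convolution kernel rests, is kept
  apart because it is derived later: from the exponential map, or from the group being a single
  point.\<close>

locale haar_group = haar_measure_group G T \<mu>
  for G :: "('a, 'm) monoid_scheme" (structure) and T \<mu> +
  assumes sf: "sigma_finite_measure \<mu>"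
begin

sublocale sigma_finite_measure \<mu> by (rule sf)
sublocale pair_sigma_finite \<mu> \<mu> by standard

lemma translate_measurable: "g \<in> carrier G \<Longrightarrow> (\<lambda>x. g \<otimes> x) \<in> measurable \<mu> \<mu>"
  by (intro continuous_measurable continuous_translate)

lemma distr_translate:
  assumes g: "g \<in> carrier G"
  shows "distr \<mu> \<mu> (\<lambda>x. g \<otimes> x) = \<mu>"
proof (rule measure_eqI)
  fix B assume "B \<in> sets (distr \<mu> \<mu> (\<lambda>x. g \<otimes> x))"
  then have B: "B \<in> sets \<mu>" by simp
  then have "B \<subseteq> carrier G" using sets.sets_into_space space_mu by auto
  \<comment> \<open>Haar invariance is stated for images; the preimage under translation by
    \<open>g\<close> is the image under translation by \<open>inv g\<close>.\<close>
  then have *: "(\<lambda>x. g \<otimes> x) -` B \<inter> space \<mu> = (\<lambda>x. inv g \<otimes> x) ` B"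
    using g by (auto simp: space_mu image_iff inv_solve_left subset_iff m_assoc[symmetric])
  show "emeasure (distr \<mu> \<mu> (\<lambda>x. g \<otimes> x)) B = emeasure \<mu> B"
    using g B by (simp add: emeasure_distr translate_measurable * mu_translate)
qed simp

lemma
  fixes f :: "'a \<Rightarrow> real"
  assumes "g \<in> carrier G" "integrable \<mu> f"
  shows integrable_translate: "integrable \<mu> (\<lambda>x. f (g \<otimes> x))"
    and integral_translate: "(\<integral>x. f (g \<otimes> x) \<partial>\<mu>) = (\<integral>x. f x \<partial>\<mu>)"
proof -
  have f: "f \<in> borel_measurable \<mu>" using assms by simp
  show "integrable \<mu> (\<lambda>x. f (g \<otimes> x))"
    using integrable_distr_eq[OF translate_measurable[OF assms(1)] f] assms
    by (simp add: distr_translate)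
  show "(\<integral>x. f (g \<otimes> x) \<partial>\<mu>) = (\<integral>x. f x \<partial>\<mu>)"
    using integral_distr[OF translate_measurable[OF assms(1)] f] assms
    by (simp add: distr_translate)
qed

section \<open>Regularity and density of step functions\<close>

lemma outer_regular:
  assumes "B \<in> sets \<mu>" "emeasure \<mu> B < \<infinity>" "e > 0"
  obtains U where "openin T U" "B \<subseteq> U" "emeasure \<mu> U < emeasure \<mu> B + ennreal e"
proof -
  have "emeasure \<mu> B = (INF U\<in>{U. openin T U \<and> B \<subseteq> U}. emeasure \<mu> U)"
    using assms by (intro mu_outer_regular)
  moreover have "emeasure \<mu> B < emeasure \<mu> B + ennreal e"
    using assms by (simp add: ennreal_add_left_cancel_less)
  ultimately have "(INF U\<in>{U. openin T U \<and> B \<subseteq> U}. emeasure \<mu> U) < emeasure \<mu> B + ennreal e"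
    by simp
  then show thesis using that by (auto simp: INF_less_iff)
qed

text \<open>A Haar measure is assumed inner regular on open sets only. For a set of finite measure
  this is extended by approximating an open superset from inside and cutting away its
  excess.\<close>

lemma inner_regular:
  assumes B: "B \<in> sets \<mu>" "emeasure \<mu> B < \<infinity>" and e: "e > (0::real)"
  obtains K where "compactin T K" "K \<subseteq> B" "measure \<mu> (B - K) < e"
proof -
  obtain U where U: "openin T U" "B \<subseteq> U" "emeasure \<mu> U < emeasure \<mu> B + ennreal (e/4)"
    using outer_regular[OF B, of "e/4"] e by auto
  have fU: "emeasure \<mu> U < \<infinity>"
    using U(3) B(2) by (metis ennreal_add_less_top ennreal_less_top infinity_ennreal_def order_less_trans)
  have UB: "U - B \<in> sets \<mu>" using U(1) open_in_sets B by auto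
  have fUB: "emeasure \<mu> (U - B) < \<infinity>"
    using emeasure_mono[of "U - B" U \<mu>] fU open_in_sets[OF U(1)] by (auto intro: le_less_trans)
  \<comment> \<open>\<open>W\<close> covers the part of \<open>U\<close> outside \<open>B\<close>,
    so removing it from a compact subset \<open>K\<close> of \<open>U\<close> lands inside
    \<open>B\<close>. The loss stays below three shares of \<open>e/4\<close>: one for
    \<open>U - K\<close> and two for \<open>W\<close>, as \<open>U - B\<close> is itself below
    \<open>e/4\<close>.\<close>
  obtain W where W: "openin T W" "U - B \<subseteq> W" "emeasure \<mu> W < emeasure \<mu> (U - B) + ennreal (e/4)"
    using outer_regular[OF UB fUB, of "e/4"] e by auto
  have fW: "emeasure \<mu> W < \<infinity>"
    using W(3) fUB by (metis ennreal_add_less_top ennreal_less_top infinity_ennreal_def order_less_trans)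
  have fm: "U \<in> fmeasurable \<mu>" "B \<in> fmeasurable \<mu>" "W \<in> fmeasurable \<mu>"
    using U(1) W(1) fU fW B open_in_sets by (auto intro!: fmeasurableI)
  have mU: "measure \<mu> U < measure \<mu> B + e/4"
  proof -
    have "ennreal (measure \<mu> U) < ennreal (measure \<mu> B + e/4)"
      using U(3) fm e by (simp add: emeasure_eq_measure2 ennreal_plus)
    then show ?thesis by (simp add: ennreal_less_iff)
  qed
  have mUB: "measure \<mu> (U - B) = measure \<mu> U - measure \<mu> B"
    using fm U(2) by (intro measurable_measure_Diff) auto
  have mW: "measure \<mu> W < measure \<mu> (U - B) + e/4"
  proof -
    have "ennreal (measure \<mu> W) < ennreal (measure \<mu> (U - B) + e/4)"
      using W(3) fm e fmeasurable_Diff[OF fm(1) B(1)] by (simp add: emeasure_eq_measure2 ennreal_plus)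
    then show ?thesis by (simp add: ennreal_less_iff)
  qed
  have "\<exists>K. compactin T K \<and> K \<subseteq> U \<and> measure \<mu> U - e/4 < measure \<mu> K"
  \<comment> \<open>Below \<open>e/4\<close> the difference is negative and \<open>ennreal\<close>
    would truncate it; the empty set serves in that case.\<close>
  proof (cases "measure \<mu> U < e/4")
    case True
    then show ?thesis by (intro exI[of _ "{}"]) auto
  next
    case False
    have "emeasure \<mu> U = (SUP K\<in>{K. compactin T K \<and> K \<subseteq> U}. emeasure \<mu> K)"
      by (rule mu_inner_regular_open[OF U(1)])
    moreover have "ennreal (measure \<mu> U - e/4) < emeasure \<mu> U"
      using fm e False by (simp add: emeasure_eq_measure2 ennreal_less_iff)
    ultimately obtain K where K: "compactin T K" "K \<subseteq> U" "ennreal (measure \<mu> U - e/4) < emeasure \<mu> K"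
      by (auto simp: less_SUP_iff)
    have "K \<in> fmeasurable \<mu>" using K compact_finite compact_in_sets by (auto intro!: fmeasurableI)
    then show ?thesis using K False by (auto simp: emeasure_eq_measure2 ennreal_less_iff)
  qed
  then obtain K where K: "compactin T K" "K \<subseteq> U" "measure \<mu> U - e/4 < measure \<mu> K" by auto
  have fK: "K \<in> fmeasurable \<mu>" using K compact_finite compact_in_sets by (auto intro!: fmeasurableI)
  have "compactin T (K \<inter> (topspace T - W))"
    using K(1) W(1) by (intro compact_Int_closedin) auto
  moreover have "K \<inter> (topspace T - W) = K - W"
    using compactin_subset_topspace[OF K(1)] by auto
  ultimately have "compactin T (K - W)" by simp
  moreover have "K - W \<subseteq> B" using K(2) W(2) by auto
  moreover have "measure \<mu> (B - (K - W)) < e"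
  proof -
    have "measure \<mu> (B - (K - W)) \<le> measure \<mu> ((U - K) \<union> W)"
      using fm fK U(2) by (intro measure_mono_fmeasurable) auto
    also have "\<dots> \<le> measure \<mu> (U - K) + measure \<mu> W"
      using fm fK by (intro measure_Un_le) auto
    also have "measure \<mu> (U - K) = measure \<mu> U - measure \<mu> K"
      using fm fK K(2) by (intro measurable_measure_Diff) auto
    finally show ?thesis using K(3) mW mUB mU e by linarith
  qed
  ultimately show thesis by (rule that)
qed

text \<open>Each index \<open>y\<close> is also the value on \<open>K y\<close>. Disjoint compact
  pieces make the positive and the negative support disjoint and compact, the form in which
  separation is applied.\<close>

definition step :: "('a \<Rightarrow> real) \<Rightarrow> bool" where
  "step f \<longleftrightarrow> (\<exists>F K. finite F \<and> (\<forall>y\<in>F. compactin T (K y)) \<and> disjoint_family_on K F \<and>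
     f = (\<lambda>x. \<Sum>y\<in>F. y * indicator (K y) x))"

lemma integrable_indicator_compact: "compactin T K \<Longrightarrow> integrable \<mu> (indicator K :: 'a \<Rightarrow> real)"
  using compact_finite compact_in_sets by (auto simp: integrable_indicator_iff)

lemma step_integrable: "step f \<Longrightarrow> integrable \<mu> f"
  unfolding step_def
  by (auto intro!: Bochner_Integration.integrable_sum integrable_mult_right integrable_indicator_compact)

text \<open>Simple functions bounded by \<open>2 * \<bar>f x\<bar>\<close> converge in L^1 by
  dominated convergence; each level set of one of them is then shrunk to a compact set.\<close>

lemma step_dense:
  assumes f: "integrable \<mu> f" and e: "e > 0"
  obtains g where "step g" "(\<integral>x. \<bar>f x - g x\<bar> \<partial>\<mu>) < e"
proof -
  have fm: "f \<in> borel_measurable \<mu>" using f by simp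
  obtain s where s: "\<And>i. simple_function \<mu> (s i)" "\<And>x. x \<in> space \<mu> \<Longrightarrow> (\<lambda>i. s i x) \<longlonglongrightarrow> f x"
     "\<And>i x. x \<in> space \<mu> \<Longrightarrow> \<bar>s i x\<bar> \<le> 2 * \<bar>f x\<bar>"
    using borel_measurable_implies_sequence_metric[OF fm, of 0] by (fastforce simp: dist_norm)
  have sm: "s i \<in> borel_measurable \<mu>" for i by (rule borel_measurable_simple_function[OF s(1)])
  have "(\<lambda>i. \<integral>x. \<bar>f x - s i x\<bar> \<partial>\<mu>) \<longlonglongrightarrow> (\<integral>x. 0 \<partial>\<mu>)"
  proof (rule integral_dominated_convergence[where w="\<lambda>x. 3 * \<bar>f x\<bar>"])
    show "AE x in \<mu>. (\<lambda>i. \<bar>f x - s i x\<bar>) \<longlonglongrightarrow> 0"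
    proof (rule AE_I2)
      fix x assume "x \<in> space \<mu>"
      then have "(\<lambda>i. \<bar>f x - s i x\<bar>) \<longlonglongrightarrow> \<bar>f x - f x\<bar>" by (intro tendsto_intros s(2))
      then show "(\<lambda>i. \<bar>f x - s i x\<bar>) \<longlonglongrightarrow> 0" by simp
    qed
    show "AE x in \<mu>. norm \<bar>f x - s i x\<bar> \<le> 3 * \<bar>f x\<bar>" for i
    proof (rule AE_I2)
      fix x assume "x \<in> space \<mu>"
      from s(3)[OF this, of i] show "norm \<bar>f x - s i x\<bar> \<le> 3 * \<bar>f x\<bar>" by simp
    qed
  qed (use f fm sm in auto)
  then have "(\<lambda>i. \<integral>x. \<bar>f x - s i x\<bar> \<partial>\<mu>) \<longlonglongrightarrow> 0" by simp
  then have "eventually (\<lambda>i. (\<integral>x. \<bar>f x - s i x\<bar> \<partial>\<mu>) < e/2) sequentially"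
    by (rule order_tendstoD) (use e in simp)
  then obtain i where i: "(\<integral>x. \<bar>f x - s i x\<bar> \<partial>\<mu>) < e/2"
    by (auto simp: eventually_sequentially)
  define t where "t = s i"
  have ti: "integrable \<mu> t" unfolding t_def
    by (rule Bochner_Integration.integrable_bound[of _ "\<lambda>x. 2 * \<bar>f x\<bar>"]) (use f sm s(3) in \<open>auto intro!: AE_I2\<close>)
  \<comment> \<open>The value 0 is left out: its level set may have infinite measure and contributes
    nothing to \<open>t\<close>.\<close>
  define F where "F = t ` space \<mu> - {0}"
  have finF: "finite F" using s(1)[of i] by (simp add: F_def t_def simple_function_def)
  define A where "A y = t -` {y} \<inter> space \<mu>" for y
  have Am: "A y \<in> sets \<mu>" for y
    using sm[of i] unfolding A_def t_def by measurable
  have Af: "emeasure \<mu> (A y) < \<infinity>" if "y \<in> F" for y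
  proof -
    have "integrable \<mu> (\<lambda>x. indicator (A y) x * t x)"
      using integrable_mult_indicator[OF Am ti] by simp
    moreover have "indicator (A y) x * t x = y * indicator (A y) x" for x
      by (auto simp: A_def indicator_def)
    ultimately have "integrable \<mu> (\<lambda>x. y * indicator (A y) x :: real)" by simp
    then show ?thesis using that Am by (simp add: F_def integrable_indicator_iff)
  qed
  \<comment> \<open>Each level set may lose measure \<open>e / (2 * M)\<close>, weighted by its
    value. The added 1 keeps \<open>M\<close> positive and makes the total loss, at most
    \<open>(M - 1) * (e / (2 * M))\<close>, strictly less than \<open>e / 2\<close>.\<close>
  define M where "M = (\<Sum>y\<in>F. \<bar>y\<bar>) + 1"
  have "0 \<le> (\<Sum>y\<in>F. \<bar>y\<bar>)" by (simp add: sum_nonneg)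
  then have M: "M > 0" unfolding M_def by linarith
  have "\<forall>y\<in>F. \<exists>K. compactin T K \<and> K \<subseteq> A y \<and> measure \<mu> (A y - K) < e / (2 * M)"
  proof
    fix y assume "y \<in> F"
    moreover have "e / (2 * M) > 0" using e M by simp
    ultimately show "\<exists>K. compactin T K \<and> K \<subseteq> A y \<and> measure \<mu> (A y - K) < e / (2 * M)"
      using inner_regular[OF Am Af, of y "e / (2 * M)"] by blast
  qed
  then obtain K where K: "\<And>y. y \<in> F \<Longrightarrow> compactin T (K y)" "\<And>y. y \<in> F \<Longrightarrow> K y \<subseteq> A y"
    "\<And>y. y \<in> F \<Longrightarrow> measure \<mu> (A y - K y) < e / (2 * M)" by metis
  define g where "g = (\<lambda>x. \<Sum>y\<in>F. y * indicator (K y) x :: real)"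
  have dj: "disjoint_family_on K F"
    unfolding disjoint_family_on_def
  proof (intro ballI impI)
    fix y z assume "y \<in> F" "z \<in> F" "y \<noteq> z"
    then show "K y \<inter> K z = {}" using K(2)[of y] K(2)[of z] by (auto simp: A_def)
  qed
  have g: "step g" unfolding step_def g_def using finF K(1) dj by blast
  have gi: "integrable \<mu> g" by (rule step_integrable[OF g])
  have tsum: "t x = (\<Sum>y\<in>F. y * indicator (A y) x)" if "x \<in> space \<mu>" for x
  proof -
    have "(\<Sum>y\<in>F. y * indicator (A y) x) = (\<Sum>y\<in>F. if y = t x then y else 0)"
      using that by (intro sum.cong) (auto simp: A_def indicator_def)
    also have "\<dots> = t x" using finF that by (auto simp: F_def)
    finally show ?thesis by simp
  qed
  have Di: "integrable \<mu> (indicator (A y - K y) :: 'a \<Rightarrow> real)" if "y \<in> F" for y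
    using Am[of y] Af[OF that] compact_in_sets[OF K(1)[OF that]]
      emeasure_mono[of "A y - K y" "A y" \<mu>] by (auto simp: integrable_indicator_iff intro: le_less_trans)
  have "(\<integral>x. \<bar>t x - g x\<bar> \<partial>\<mu>) \<le> (\<integral>x. (\<Sum>y\<in>F. \<bar>y\<bar> * indicator (A y - K y) x) \<partial>\<mu>)"
  proof (rule integral_mono)
    fix x assume x: "x \<in> space \<mu>"
    have "t x - g x = (\<Sum>y\<in>F. y * indicator (A y - K y) x)"
      unfolding tsum[OF x] g_def sum_subtractf[symmetric]
      using K(2) by (intro sum.cong refl) (auto simp: indicator_def)
    also have "\<bar>\<dots>\<bar> \<le> (\<Sum>y\<in>F. \<bar>y\<bar> * indicator (A y - K y) x)"
      by (rule order.trans[OF sum_abs]) (simp add: abs_mult)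
    finally show "\<bar>t x - g x\<bar> \<le> (\<Sum>y\<in>F. \<bar>y\<bar> * indicator (A y - K y) x)" .
  qed (use ti gi Di in auto)
  also have "\<dots> = (\<Sum>y\<in>F. \<bar>y\<bar> * measure \<mu> (A y - K y))"
    using Di Am K(1)[THEN compact_in_sets] by (subst Bochner_Integration.integral_sum) (auto intro!: sum.cong)
  also have "\<dots> \<le> (\<Sum>y\<in>F. \<bar>y\<bar> * (e / (2 * M)))"
    using K(3) by (intro sum_mono mult_left_mono) (auto intro: less_imp_le)
  also have "\<dots> = (M - 1) * (e / (2 * M))" by (simp add: M_def sum_distrib_right sum_divide_distrib)
  also have "\<dots> < M * (e / (2 * M))" using e M by (intro mult_strict_right_mono) auto
  also have "\<dots> = e / 2" using M by simp
  finally have tg: "(\<integral>x. \<bar>t x - g x\<bar> \<partial>\<mu>) < e / 2" .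
  have "(\<integral>x. \<bar>f x - g x\<bar> \<partial>\<mu>) \<le> (\<integral>x. \<bar>f x - t x\<bar> + \<bar>t x - g x\<bar> \<partial>\<mu>)"
    using f ti gi by (intro integral_mono) auto
  also have "\<dots> = (\<integral>x. \<bar>f x - t x\<bar> \<partial>\<mu>) + (\<integral>x. \<bar>t x - g x\<bar> \<partial>\<mu>)"
    using f ti gi by (intro Bochner_Integration.integral_add) auto
  also have "\<dots> < e" using i tg by (simp add: t_def)
  finally show thesis using that g by blast
qed

end

section \<open>Continuity of translation in L^1\<close>

context haar_group
begin

lemma L1_dist_triangle:
  fixes f g h :: "'a \<Rightarrow> real"
  assumes "integrable \<mu> f" "integrable \<mu> g" "integrable \<mu> h"
  shows "(\<integral>x. \<bar>f x - h x\<bar> \<partial>\<mu>) \<le> (\<integral>x. \<bar>f x - g x\<bar> \<partial>\<mu>) + (\<integral>x. \<bar>g x - h x\<bar> \<partial>\<mu>)"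
proof -
  have "(\<integral>x. \<bar>f x - h x\<bar> \<partial>\<mu>) \<le> (\<integral>x. \<bar>f x - g x\<bar> + \<bar>g x - h x\<bar> \<partial>\<mu>)"
    using assms by (intro integral_mono) auto
  also have "\<dots> = (\<integral>x. \<bar>f x - g x\<bar> \<partial>\<mu>) + (\<integral>x. \<bar>g x - h x\<bar> \<partial>\<mu>)"
    using assms by (intro Bochner_Integration.integral_add) auto
  finally show ?thesis .
qed

lemma integral_tr_dist:
  fixes f g :: "'a \<Rightarrow> real"
  assumes "y \<in> carrier G" "integrable \<mu> f" "integrable \<mu> g"
  shows "(\<integral>x. \<bar>f (inv y \<otimes> x) - g (inv y \<otimes> x)\<bar> \<partial>\<mu>) = (\<integral>x. \<bar>f x - g x\<bar> \<partial>\<mu>)"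
  using integral_translate[of "inv y" "\<lambda>x. \<bar>f x - g x\<bar>"] assms by simp

text \<open>For late \<open>n\<close> the translates of \<open>K\<close> by \<open>s n\<close> and
  by \<open>y\<close> both lie in an open set \<open>U\<close> of measure less than
  \<open>measure \<mu> K + e/4\<close>. Each misses less than \<open>e/4\<close> of it, so they
  differ by less than \<open>e/2\<close>.\<close>

lemma translate_indicator_continuous:
  fixes s :: "nat \<Rightarrow> 'a"
  assumes K: "compactin T K" and s: "\<And>n. s n \<in> carrier G" and lim: "limitin T s y sequentially"
  shows "(\<lambda>n. \<integral>x. \<bar>indicator K (inv (s n) \<otimes> x) - indicator K (inv y \<otimes> x)\<bar> \<partial>\<mu>) \<longlonglongrightarrow> (0::real)"
proof (rule tendstoI)
  fix e :: real assume e: "e > 0"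
  have y: "y \<in> carrier G" using lim top by (simp add: limitin_def)
  have KG: "K \<subseteq> carrier G" using compactin_subset_topspace[OF K] top by simp
  have Kf: "K \<in> fmeasurable \<mu>" using compact_finite[OF K] compact_in_sets[OF K] by (auto intro: fmeasurableI)
  define Y where "Y = (\<lambda>x. y \<otimes> x) ` K"
  have Y: "compactin T Y"
    unfolding Y_def by (rule image_compactin[OF K continuous_translate[OF y]])
  have Ys: "Y \<in> sets \<mu>" by (rule compact_in_sets[OF Y])
  have YK: "emeasure \<mu> Y = emeasure \<mu> K"
    unfolding Y_def using y compact_in_sets[OF K] by (rule mu_translate)
  obtain U where U: "openin T U" "Y \<subseteq> U" "emeasure \<mu> U < emeasure \<mu> Y + ennreal (e/4)"
    using outer_regular[OF Ys compact_finite[OF Y], of "e/4"] e by auto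
  have Uf: "U \<in> fmeasurable \<mu>"
    using U compact_finite[OF Y] open_in_sets
    by (intro fmeasurableI) (auto simp: ennreal_add_less_top intro: less_trans)
  have mU: "measure \<mu> U < measure \<mu> K + e/4"
  proof -
    have "ennreal (measure \<mu> U) < ennreal (measure \<mu> K + e/4)"
      using U(3) YK Kf Uf e by (simp add: emeasure_eq_measure2 ennreal_plus)
    then show ?thesis by (simp add: ennreal_less_iff)
  qed
  define W where "W = {z \<in> topspace (prod_topology T T). (case z of (a, b) \<Rightarrow> a \<otimes> b) \<in> U}"
  have W: "openin (prod_topology T T) W"
    unfolding W_def using cmult U(1) by (simp add: continuous_map_def)
  have "compactin T {y}" using y top by simp
  moreover have "{y} \<times> K \<subseteq> W" using U(2) y KG by (auto simp: W_def Y_def top)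
  \<comment> \<open>The tube lemma: a whole neighbourhood \<open>A\<close> of \<open>y\<close> moves
    the compact set \<open>K\<close> into \<open>U\<close>.\<close>
  ultimately obtain A B where AB: "openin T A" "openin T B" "{y} \<subseteq> A" "K \<subseteq> B" "A \<times> B \<subseteq> W"
    using Wallace_theorem_prod_topology[OF _ K W] by metis
  have "eventually (\<lambda>n. s n \<in> A) sequentially"
    using lim AB by (simp add: limitin_def)
  then show "eventually (\<lambda>n. dist (\<integral>x. \<bar>indicator K (inv (s n) \<otimes> x) - indicator K (inv y \<otimes> x)\<bar> \<partial>\<mu>) (0::real) < e) sequentially"
  proof eventually_elim
    case (elim n)
    have sub: "z \<otimes> x \<in> U" if "z \<in> {s n, y}" "x \<in> K" for z x
    proof -
      have "(z, x) \<in> A \<times> B" using that AB elim by auto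
      then have "(z, x) \<in> W" using AB by blast
      then show ?thesis by (simp add: W_def)
    qed
    have ind: "indicator K (inv z \<otimes> x) \<le> (indicator U x :: real)" if "z \<in> {s n, y}" "x \<in> carrier G" for x z
    proof -
      have "z \<in> carrier G" using that s y by auto
      then have "z \<otimes> (inv z \<otimes> x) = x" using that by (simp add: m_assoc[symmetric])
      then show ?thesis using sub[OF that(1), of "inv z \<otimes> x"] by (auto simp: indicator_def)
    qed
    have iK: "integrable \<mu> (\<lambda>x. indicator K (inv z \<otimes> x) :: real)"
      and eK: "(\<integral>x. indicator K (inv z \<otimes> x) \<partial>\<mu>) = measure \<mu> K" if "z \<in> carrier G" for z
      using integrable_translate[OF _ integrable_indicator_compact[OF K], of "inv z"]
        integral_translate[OF _ integrable_indicator_compact[OF K], of "inv z"] that Kf by auto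
    have iU: "integrable \<mu> (indicator U :: 'a \<Rightarrow> real)" "(\<integral>x. indicator U x \<partial>\<mu>) = measure \<mu> U"
      using Uf by (auto simp: integrable_indicator_iff fmeasurable_def)
    have "(\<integral>x. \<bar>indicator K (inv (s n) \<otimes> x) - indicator K (inv y \<otimes> x)\<bar> \<partial>\<mu>) \<le>
       (\<integral>x. (indicator U x - indicator K (inv (s n) \<otimes> x)) + (indicator U x - indicator K (inv y \<otimes> x)) \<partial>\<mu> :: real)"
    proof (rule integral_mono)
      fix x assume x: "x \<in> space \<mu>"
      have "\<bar>a - b\<bar> \<le> (u - a) + (u - b)" if "a \<le> u" "b \<le> u" for a b u :: real
        using that by linarith
      with ind[of "s n" x] ind[of y x] x space_mu
      show "\<bar>indicator K (inv (s n) \<otimes> x) - indicator K (inv y \<otimes> x)\<bar> \<le>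
         (indicator U x - indicator K (inv (s n) \<otimes> x)) + (indicator U x - indicator K (inv y \<otimes> x) :: real)"
        by simp
    qed (use iK s y iU in auto)
    also have "\<dots> = 2 * (measure \<mu> U - measure \<mu> K)"
      using iK eK s y iU by (simp add: Bochner_Integration.integral_add Bochner_Integration.integral_diff)
    also have "\<dots> < e" using mU e by (simp add: algebra_simps)
    finally have "(\<integral>x. \<bar>indicator K (inv (s n) \<otimes> x) - indicator K (inv y \<otimes> x)\<bar> \<partial>\<mu>) < e" .
    moreover have "0 \<le> (\<integral>x. \<bar>indicator K (inv (s n) \<otimes> x) - indicator K (inv y \<otimes> x)\<bar> \<partial>\<mu> :: real)"
      by (rule integral_nonneg_AE) simp
    ultimately show ?case by (simp add: dist_norm)
  qed
qed

lemma translate_continuous_step: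
  fixes s :: "nat \<Rightarrow> 'a"
  assumes step: "step g" and s: "\<And>n. s n \<in> carrier G" and lim: "limitin T s y sequentially"
  shows "(\<lambda>n. \<integral>x. \<bar>g (inv (s n) \<otimes> x) - g (inv y \<otimes> x)\<bar> \<partial>\<mu>) \<longlonglongrightarrow> 0"
proof -
  have y: "y \<in> carrier G" using lim top by (simp add: limitin_def)
  obtain F K where F: "finite F" "\<And>z. z \<in> F \<Longrightarrow> compactin T (K z)"
    and g: "g = (\<lambda>x. \<Sum>z\<in>F. z * indicator (K z) x)"
    using step unfolding step_def by blast
  have tg: "integrable \<mu> (\<lambda>x. g (inv a \<otimes> x))" if "a \<in> carrier G" for a
    using that step by (intro integrable_translate step_integrable) auto
  have iK: "integrable \<mu> (\<lambda>x. indicator (K z) (inv a \<otimes> x) :: real)" if "z \<in> F" "a \<in> carrier G" for z a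
    using that F(2) by (intro integrable_translate integrable_indicator_compact) auto
  show ?thesis
  proof (rule tendsto_sandwich[OF _ _ tendsto_const])
    show "eventually (\<lambda>n. 0 \<le> (\<integral>x. \<bar>g (inv (s n) \<otimes> x) - g (inv y \<otimes> x)\<bar> \<partial>\<mu>)) sequentially"
      by simp
    show "(\<lambda>n. \<Sum>z\<in>F. \<bar>z\<bar> * (\<integral>x. \<bar>indicator (K z) (inv (s n) \<otimes> x) - indicator (K z) (inv y \<otimes> x)\<bar> \<partial>\<mu>)) \<longlonglongrightarrow> 0"
      using translate_indicator_continuous[OF F(2) s lim]
      by (intro tendsto_null_sum tendsto_mult_right_zero) auto
    show "eventually (\<lambda>n. (\<integral>x. \<bar>g (inv (s n) \<otimes> x) - g (inv y \<otimes> x)\<bar> \<partial>\<mu>) \<le>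
      (\<Sum>z\<in>F. \<bar>z\<bar> * (\<integral>x. \<bar>indicator (K z) (inv (s n) \<otimes> x) - indicator (K z) (inv y \<otimes> x)\<bar> \<partial>\<mu>))) sequentially"
    proof (intro always_eventually allI)
      fix n
      have "(\<integral>x. \<bar>g (inv (s n) \<otimes> x) - g (inv y \<otimes> x)\<bar> \<partial>\<mu>) \<le>
        (\<integral>x. (\<Sum>z\<in>F. \<bar>z\<bar> * \<bar>indicator (K z) (inv (s n) \<otimes> x) - indicator (K z) (inv y \<otimes> x)\<bar>) \<partial>\<mu>)"
      proof (rule integral_mono)
        fix x
        show "\<bar>g (inv (s n) \<otimes> x) - g (inv y \<otimes> x)\<bar> \<le>
          (\<Sum>z\<in>F. \<bar>z\<bar> * \<bar>indicator (K z) (inv (s n) \<otimes> x) - indicator (K z) (inv y \<otimes> x)\<bar>)"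
          unfolding g sum_subtractf[symmetric]
          by (rule order.trans[OF sum_abs]) (simp add: abs_mult[symmetric] right_diff_distrib)
      next
        show "integrable \<mu> (\<lambda>x. \<bar>g (inv (s n) \<otimes> x) - g (inv y \<otimes> x)\<bar>)"
          by (intro integrable_abs Bochner_Integration.integrable_diff tg s y)
        show "integrable \<mu> (\<lambda>x. \<Sum>z\<in>F. \<bar>z\<bar> * \<bar>indicator (K z) (inv (s n) \<otimes> x) - indicator (K z) (inv y \<otimes> x)\<bar>)"
          by (intro Bochner_Integration.integrable_sum integrable_mult_right integrable_abs
              Bochner_Integration.integrable_diff iK s y)
      qed
      also have "\<dots> = (\<Sum>z\<in>F. \<bar>z\<bar> * (\<integral>x. \<bar>indicator (K z) (inv (s n) \<otimes> x) - indicator (K z) (inv y \<otimes> x)\<bar> \<partial>\<mu>))"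
        by (subst Bochner_Integration.integral_sum)
          (simp_all add: integrable_mult_right integrable_abs Bochner_Integration.integrable_diff iK s y)
      finally show "(\<integral>x. \<bar>g (inv (s n) \<otimes> x) - g (inv y \<otimes> x)\<bar> \<partial>\<mu>) \<le> \<dots>" .
    qed
  qed
qed

text \<open>Translation is an isometry of L^1, so replacing \<open>f\<close> by a step function
  costs the same \<open>e/3\<close> at \<open>s n\<close> and at \<open>y\<close>; the last third is
  continuity for that step function.\<close>

lemma translate_continuous:
  fixes s :: "nat \<Rightarrow> 'a"
  assumes f: "integrable \<mu> f" and s: "\<And>n. s n \<in> carrier G" and lim: "limitin T s y sequentially"
  shows "(\<lambda>n. \<integral>x. \<bar>f (inv (s n) \<otimes> x) - f (inv y \<otimes> x)\<bar> \<partial>\<mu>) \<longlonglongrightarrow> (0::real)"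
proof (rule tendstoI)
  fix e :: real assume e: "e > 0"
  have y: "y \<in> carrier G" using lim top by (simp add: limitin_def)
  obtain g where g: "step g" "(\<integral>x. \<bar>f x - g x\<bar> \<partial>\<mu>) < e/3"
    using step_dense[OF f, of "e/3"] e by auto
  have gi: "integrable \<mu> g" by (rule step_integrable[OF g(1)])
  have tf: "integrable \<mu> (\<lambda>x. f (inv a \<otimes> x))" "integrable \<mu> (\<lambda>x. g (inv a \<otimes> x))" if "a \<in> carrier G" for a
    using that f gi by (auto intro!: integrable_translate)
  have "eventually (\<lambda>n. (\<integral>x. \<bar>g (inv (s n) \<otimes> x) - g (inv y \<otimes> x)\<bar> \<partial>\<mu>) < e/3) sequentially"
    using order_tendstoD(2)[OF translate_continuous_step[OF g(1) s lim], of "e/3"] e by simp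
  then show "eventually (\<lambda>n. dist (\<integral>x. \<bar>f (inv (s n) \<otimes> x) - f (inv y \<otimes> x)\<bar> \<partial>\<mu>) 0 < e) sequentially"
  proof eventually_elim
    case (elim n)
    have "(\<integral>x. \<bar>f (inv (s n) \<otimes> x) - f (inv y \<otimes> x)\<bar> \<partial>\<mu>) \<le>
      (\<integral>x. \<bar>f (inv (s n) \<otimes> x) - g (inv (s n) \<otimes> x)\<bar> \<partial>\<mu>) + (\<integral>x. \<bar>g (inv (s n) \<otimes> x) - f (inv y \<otimes> x)\<bar> \<partial>\<mu>)"
      by (intro L1_dist_triangle tf s y)
    moreover have "(\<integral>x. \<bar>g (inv (s n) \<otimes> x) - f (inv y \<otimes> x)\<bar> \<partial>\<mu>) \<le>
      (\<integral>x. \<bar>g (inv (s n) \<otimes> x) - g (inv y \<otimes> x)\<bar> \<partial>\<mu>) + (\<integral>x. \<bar>g (inv y \<otimes> x) - f (inv y \<otimes> x)\<bar> \<partial>\<mu>)"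
      by (intro L1_dist_triangle tf s y)
    moreover have "(\<integral>x. \<bar>f (inv (s n) \<otimes> x) - g (inv (s n) \<otimes> x)\<bar> \<partial>\<mu>) = (\<integral>x. \<bar>f x - g x\<bar> \<partial>\<mu>)"
      using s f gi by (rule integral_tr_dist)
    moreover have "(\<integral>x. \<bar>g (inv y \<otimes> x) - f (inv y \<otimes> x)\<bar> \<partial>\<mu>) = (\<integral>x. \<bar>f x - g x\<bar> \<partial>\<mu>)"
      using integral_tr_dist[OF y gi f] by (simp add: abs_minus_commute)
    moreover have "0 \<le> (\<integral>x. \<bar>f (inv (s n) \<otimes> x) - f (inv y \<otimes> x)\<bar> \<partial>\<mu>)"
      by (rule integral_nonneg_AE) simp
    ultimately show ?case using elim g(2) by (simp add: dist_norm)
  qed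
qed

section \<open>Convolution on L^1\<close>

lemma div_measurable: "(\<lambda>(y, x). inv y \<otimes> x) \<in> measurable (\<mu> \<Otimes>\<^sub>M \<mu>) \<mu>"
proof (rule continuous2_measurable)
  have "continuous_map (prod_topology T T) (prod_topology T T) (\<lambda>z. (inv (fst z), snd z))"
    using continuous_map_compose[OF continuous_map_fst cinv, of T]
    by (intro continuous_map_pairedI continuous_map_snd) (simp_all add: o_def)
  from continuous_map_compose[OF this cmult]
  show "continuous_map (prod_topology T T) T (\<lambda>(y, x). inv y \<otimes> x)"
    by (simp add: o_def case_prod_beta')
qed

lemma conv_kernel_measurable:
  assumes "f \<in> borel_measurable \<mu>" "g \<in> borel_measurable \<mu>"
  shows "(\<lambda>(y, x). f y * g (inv y \<otimes> x) :: real) \<in> borel_measurable (\<mu> \<Otimes>\<^sub>M \<mu>)"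
proof -
  have "(\<lambda>z. g ((\<lambda>(y, x). inv y \<otimes> x) z)) \<in> borel_measurable (\<mu> \<Otimes>\<^sub>M \<mu>)"
    by (rule measurable_compose[OF div_measurable assms(2)])
  moreover have "(\<lambda>z. f (fst z)) \<in> borel_measurable (\<mu> \<Otimes>\<^sub>M \<mu>)"
    by (rule measurable_compose[OF measurable_fst assms(1)])
  ultimately show ?thesis by (simp add: case_prod_beta')
qed

text \<open>By invariance the inner integral of the modulus is \<open>\<bar>f y\<bar>\<close> times
  the norm of \<open>g\<close>, which is integrable in \<open>y\<close>.\<close>

lemma conv_kernel_integrable:
  assumes f: "integrable \<mu> f" and g: "integrable \<mu> g"
  shows "integrable (\<mu> \<Otimes>\<^sub>M \<mu>) (\<lambda>(y, x). f y * g (inv y \<otimes> x) :: real)"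
proof (rule Fubini_integrable)
  show "(\<lambda>(y, x). f y * g (inv y \<otimes> x)) \<in> borel_measurable (\<mu> \<Otimes>\<^sub>M \<mu>)"
    using f g by (intro conv_kernel_measurable) auto
  have ti: "integrable \<mu> (\<lambda>x. g (inv y \<otimes> x))" if "y \<in> space \<mu>" for y
    using that space_mu by (intro integrable_translate g) auto
  then show "AE y in \<mu>. integrable \<mu> (\<lambda>x. case (y, x) of (y, x) \<Rightarrow> f y * g (inv y \<otimes> x))"
    by (intro AE_I2) auto
  have "(\<integral>x. norm (f y * g (inv y \<otimes> x)) \<partial>\<mu>) = \<bar>f y\<bar> * (\<integral>x. \<bar>g x\<bar> \<partial>\<mu>)" if "y \<in> space \<mu>" for y
    using that space_mu integral_translate[of "inv y" "\<lambda>x. \<bar>g x\<bar>"] g by (simp add: abs_mult)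
  then show "integrable \<mu> (\<lambda>y. \<integral>x. norm (case (y, x) of (y, x) \<Rightarrow> f y * g (inv y \<otimes> x)) \<partial>\<mu>)"
    using f by (subst Bochner_Integration.integrable_cong[OF refl, where g="\<lambda>y. \<bar>f y\<bar> * (\<integral>x. \<bar>g x\<bar> \<partial>\<mu>)"]) auto
qed

lemma convolution_integrable:
  assumes f: "integrable \<mu> f" and g: "integrable \<mu> g"
  shows "integrable \<mu> (convolution G \<mu> f g)"
  using integrable_snd[OF conv_kernel_integrable[OF assms]] by (simp add: convolution_def[abs_def])

lemma convolution_cong_AE:
  assumes f: "integrable \<mu> f" "integrable \<mu> f'" "AE x in \<mu>. f x = f' x"
    and g: "integrable \<mu> g" "integrable \<mu> g'" "AE x in \<mu>. g x = g' x"
  shows "AE x in \<mu>. convolution G \<mu> f g x = convolution G \<mu> f' g' x"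
proof -
  have m: "(\<lambda>(y, x). f y * g (inv y \<otimes> x)) \<in> borel_measurable (\<mu> \<Otimes>\<^sub>M \<mu>)"
      "(\<lambda>(y, x). f' y * g' (inv y \<otimes> x)) \<in> borel_measurable (\<mu> \<Otimes>\<^sub>M \<mu>)"
    using f g by (intro conv_kernel_measurable; auto)+
  have "AE x in \<mu>. AE y in \<mu>. f y * g (inv y \<otimes> x) = f' y * g' (inv y \<otimes> x)"
  \<comment> \<open>For fixed \<open>y\<close> the exceptional set in \<open>x\<close> is a
    translate of a null set, while the integral defining the convolution needs fixed
    \<open>x\<close>. Exchanging the two quantifiers requires the equality set to be jointly
    measurable.\<close>
  proof (subst AE_commute[symmetric])
    have "{z \<in> space (\<mu> \<Otimes>\<^sub>M \<mu>). (\<lambda>(y, x). f y * g (inv y \<otimes> x)) z = (\<lambda>(y, x). f' y * g' (inv y \<otimes> x)) z} \<in> sets (\<mu> \<Otimes>\<^sub>M \<mu>)"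
      using m by measurable
    then show "{z \<in> space (\<mu> \<Otimes>\<^sub>M \<mu>). f (fst z) * g (inv (fst z) \<otimes> snd z) = f' (fst z) * g' (inv (fst z) \<otimes> snd z)} \<in> sets (\<mu> \<Otimes>\<^sub>M \<mu>)"
      by (simp add: case_prod_beta')
    show "AE y in \<mu>. AE x in \<mu>. f y * g (inv y \<otimes> x) = f' y * g' (inv y \<otimes> x)"
      using f(3) AE_space
    proof eventually_elim
      case (elim y)
      then have y: "inv y \<in> carrier G" by (simp add: space_mu)
      have "AE x in distr \<mu> \<mu> (\<lambda>x. inv y \<otimes> x). g x = g' x"
        unfolding distr_translate[OF y] by (rule g(3))
      then have "AE x in \<mu>. g (inv y \<otimes> x) = g' (inv y \<otimes> x)"
        by (rule AE_distrD[OF translate_measurable[OF y]])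
      then show ?case using elim by simp
    qed
  qed
  then show ?thesis
    using AE_space
  proof eventually_elim
    case (elim x)
    show ?case unfolding convolution_def
    proof (rule integral_cong_AE)
      show "(\<lambda>y. f y * g (inv y \<otimes> x)) \<in> borel_measurable \<mu>" "(\<lambda>y. f' y * g' (inv y \<otimes> x)) \<in> borel_measurable \<mu>"
        using measurable_compose[OF measurable_Pair2'[OF elim(2)] m(1)]
          measurable_compose[OF measurable_Pair2'[OF elim(2)] m(2)] by simp_all
    qed (rule elim(1))
  qed
qed

lemma cnv_conv_L1:
  assumes "integrable \<mu> f" "integrable \<mu> g"
  shows "cnv_conv (L1_conv G \<mu>) (L1_class \<mu> f) (L1_class \<mu> g) = L1_class \<mu> (convolution G \<mu> f g)"
  unfolding L1_conv_def cnv_structure.simps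
proof (intro UN_L1_class2 assms)
  fix f' g' assume "f' \<in> L1_class \<mu> f" "g' \<in> L1_class \<mu> g"
  then have *: "(f, f') \<in> L1_rel \<mu>" "(g, g') \<in> L1_rel \<mu>" by auto
  from L1_relD[OF *(1)] L1_relD[OF *(2)]
  show "L1_class \<mu> (convolution G \<mu> f' g') = L1_class \<mu> (convolution G \<mu> f g)"
    by (intro L1_class_cong[OF convolution_integrable convolution_integrable convolution_cong_AE, symmetric])
qed

end

section \<open>Finite approximations\<close>

context haar_group
begin

definition push :: "('a \<Rightarrow> 'b) \<Rightarrow> ('a \<Rightarrow> real) \<Rightarrow> 'b \<Rightarrow> real" where
  "push p f h = (\<integral>x. indicator (p -` {h}) x * f x \<partial>\<mu>)"

lemma integrable_fibre:
  fixes f :: "'a \<Rightarrow> real"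
  assumes p: "p \<in> measurable \<mu> (count_space UNIV)" and f: "integrable \<mu> f"
  shows "integrable \<mu> (\<lambda>x. indicator (p -` {h}) x * f x)"
proof -
  have "p -` {h} \<inter> space \<mu> \<in> sets \<mu>" using p by (rule measurable_sets) simp
  from integrable_mult_indicator[OF this f]
  have "integrable \<mu> (\<lambda>x. indicator (p -` {h} \<inter> space \<mu>) x * f x)" by simp
  then show ?thesis
    by (rule Bochner_Integration.integrable_cong[OF refl, THEN iffD1, rotated]) (auto simp: indicator_def)
qed

lemma push_add:
  assumes "p \<in> measurable \<mu> (count_space UNIV)" "integrable \<mu> f" "integrable \<mu> g"
  shows "push p (\<lambda>x. f x + g x) h = push p f h + push p g h"
  using integrable_fibre[OF assms(1)] assms(2,3) by (simp add: push_def distrib_left)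

lemma push_diff:
  assumes "p \<in> measurable \<mu> (count_space UNIV)" "integrable \<mu> f" "integrable \<mu> g"
  shows "push p (\<lambda>x. f x - g x) h = push p f h - push p g h"
  using integrable_fibre[OF assms(1)] assms(2,3) by (simp add: push_def right_diff_distrib)

lemma push_scale: "push p (\<lambda>x. c * f x) h = c * push p f h"
  by (simp add: push_def mult.left_commute[of _ c])

lemma abs_push_le:
  assumes p: "p \<in> measurable \<mu> (count_space UNIV)" and f: "integrable \<mu> f"
  shows "\<bar>push p f h\<bar> \<le> push p (\<lambda>x. \<bar>f x\<bar>) h"
proof -
  have "\<bar>push p f h\<bar> \<le> (\<integral>x. \<bar>indicator (p -` {h}) x * f x\<bar> \<partial>\<mu>)"
    unfolding push_def by (rule integral_abs_bound)
  then show ?thesis by (simp add: push_def abs_mult)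
qed

lemma push_cong_AE:
  assumes p: "p \<in> measurable \<mu> (count_space UNIV)"
    and "integrable \<mu> f" "integrable \<mu> g" "AE x in \<mu>. f x = g x"
  shows "push p f h = push p g h"
  unfolding push_def using assms(4)
  by (intro integral_cong_AE borel_measurable_integrable[OF integrable_fibre] assms) auto

lemma sum_fibres:
  assumes "finite C" "p x \<in> C"
  shows "(\<Sum>h\<in>C. indicator (p -` {h}) x * F h) = (F (p x) :: real)"
proof -
  have "(\<Sum>h\<in>C. indicator (p -` {h}) x * F h) = (\<Sum>h\<in>C. if h = p x then F h else 0)"
    by (intro sum.cong) (auto simp: indicator_def)
  then show ?thesis using assms by simp
qed

text \<open>The fibres over \<open>C\<close> partition the group, so the total integral is
  preserved.\<close>

lemma sum_push:
  assumes p: "p \<in> measurable \<mu> (count_space UNIV)" and "finite C" "p \<in> carrier G \<rightarrow> C"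
    and f: "integrable \<mu> f"
  shows "(\<Sum>h\<in>C. push p f h) = (\<integral>x. f x \<partial>\<mu>)"
proof -
  have "(\<Sum>h\<in>C. push p f h) = (\<integral>x. (\<Sum>h\<in>C. indicator (p -` {h}) x * f x) \<partial>\<mu>)"
    unfolding push_def using integrable_fibre[OF p f]
    by (subst Bochner_Integration.integral_sum) auto
  also have "\<dots> = (\<integral>x. f x \<partial>\<mu>)"
    using assms by (intro Bochner_Integration.integral_cong refl sum_fibres) (auto simp: space_mu)
  finally show ?thesis .
qed

lemma l1norm_push_le:
  assumes p: "p \<in> measurable \<mu> (count_space UNIV)" and "finite (carrier H)" "p \<in> carrier G \<rightarrow> carrier H"
    and f: "integrable \<mu> f"
  shows "l1norm H (push p f) \<le> (\<integral>x. \<bar>f x\<bar> \<partial>\<mu>)"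
proof -
  have "l1norm H (push p f) \<le> (\<Sum>h\<in>carrier H. push p (\<lambda>x. \<bar>f x\<bar>) h)"
    unfolding l1norm_def by (intro sum_mono abs_push_le p f)
  also have "\<dots> = (\<integral>x. \<bar>f x\<bar> \<partial>\<mu>)" using assms by (intro sum_push) auto
  finally show ?thesis .
qed

text \<open>The push-forward of \<open>|f|\<close> dominates the modulus of the push-forward of \<open>f\<close>, so the
  \<open>\<ell>\<^sup>1\<close>-distance between the two is the norm defect.\<close>

lemma l1norm_push_lattice:
  assumes p: "p \<in> measurable \<mu> (count_space UNIV)" and "finite (carrier H)" "p \<in> carrier G \<rightarrow> carrier H"
    and f: "integrable \<mu> f" and g: "integrable \<mu> g"
  shows "l1norm H (\<lambda>h. push p (\<lambda>x. min (f x) (g x)) h - min (push p f h) (push p g h)) =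
    ((\<integral>x. \<bar>f x - g x\<bar> \<partial>\<mu>) - l1norm H (push p (\<lambda>x. f x - g x))) / 2"
    and "l1norm H (\<lambda>h. push p (\<lambda>x. max (f x) (g x)) h - max (push p f h) (push p g h)) =
    ((\<integral>x. \<bar>f x - g x\<bar> \<partial>\<mu>) - l1norm H (push p (\<lambda>x. f x - g x))) / 2"
proof -
  define d where "d = (\<lambda>x. f x - g x)"
  have d: "integrable \<mu> d" "integrable \<mu> (\<lambda>x. \<bar>d x\<bar>)" using f g by (auto simp: d_def)
  have pd: "push p d h = push p f h - push p g h" for h
    unfolding d_def by (rule push_diff[OF p f g])
  \<comment> \<open>Both lattice operations reduce to the modulus of the difference, which is why
    minimum and maximum have the same defect.\<close>
  have mn: "min a b = (1/2) * (a + b - \<bar>a - b\<bar>)" "max a b = (1/2) * (a + b + \<bar>a - b\<bar>)" for a b :: real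
    by (auto simp: min_def max_def)
  have pmin: "push p (\<lambda>x. min (f x) (g x)) h = (1/2) * (push p f h + push p g h - push p (\<lambda>x. \<bar>d x\<bar>) h)" for h
  proof -
    have "push p (\<lambda>x. min (f x) (g x)) h = push p (\<lambda>x. (1/2) * (f x + g x - \<bar>d x\<bar>)) h"
      by (simp only: mn d_def)
    then show ?thesis unfolding push_scale using p f g d by (simp add: push_diff push_add)
  qed
  have pmax: "push p (\<lambda>x. max (f x) (g x)) h = (1/2) * (push p f h + push p g h + push p (\<lambda>x. \<bar>d x\<bar>) h)" for h
  proof -
    have "push p (\<lambda>x. max (f x) (g x)) h = push p (\<lambda>x. (1/2) * (f x + g x + \<bar>d x\<bar>)) h"
      by (simp only: mn d_def)
    then show ?thesis unfolding push_scale using p f g d by (simp add: push_diff push_add)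
  qed
  have le: "\<bar>push p d h\<bar> \<le> push p (\<lambda>x. \<bar>d x\<bar>) h" for h by (rule abs_push_le[OF p d(1)])
  have "\<bar>push p (\<lambda>x. min (f x) (g x)) h - min (push p f h) (push p g h)\<bar> = (push p (\<lambda>x. \<bar>d x\<bar>) h - \<bar>push p d h\<bar>) / 2"
     "\<bar>push p (\<lambda>x. max (f x) (g x)) h - max (push p f h) (push p g h)\<bar> = (push p (\<lambda>x. \<bar>d x\<bar>) h - \<bar>push p d h\<bar>) / 2" for h
    unfolding pmin pmax unfolding mn using le[of h] by (auto simp: pd field_simps)
  moreover have "(\<Sum>h\<in>carrier H. (push p (\<lambda>x. \<bar>d x\<bar>) h - \<bar>push p d h\<bar>) / 2) = ((\<integral>x. \<bar>d x\<bar> \<partial>\<mu>) - l1norm H (push p d)) / 2"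
    using sum_push[OF p assms(2,3) d(2)] by (simp add: l1norm_def sum_subtractf flip: sum_divide_distrib)
  ultimately show "l1norm H (\<lambda>h. push p (\<lambda>x. min (f x) (g x)) h - min (push p f h) (push p g h)) =
    ((\<integral>x. \<bar>f x - g x\<bar> \<partial>\<mu>) - l1norm H (push p (\<lambda>x. f x - g x))) / 2"
   "l1norm H (\<lambda>h. push p (\<lambda>x. max (f x) (g x)) h - max (push p f h) (push p g h)) =
    ((\<integral>x. \<bar>f x - g x\<bar> \<partial>\<mu>) - l1norm H (push p (\<lambda>x. f x - g x))) / 2"
    unfolding l1norm_def d_def by presburger+
qed

text \<open>Fubini's theorem moves the fibre integral inside: the push-forward of a convolution is
  an average of push-forwards of translates of \<open>g\<close>, weighted by
  \<open>f\<close>.\<close>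

lemma push_convolution:
  assumes p: "p \<in> measurable \<mu> (count_space UNIV)" and f: "integrable \<mu> f" and g: "integrable \<mu> g"
  shows "integrable \<mu> (\<lambda>y. f y * push p (\<lambda>x. g (inv y \<otimes> x)) h)"
    and "push p (convolution G \<mu> f g) h = (\<integral>y. f y * push p (\<lambda>x. g (inv y \<otimes> x)) h \<partial>\<mu>)"
proof -
  let ?i = "\<lambda>x. indicator (p -` {h}) x :: real"
  have A: "space \<mu> \<times> (p -` {h} \<inter> space \<mu>) \<in> sets (\<mu> \<Otimes>\<^sub>M \<mu>)"
    using p by (intro pair_measureI measurable_sets[OF p]) auto
  have "integrable (\<mu> \<Otimes>\<^sub>M \<mu>) (\<lambda>z. indicator (space \<mu> \<times> (p -` {h} \<inter> space \<mu>)) z * (\<lambda>(y, x). f y * g (inv y \<otimes> x)) z)"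
    using integrable_mult_indicator[OF A conv_kernel_integrable[OF f g]] by simp
  then have int: "integrable (\<mu> \<Otimes>\<^sub>M \<mu>) (\<lambda>(y, x). f y * (?i x * g (inv y \<otimes> x)))"
    by (rule Bochner_Integration.integrable_cong[OF refl, THEN iffD1, rotated])
      (auto simp: space_pair_measure indicator_def)
  show "integrable \<mu> (\<lambda>y. f y * push p (\<lambda>x. g (inv y \<otimes> x)) h)"
    using integrable_fst[OF int] by (simp add: push_def)
  have "push p (convolution G \<mu> f g) h = (\<integral>x. (\<integral>y. f y * (?i x * g (inv y \<otimes> x)) \<partial>\<mu>) \<partial>\<mu>)"
    by (simp add: push_def convolution_def mult.left_commute[of "f _"])
  also have "\<dots> = (\<integral>y. (\<integral>x. f y * (?i x * g (inv y \<otimes> x)) \<partial>\<mu>) \<partial>\<mu>)"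
    by (rule Fubini_integral[OF int])
  also have "\<dots> = (\<integral>y. f y * push p (\<lambda>x. g (inv y \<otimes> x)) h \<partial>\<mu>)" by (simp add: push_def)
  finally show "push p (convolution G \<mu> f g) h = \<dots>" .
qed

text \<open>Rewrites a sum over the finite group as an integral over \<open>G\<close> against
  \<open>f\<close>, so that it can be compared under one integral sign with the push-forward of a
  convolution.\<close>

lemma fin_conv_push:
  assumes p: "p \<in> measurable \<mu> (count_space UNIV)" and "finite (carrier H)" "p \<in> carrier G \<rightarrow> carrier H"
    and f: "integrable \<mu> f"
  shows "integrable \<mu> (\<lambda>y. f y * k (inv\<^bsub>H\<^esub> (p y) \<otimes>\<^bsub>H\<^esub> h))"
    and "fin_conv H (push p f) k h = (\<integral>y. f y * k (inv\<^bsub>H\<^esub> (p y) \<otimes>\<^bsub>H\<^esub> h) \<partial>\<mu>)"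
proof -
  have *: "f y * k (inv\<^bsub>H\<^esub> (p y) \<otimes>\<^bsub>H\<^esub> h) =
    (\<Sum>a\<in>carrier H. (indicator (p -` {a}) y * f y) * k (inv\<^bsub>H\<^esub> a \<otimes>\<^bsub>H\<^esub> h))" if "y \<in> space \<mu>" for y
  proof -
    have "p y \<in> carrier H" using that assms(3) by (auto simp: space_mu)
    from sum_fibres[where p=p and x=y, OF assms(2) this, of "\<lambda>a. f y * k (inv\<^bsub>H\<^esub> a \<otimes>\<^bsub>H\<^esub> h)"]
    show ?thesis by (simp only: mult.assoc)
  qed
  have int: "integrable \<mu> (\<lambda>y. (indicator (p -` {a}) y * f y) * k (inv\<^bsub>H\<^esub> a \<otimes>\<^bsub>H\<^esub> h))" for a
    by (intro integrable_mult_left integrable_fibre p f)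
  show "integrable \<mu> (\<lambda>y. f y * k (inv\<^bsub>H\<^esub> (p y) \<otimes>\<^bsub>H\<^esub> h))"
    using int by (subst Bochner_Integration.integrable_cong[OF refl *]) auto
  show "fin_conv H (push p f) k h = (\<integral>y. f y * k (inv\<^bsub>H\<^esub> (p y) \<otimes>\<^bsub>H\<^esub> h) \<partial>\<mu>)"
    using int by (subst Bochner_Integration.integral_cong[OF refl *])
      (auto simp: fin_conv_def push_def integrable_fibre[OF p f])
qed

end

text \<open>
  The last assumption replaces an approximate homomorphism property: translating by a point close
  to \<open>y\<close>, rather than by \<open>y\<close> itself, commutes with \<open>p n\<close> exactly.
\<close>

locale finite_approximation = haar_group G T \<mu>
  for G :: "('a, 'm) monoid_scheme" (structure) and T \<mu> +
  fixes H :: "nat \<Rightarrow> 'b monoid" and p :: "nat \<Rightarrow> 'a \<Rightarrow> 'b"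
  assumes Hgrp: "\<And>n. group (H n)" and Hfin: "\<And>n. finite (carrier (H n))"
    and p_into: "\<And>n. p n \<in> carrier G \<rightarrow> carrier (H n)"
    and p_meas: "\<And>n. p n \<in> measurable \<mu> (count_space UNIV)"
    and separates: "\<And>K L. compactin T K \<Longrightarrow> compactin T L \<Longrightarrow> K \<inter> L = {} \<Longrightarrow>
      eventually (\<lambda>n. \<forall>x\<in>K. \<forall>y\<in>L. p n x \<noteq> p n y) sequentially"
    and almost_hom: "\<And>y. y \<in> carrier G \<Longrightarrow> \<exists>s. limitin T s y sequentially \<and>
      (\<forall>n. s n \<in> carrier G \<and> (\<forall>x\<in>carrier G. p n (s n \<otimes> x) = p n y \<otimes>\<^bsub>H n\<^esub> p n x))"
begin

text \<open>Once \<open>p n\<close> separates the positive support \<open>P\<close> from the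
  negative support \<open>N\<close>, no fibre meets both. Nothing cancels within a fibre, and the
  norm is preserved exactly.\<close>

lemma push_norm_step:
  assumes "step g"
  shows "eventually (\<lambda>n. l1norm (H n) (push (p n) g) = (\<integral>x. \<bar>g x\<bar> \<partial>\<mu>)) sequentially"
proof -
  obtain F K where F: "finite F" "\<And>z. z \<in> F \<Longrightarrow> compactin T (K z)" "disjoint_family_on K F"
    and g: "g = (\<lambda>x. \<Sum>z\<in>F. z * indicator (K z) x)"
    using assms unfolding step_def by blast
  have gi: "integrable \<mu> g" by (rule step_integrable[OF assms])
  define P N where "P = (\<Union>z\<in>{z\<in>F. z > 0}. K z)" and "N = (\<Union>z\<in>{z\<in>F. z < 0}. K z)"
  have "compactin T P" "compactin T N"
    unfolding P_def N_def using F by (auto intro!: compactin_Union)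
  moreover have "P \<inter> N = {}"
    using F(3) unfolding P_def N_def disjoint_family_on_def by fastforce
  ultimately have "eventually (\<lambda>n. \<forall>x\<in>P. \<forall>y\<in>N. p n x \<noteq> p n y) sequentially"
    by (rule separates)
  then show ?thesis
  proof eventually_elim
    case (elim n)
    have neg: "x \<in> N" if "g x < 0" for x
    proof (rule ccontr)
      assume "x \<notin> N"
      then have "0 \<le> z * indicator (K z) x" if "z \<in> F" for z
        using that by (cases "z < 0") (auto simp: N_def indicator_def)
      then have "0 \<le> g x" unfolding g by (rule sum_nonneg)
      with that show False by simp
    qed
    have pos: "x \<in> P" if "g x > 0" for x
    proof (rule ccontr)
      assume "x \<notin> P"
      then have "z * indicator (K z) x \<le> 0" if "z \<in> F" for z
        using that by (cases "z > 0") (auto simp: P_def indicator_def)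
      then have "g x \<le> 0" unfolding g by (rule sum_nonpos)
      with that show False by simp
    qed
    have "\<bar>push (p n) g h\<bar> = push (p n) (\<lambda>x. \<bar>g x\<bar>) h" for h
    proof (cases "\<exists>x. p n x = h \<and> g x < 0")
      case True
      then have "\<And>x. p n x = h \<Longrightarrow> g x \<le> 0" by (metis elim neg pos not_less)
      then have "indicator (p n -` {h}) x * \<bar>g x\<bar> = - (indicator (p n -` {h}) x * g x)" for x
        by (auto simp: indicator_def)
      then have "push (p n) (\<lambda>x. \<bar>g x\<bar>) h = - push (p n) g h" by (simp add: push_def)
      then show ?thesis using abs_push_le[OF p_meas gi, of n h] by simp
    next
      case False
      then have "indicator (p n -` {h}) x * \<bar>g x\<bar> = indicator (p n -` {h}) x * g x" for x
        by (auto simp: indicator_def)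
      then have "push (p n) (\<lambda>x. \<bar>g x\<bar>) h = push (p n) g h" by (simp only: push_def)
      then show ?thesis using abs_push_le[OF p_meas gi, of n h] by simp
    qed
    then show ?case
      using sum_push[OF p_meas Hfin p_into, of "\<lambda>x. \<bar>g x\<bar>" n] gi by (simp add: l1norm_def)
  qed
qed

text \<open>Push-forward is a contraction, so passing to a step function within \<open>e/2\<close>
  costs the same amount on both sides, uniformly in \<open>n\<close>.\<close>

lemma push_norm:
  assumes f: "integrable \<mu> f"
  shows "(\<lambda>n. l1norm (H n) (push (p n) f)) \<longlonglongrightarrow> (\<integral>x. \<bar>f x\<bar> \<partial>\<mu>)"
proof (rule tendstoI)
  fix e :: real assume e: "e > 0"
  obtain g where g: "step g" "(\<integral>x. \<bar>f x - g x\<bar> \<partial>\<mu>) < e/2"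
    using step_dense[OF f, of "e/2"] e by auto
  have gi: "integrable \<mu> g" by (rule step_integrable[OF g(1)])
  have fg: "integrable \<mu> (\<lambda>x. f x - g x)" using f gi by simp
  show "eventually (\<lambda>n. dist (l1norm (H n) (push (p n) f)) (\<integral>x. \<bar>f x\<bar> \<partial>\<mu>) < e) sequentially"
    using push_norm_step[OF g(1)]
  proof eventually_elim
    case (elim n)
    have "l1norm (H n) (push (p n) g) \<le> l1norm (H n) (push (p n) f) + l1norm (H n) (push (p n) (\<lambda>x. f x - g x))"
      by (rule l1norm_bound2) (simp add: push_diff[OF p_meas f gi])
    moreover have "l1norm (H n) (push (p n) (\<lambda>x. f x - g x)) \<le> (\<integral>x. \<bar>f x - g x\<bar> \<partial>\<mu>)"
      by (rule l1norm_push_le[OF p_meas Hfin p_into fg])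
    moreover have "l1norm (H n) (push (p n) f) \<le> (\<integral>x. \<bar>f x\<bar> \<partial>\<mu>)"
      by (rule l1norm_push_le[OF p_meas Hfin p_into f])
    moreover have "(\<integral>x. \<bar>f x\<bar> \<partial>\<mu>) \<le> (\<integral>x. \<bar>f x - g x\<bar> \<partial>\<mu>) + (\<integral>x. \<bar>g x\<bar> \<partial>\<mu>)"
      using L1_dist_triangle[OF f gi, of "\<lambda>x. 0"] by simp
    ultimately show ?case using elim g(2) by (simp add: dist_norm)
  qed
qed

text \<open>Translation by \<open>s\<close> carries the fibre over \<open>(p n y)\<close>-inverse
  times \<open>h\<close> onto the fibre over \<open>h\<close>, and Haar measure does not
  notice.\<close>

lemma push_translate:
  assumes g: "integrable \<mu> g" and s: "s \<in> carrier G" and y: "y \<in> carrier G"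
    and hom: "\<And>x. x \<in> carrier G \<Longrightarrow> p n (s \<otimes> x) = p n y \<otimes>\<^bsub>H n\<^esub> p n x"
    and h: "h \<in> carrier (H n)"
  shows "push (p n) (\<lambda>x. g (inv s \<otimes> x)) h = push (p n) g (inv\<^bsub>H n\<^esub> (p n y) \<otimes>\<^bsub>H n\<^esub> h)"
proof -
  interpret Hn: group "H n" by (rule Hgrp)
  have "push (p n) (\<lambda>x. g (inv s \<otimes> x)) h =
    (\<integral>x. (\<lambda>x. indicator (p n -` {h}) x * g (inv s \<otimes> x)) (s \<otimes> x) \<partial>\<mu>)"
    unfolding push_def
    by (rule integral_translate[symmetric, OF s integrable_fibre[OF p_meas]])
      (use integrable_translate[OF _ g, of "inv s"] s in auto)
  also have "\<dots> = push (p n) g (inv\<^bsub>H n\<^esub> (p n y) \<otimes>\<^bsub>H n\<^esub> h)"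
    unfolding push_def
  proof (rule Bochner_Integration.integral_cong[OF refl])
    fix x assume "x \<in> space \<mu>"
    then have x: "x \<in> carrier G" by (simp add: space_mu)
    have px: "p n x \<in> carrier (H n)" "p n y \<in> carrier (H n)" using p_into x y by auto
    have "inv s \<otimes> (s \<otimes> x) = x" using s x by (simp add: m_assoc[symmetric])
    moreover have "p n (s \<otimes> x) = h \<longleftrightarrow> p n x = inv\<^bsub>H n\<^esub> (p n y) \<otimes>\<^bsub>H n\<^esub> h"
      unfolding hom[OF x] using px h by (metis Hn.inv_solve_left)
    ultimately show "indicator (p n -` {h}) (s \<otimes> x) * g (inv s \<otimes> (s \<otimes> x)) =
       indicator (p n -` {inv\<^bsub>H n\<^esub> (p n y) \<otimes>\<^bsub>H n\<^esub> h}) x * g x"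
      by (simp add: indicator_def)
  qed
  finally show ?thesis .
qed

text \<open>Replacing \<open>y\<close> by \<open>s n\<close> makes the two sides equal. What remains
  is the push-forward of the difference of two translates of \<open>g\<close>, bounded by their
  L^1-distance, which tends to 0.\<close>

lemma translate_defect:
  assumes g: "integrable \<mu> g" and y: "y \<in> carrier G"
  shows "(\<lambda>n. l1norm (H n) (\<lambda>h. push (p n) (\<lambda>x. g (inv y \<otimes> x)) h -
    push (p n) g (inv\<^bsub>H n\<^esub> (p n y) \<otimes>\<^bsub>H n\<^esub> h))) \<longlonglongrightarrow> 0"
proof -
  obtain s where s: "limitin T s y sequentially" "\<And>n. s n \<in> carrier G"
    "\<And>n x. x \<in> carrier G \<Longrightarrow> p n (s n \<otimes> x) = p n y \<otimes>\<^bsub>H n\<^esub> p n x"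
    using almost_hom[OF y] by blast
  have ti: "integrable \<mu> (\<lambda>x. g (inv a \<otimes> x))" if "a \<in> carrier G" for a
    using that g by (intro integrable_translate) auto
  show ?thesis
  proof (rule tendsto_sandwich[OF _ _ tendsto_const translate_continuous[OF g s(2,1)]])
    show "eventually (\<lambda>n. l1norm (H n) (\<lambda>h. push (p n) (\<lambda>x. g (inv y \<otimes> x)) h -
      push (p n) g (inv\<^bsub>H n\<^esub> (p n y) \<otimes>\<^bsub>H n\<^esub> h)) \<le> (\<integral>x. \<bar>g (inv (s n) \<otimes> x) - g (inv y \<otimes> x)\<bar> \<partial>\<mu>)) sequentially"
    proof (intro always_eventually allI)
      fix n
      have "l1norm (H n) (\<lambda>h. push (p n) (\<lambda>x. g (inv y \<otimes> x)) h - push (p n) g (inv\<^bsub>H n\<^esub> (p n y) \<otimes>\<^bsub>H n\<^esub> h)) =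
        l1norm (H n) (push (p n) (\<lambda>x. g (inv (s n) \<otimes> x) - g (inv y \<otimes> x)))"
        unfolding l1norm_def
      proof (intro sum.cong refl)
        fix h assume h: "h \<in> carrier (H n)"
        have eq: "push (p n) (\<lambda>x. g (inv (s n) \<otimes> x)) h = push (p n) g (inv\<^bsub>H n\<^esub> (p n y) \<otimes>\<^bsub>H n\<^esub> h)"
          by (rule push_translate[OF g s(2) y s(3) h])
        show "\<bar>push (p n) (\<lambda>x. g (inv y \<otimes> x)) h - push (p n) g (inv\<^bsub>H n\<^esub> (p n y) \<otimes>\<^bsub>H n\<^esub> h)\<bar> =
          \<bar>push (p n) (\<lambda>x. g (inv (s n) \<otimes> x) - g (inv y \<otimes> x)) h\<bar>"
          unfolding push_diff[OF p_meas ti[OF s(2)] ti[OF y]] eq by (rule abs_minus_commute)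
      qed
      also have "\<dots> \<le> (\<integral>x. \<bar>g (inv (s n) \<otimes> x) - g (inv y \<otimes> x)\<bar> \<partial>\<mu>)"
        by (intro l1norm_push_le p_meas Hfin p_into Bochner_Integration.integrable_diff ti s(2) y)
      finally show "l1norm (H n) (\<lambda>h. push (p n) (\<lambda>x. g (inv y \<otimes> x)) h -
        push (p n) g (inv\<^bsub>H n\<^esub> (p n y) \<otimes>\<^bsub>H n\<^esub> h)) \<le> (\<integral>x. \<bar>g (inv (s n) \<otimes> x) - g (inv y \<otimes> x)\<bar> \<partial>\<mu>)" .
    qed
  qed (simp add: l1norm_nonneg)
qed

text \<open>The defect of the product is the integral over \<open>y\<close> of \<open>f y\<close>
  times the defect \<open>\<delta> n y\<close> of a single translation. The latter vanishes
  pointwise in \<open>y\<close>, and dominated convergence does the rest.\<close>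

lemma push_convolution_defect:
  assumes f: "integrable \<mu> f" and g: "integrable \<mu> g"
  shows "(\<lambda>n. l1norm (H n) (\<lambda>h. push (p n) (convolution G \<mu> f g) h -
     fin_conv (H n) (push (p n) f) (push (p n) g) h)) \<longlonglongrightarrow> 0"
proof -
  define \<delta> where "\<delta> n y h = push (p n) (\<lambda>x. g (inv y \<otimes> x)) h - push (p n) g (inv\<^bsub>H n\<^esub> (p n y) \<otimes>\<^bsub>H n\<^esub> h)" for n y h
  have int: "integrable \<mu> (\<lambda>y. f y * \<delta> n y h)" for n h
    unfolding \<delta>_def right_diff_distrib
    by (intro Bochner_Integration.integrable_diff push_convolution(1) fin_conv_push(1) p_meas Hfin p_into f g)
  have diff: "push (p n) (convolution G \<mu> f g) h - fin_conv (H n) (push (p n) f) (push (p n) g) h =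
     (\<integral>y. f y * \<delta> n y h \<partial>\<mu>)" for n h
    unfolding push_convolution(2)[OF p_meas f g] fin_conv_push(2)[OF p_meas Hfin p_into f] \<delta>_def right_diff_distrib
    by (rule Bochner_Integration.integral_diff[symmetric])
      (intro push_convolution(1) fin_conv_push(1) p_meas Hfin p_into f g)+
  \<comment> \<open>A crude bound by twice the norm of \<open>g\<close>, independent of
    \<open>n\<close> and \<open>y\<close>: it provides the dominating function.\<close>
  have bound: "l1norm (H n) (\<lambda>h. \<delta> n y h) \<le> 2 * (\<integral>x. \<bar>g x\<bar> \<partial>\<mu>)" if "y \<in> carrier G" for n y
  proof -
    interpret Hn: group "H n" by (rule Hgrp)
    have py: "p n y \<in> carrier (H n)" using p_into that by auto
    have "l1norm (H n) (\<lambda>h. \<delta> n y h) \<le> l1norm (H n) (push (p n) (\<lambda>x. g (inv y \<otimes> x))) +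
      l1norm (H n) (\<lambda>h. push (p n) g (inv\<^bsub>H n\<^esub> (p n y) \<otimes>\<^bsub>H n\<^esub> h))"
      by (rule l1norm_bound2) (simp add: \<delta>_def)
    also have "l1norm (H n) (\<lambda>h. push (p n) g (inv\<^bsub>H n\<^esub> (p n y) \<otimes>\<^bsub>H n\<^esub> h)) = l1norm (H n) (push (p n) g)"
      unfolding l1norm_def using Hn.sum_translate[OF py, where f="\<lambda>h. \<bar>push (p n) g h\<bar>"] by simp
    also have "l1norm (H n) (push (p n) g) \<le> (\<integral>x. \<bar>g x\<bar> \<partial>\<mu>)"
      by (rule l1norm_push_le[OF p_meas Hfin p_into g])
    also have "l1norm (H n) (push (p n) (\<lambda>x. g (inv y \<otimes> x))) \<le> (\<integral>x. \<bar>g (inv y \<otimes> x)\<bar> \<partial>\<mu>)"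
      using that g by (intro l1norm_push_le[OF p_meas Hfin p_into] integrable_translate) auto
    also have "\<dots> = (\<integral>x. \<bar>g x\<bar> \<partial>\<mu>)"
      using integral_translate[of "inv y" "\<lambda>x. \<bar>g x\<bar>"] that g by simp
    finally show ?thesis by simp
  qed
  have wint: "integrable \<mu> (\<lambda>y. \<bar>f y\<bar> * l1norm (H n) (\<lambda>h. \<delta> n y h))" for n
  proof -
    have "integrable \<mu> (\<lambda>y. \<Sum>h\<in>carrier (H n). \<bar>f y * \<delta> n y h\<bar>)"
      by (intro Bochner_Integration.integrable_sum integrable_abs int)
    then show ?thesis by (simp add: l1norm_def sum_distrib_left abs_mult)
  qed
  have "(\<lambda>n. \<integral>y. \<bar>f y\<bar> * l1norm (H n) (\<lambda>h. \<delta> n y h) \<partial>\<mu>) \<longlonglongrightarrow> (\<integral>y. 0 \<partial>\<mu>)"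
  proof (rule integral_dominated_convergence[where w="\<lambda>y. \<bar>f y\<bar> * (2 * (\<integral>x. \<bar>g x\<bar> \<partial>\<mu>))"])
    show "AE y in \<mu>. (\<lambda>n. \<bar>f y\<bar> * l1norm (H n) (\<lambda>h. \<delta> n y h)) \<longlonglongrightarrow> 0"
      unfolding \<delta>_def by (intro AE_I2 tendsto_mult_right_zero translate_defect g) (simp add: space_mu)
    show "AE y in \<mu>. norm (\<bar>f y\<bar> * l1norm (H n) (\<lambda>h. \<delta> n y h)) \<le> \<bar>f y\<bar> * (2 * (\<integral>x. \<bar>g x\<bar> \<partial>\<mu>))" for n
      using bound l1norm_nonneg by (intro AE_I2) (auto simp: space_mu abs_mult abs_of_nonneg[OF l1norm_nonneg] intro!: mult_left_mono)
  qed (use f borel_measurable_integrable[OF wint] in auto)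
  then have lim: "(\<lambda>n. \<integral>y. \<bar>f y\<bar> * l1norm (H n) (\<lambda>h. \<delta> n y h) \<partial>\<mu>) \<longlonglongrightarrow> 0" by simp
  show ?thesis
  proof (rule tendsto_sandwich[OF _ _ tendsto_const lim])
    show "eventually (\<lambda>n. l1norm (H n) (\<lambda>h. push (p n) (convolution G \<mu> f g) h -
       fin_conv (H n) (push (p n) f) (push (p n) g) h) \<le> (\<integral>y. \<bar>f y\<bar> * l1norm (H n) (\<lambda>h. \<delta> n y h) \<partial>\<mu>)) sequentially"
    proof (intro always_eventually allI)
      fix n
      have "l1norm (H n) (\<lambda>h. push (p n) (convolution G \<mu> f g) h - fin_conv (H n) (push (p n) f) (push (p n) g) h) \<le>
        (\<Sum>h\<in>carrier (H n). \<integral>y. \<bar>f y * \<delta> n y h\<bar> \<partial>\<mu>)"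
        unfolding diff l1norm_def by (intro sum_mono integral_abs_bound)
      also have "\<dots> = (\<integral>y. (\<Sum>h\<in>carrier (H n). \<bar>f y * \<delta> n y h\<bar>) \<partial>\<mu>)"
        by (rule Bochner_Integration.integral_sum[symmetric]) (intro integrable_abs int)
      also have "\<dots> = (\<integral>y. \<bar>f y\<bar> * l1norm (H n) (\<lambda>h. \<delta> n y h) \<partial>\<mu>)"
        by (simp add: l1norm_def sum_distrib_left abs_mult)
      finally show "l1norm (H n) (\<lambda>h. push (p n) (convolution G \<mu> f g) h -
        fin_conv (H n) (push (p n) f) (push (p n) g) h) \<le> (\<integral>y. \<bar>f y\<bar> * l1norm (H n) (\<lambda>h. \<delta> n y h) \<partial>\<mu>)" .
    qed
  qed (simp add: l1norm_nonneg)
qed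

theorem L1_metrically_embeds:
  assumes D: "D \<le> sequentially" "D \<noteq> bot"
  shows "metrically_embeds (L1_conv G \<mu>) (ultraproduct D (\<lambda>n. l1_conv (H n)))"
proof -
  interpret U: finite_group_sequence H D by (intro finite_group_sequence.intro Hgrp Hfin D(2))
  \<comment> \<open>Any representative may be chosen: a push-forward does not see null sets.\<close>
  define \<Phi> where "\<Phi> X = U.ucls (\<lambda>n. push (p n) (SOME f. f \<in> X))" for X
  have bdd: "U.bdd (\<lambda>n. push (p n) f)" if "integrable \<mu> f" for f
    unfolding U.bdd_def using l1norm_push_le[OF p_meas Hfin p_into that] by blast
  have \<Phi>: "\<Phi> (L1_class \<mu> f) = U.ucls (\<lambda>n. push (p n) f)" if f: "integrable \<mu> f" for f
  proof -
    define f' where "f' = (SOME f'. f' \<in> L1_class \<mu> f)"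
    have "f' \<in> L1_class \<mu> f" unfolding f'_def using mem_L1_class_self[OF f]
      by (rule someI[of "\<lambda>f'. f' \<in> L1_class \<mu> f"])
    then have f': "(f, f') \<in> L1_rel \<mu>" by simp
    have "push (p n) f = push (p n) f'" for n
      by (intro ext push_cong_AE[OF p_meas] L1_relD[OF f'])
    then show ?thesis by (simp add: \<Phi>_def f'_def)
  qed
  \<comment> \<open>Ordinary limits pass to \<open>D\<close> because \<open>D\<close> is finer than
    \<open>sequentially\<close>.\<close>
  have close: "U.ucls \<phi> = U.ucls \<psi>" if "U.bdd \<phi>" "U.bdd \<psi>"
    "(\<lambda>n. l1norm (H n) (\<lambda>x. \<phi> n x - \<psi> n x)) \<longlonglongrightarrow> 0" for \<phi> \<psi>
    using that filterlim_mono[OF that(3) order_refl D(1)] by (simp add: U.ucls_eq_iff U.close_def)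
  have norm: "cnv_norm U.UP (U.ucls (\<lambda>n. push (p n) f)) = (\<integral>x. \<bar>f x\<bar> \<partial>\<mu>)" if "integrable \<mu> f" for f
    by (intro U.ultraproduct_norm bdd that filterlim_mono[OF push_norm order_refl D(1)])
  have defect: "(\<lambda>n. ((\<integral>x. \<bar>f x - g x\<bar> \<partial>\<mu>) - l1norm (H n) (push (p n) (\<lambda>x. f x - g x))) / 2) \<longlonglongrightarrow> 0"
    if "integrable \<mu> f" "integrable \<mu> g" for f g
  proof -
    have "(\<lambda>n. ((\<integral>x. \<bar>f x - g x\<bar> \<partial>\<mu>) - l1norm (H n) (push (p n) (\<lambda>x. f x - g x))) / 2)
      \<longlonglongrightarrow> ((\<integral>x. \<bar>f x - g x\<bar> \<partial>\<mu>) - (\<integral>x. \<bar>f x - g x\<bar> \<partial>\<mu>)) / 2"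
      using that by (intro tendsto_intros push_norm) auto
    then show ?thesis by simp
  qed
  have add: "cnv_add U.UP (U.ucls (\<lambda>n. push (p n) f)) (U.ucls (\<lambda>n. push (p n) g)) =
      U.ucls (\<lambda>n. push (p n) (\<lambda>x. f x + g x))"
    if "integrable \<mu> f" "integrable \<mu> g" for f g
  proof -
    have "push (p n) (\<lambda>x. f x + g x) = (\<lambda>h. push (p n) f h + push (p n) g h)" for n
      by (intro ext push_add p_meas that)
    then show ?thesis using that by (simp add: U.ultraproduct_add bdd)
  qed
  have scale: "cnv_scale U.UP c (U.ucls (\<lambda>n. push (p n) f)) = U.ucls (\<lambda>n. push (p n) (\<lambda>x. c * f x))"
    if "integrable \<mu> f" for f c
  proof -
    have "push (p n) (\<lambda>x. c * f x) = (\<lambda>h. c * push (p n) f h)" for n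
      by (intro ext push_scale)
    then show ?thesis using that by (simp add: U.ultraproduct_scale bdd)
  qed
  have binary: "\<Phi> (cnv_add (L1_conv G \<mu>) X Y) = cnv_add U.UP (\<Phi> X) (\<Phi> Y) \<and>
        \<Phi> (cnv_inf (L1_conv G \<mu>) X Y) = cnv_inf U.UP (\<Phi> X) (\<Phi> Y) \<and>
        \<Phi> (cnv_sup (L1_conv G \<mu>) X Y) = cnv_sup U.UP (\<Phi> X) (\<Phi> Y) \<and>
        \<Phi> (cnv_conv (L1_conv G \<mu>) X Y) = cnv_conv U.UP (\<Phi> X) (\<Phi> Y) \<and>
        cnv_dist U.UP (\<Phi> X) (\<Phi> Y) = cnv_dist (L1_conv G \<mu>) X Y"
    if XY: "X \<in> cnv_carrier (L1_conv G \<mu>)" "Y \<in> cnv_carrier (L1_conv G \<mu>)" for X Y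
  proof -
    obtain f g where f: "integrable \<mu> f" "X = L1_class \<mu> f" and g: "integrable \<mu> g" "Y = L1_class \<mu> g"
      using XY by (auto simp: cnv_carrier_L1)
    note int = f(1) g(1)
    show ?thesis
      unfolding f(2) g(2)
    proof (intro conjI)
      show "\<Phi> (cnv_add (L1_conv G \<mu>) (L1_class \<mu> f) (L1_class \<mu> g)) = cnv_add U.UP (\<Phi> (L1_class \<mu> f)) (\<Phi> (L1_class \<mu> g))"
        using int by (simp add: cnv_add_L1 \<Phi> add)
      have mm: "integrable \<mu> (\<lambda>x. min (f x) (g x))" "integrable \<mu> (\<lambda>x. max (f x) (g x))"
        using int by auto
      have Ubdd: "U.bdd (\<lambda>n x. F (push (p n) f x) (push (p n) g x))" if "F = min \<or> F = max" for F
        unfolding U.bdd_def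
      proof (intro exI allI)
        fix n
        have "l1norm (H n) (\<lambda>x. F (push (p n) f x) (push (p n) g x)) \<le> l1norm (H n) (push (p n) f) + l1norm (H n) (push (p n) g)"
          using that by (intro l1norm_bound2) (auto simp: min_def max_def)
        also have "\<dots> \<le> (\<integral>x. \<bar>f x\<bar> \<partial>\<mu>) + (\<integral>x. \<bar>g x\<bar> \<partial>\<mu>)"
          by (intro add_mono l1norm_push_le p_meas Hfin p_into int)
        finally show "l1norm (H n) (\<lambda>x. F (push (p n) f x) (push (p n) g x)) \<le> (\<integral>x. \<bar>f x\<bar> \<partial>\<mu>) + (\<integral>x. \<bar>g x\<bar> \<partial>\<mu>)" .
      qed
      show "\<Phi> (cnv_inf (L1_conv G \<mu>) (L1_class \<mu> f) (L1_class \<mu> g)) = cnv_inf U.UP (\<Phi> (L1_class \<mu> f)) (\<Phi> (L1_class \<mu> g))"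
        unfolding cnv_inf_L1[OF int] \<Phi>[OF mm(1)] \<Phi>[OF int(1)] \<Phi>[OF int(2)] U.ultraproduct_inf[OF bdd[OF int(1)] bdd[OF int(2)]]
        using defect[OF int]
        by (intro close bdd mm Ubdd) (simp_all add: l1norm_push_lattice[OF p_meas Hfin p_into int])
      show "\<Phi> (cnv_sup (L1_conv G \<mu>) (L1_class \<mu> f) (L1_class \<mu> g)) = cnv_sup U.UP (\<Phi> (L1_class \<mu> f)) (\<Phi> (L1_class \<mu> g))"
        unfolding cnv_sup_L1[OF int] \<Phi>[OF mm(2)] \<Phi>[OF int(1)] \<Phi>[OF int(2)] U.ultraproduct_sup[OF bdd[OF int(1)] bdd[OF int(2)]]
        using defect[OF int]
        by (intro close bdd mm Ubdd) (simp_all add: l1norm_push_lattice[OF p_meas Hfin p_into int])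
      have cbdd: "U.bdd (\<lambda>n. fin_conv (H n) (push (p n) f) (push (p n) g))"
        unfolding U.bdd_def
      proof (intro exI allI)
        fix n
        show "l1norm (H n) (fin_conv (H n) (push (p n) f) (push (p n) g)) \<le> (\<integral>x. \<bar>f x\<bar> \<partial>\<mu>) * (\<integral>x. \<bar>g x\<bar> \<partial>\<mu>)"
          by (intro order.trans[OF l1norm_conv[OF Hgrp]] mult_mono l1norm_push_le p_meas Hfin p_into int l1norm_nonneg) simp
      qed
      show "\<Phi> (cnv_conv (L1_conv G \<mu>) (L1_class \<mu> f) (L1_class \<mu> g)) = cnv_conv U.UP (\<Phi> (L1_class \<mu> f)) (\<Phi> (L1_class \<mu> g))"
        unfolding cnv_conv_L1[OF int] \<Phi>[OF convolution_integrable[OF int]] \<Phi>[OF int(1)] \<Phi>[OF int(2)]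
          U.ultraproduct_conv[OF bdd[OF int(1)] bdd[OF int(2)]]
        by (intro close bdd convolution_integrable int cbdd push_convolution_defect)
      \<comment> \<open>Both distances are by definition norms of a linear combination, so the norm
        and the linear operations suffice.\<close>
      show "cnv_dist U.UP (\<Phi> (L1_class \<mu> f)) (\<Phi> (L1_class \<mu> g)) = cnv_dist (L1_conv G \<mu>) (L1_class \<mu> f) (L1_class \<mu> g)"
        unfolding cnv_dist_L1[OF int] unfolding cnv_dist_def
        using int by (simp add: \<Phi> scale add norm)
    qed
  qed
  have "metric_embedding (L1_conv G \<mu>) U.UP \<Phi>"
    unfolding metric_embedding_def
  proof (intro conjI ballI allI)
    show "\<Phi> (cnv_zero (L1_conv G \<mu>)) = cnv_zero U.UP"
      unfolding cnv_zero_L1 U.ultraproduct_zero by (subst \<Phi>) (simp_all add: push_def[abs_def])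
  next
    fix X assume "X \<in> cnv_carrier (L1_conv G \<mu>)"
    then obtain f where f: "integrable \<mu> f" "X = L1_class \<mu> f" by (auto simp: cnv_carrier_L1)
    show "\<Phi> X \<in> cnv_carrier U.UP" using f by (simp add: \<Phi> U.ucls_in_carrier bdd)
    show "cnv_norm U.UP (\<Phi> X) = cnv_norm (L1_conv G \<mu>) X" using f by (simp add: \<Phi> norm cnv_norm_L1)
    show "\<Phi> (cnv_scale (L1_conv G \<mu>) c X) = cnv_scale U.UP c (\<Phi> X)" for c
      using f by (simp add: \<Phi> scale cnv_scale_L1)
  qed (use binary in blast)+
  then show ?thesis unfolding metrically_embeds_def by blast
qed

end

section \<open>The exponential map of a connected abelian Lie group\<close>

text \<open>With tolerance 1 in the definition of the derivative, \<open>1 + onorm D\<close> is a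
  Lipschitz constant relative to the fixed point \<open>x\<close>.\<close>

lemma differentiable_imp_pointwise_Lipschitz:
  fixes f :: "'a::real_normed_vector \<Rightarrow> 'b::real_normed_vector"
  assumes "f differentiable (at x)"
  obtains K d where "K \<ge> 0" "d > 0" "\<And>y. norm (y - x) < d \<Longrightarrow> norm (f y - f x) \<le> K * norm (y - x)"
proof -
  obtain D where D: "(f has_derivative D) (at x)" using assms by (auto simp: differentiable_def)
  have bl: "bounded_linear D" using D by (rule has_derivative_bounded_linear)
  obtain d where d: "d > 0" "\<And>y. norm (y - x) < d \<Longrightarrow> norm (f y - f x - D (y - x)) \<le> 1 * norm (y - x)"
    using D unfolding has_derivative_at_alt by (meson zero_less_one)
  show thesis
  proof (rule that[of "1 + onorm D" d])
    show "0 \<le> 1 + onorm D" using onorm_pos_le[OF bl] by simp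
    fix y assume y: "norm (y - x) < d"
    have "norm (f y - f x) \<le> norm (f y - f x - D (y - x)) + norm (D (y - x))"
      using norm_triangle_sub by (metis add.commute)
    also have "\<dots> \<le> 1 * norm (y - x) + onorm D * norm (y - x)"
      using d(2)[OF y] onorm[OF bl] by (rule add_mono)
    finally show "norm (f y - f x) \<le> (1 + onorm D) * norm (y - x)" by (simp add: algebra_simps)
  qed (rule d(1))
qed

lemma linear_Basis_expansion:
  fixes L :: "'a::euclidean_space \<Rightarrow> 'b::real_vector"
  assumes "linear L"
  shows "L v = (\<Sum>b\<in>Basis. (v \<bullet> b) *\<^sub>R L b)"
proof -
  have "L v = L (\<Sum>b\<in>Basis. (v \<bullet> b) *\<^sub>R b)" by (simp add: euclidean_representation)
  then show ?thesis by (simp only: linear_sum[OF assms] linear_scale[OF assms])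
qed

text \<open>Mean value inequality on the segment from \<open>(p, y)\<close> to
  \<open>(z, y)\<close>: moving the first slot only is what gives the error the factor
  \<open>norm (z - p)\<close>. The other factor bounds the variation of the derivative, which is of
  the order of the distance to \<open>(p, p)\<close>.\<close>

lemma local_product_estimate:
  fixes F :: "'e::euclidean_space \<times> 'e \<Rightarrow> 'e"
  assumes \<rho>: "\<rho> > 0"
    and diff: "\<And>x. x \<in> ball p \<rho> \<times> ball p \<rho> \<Longrightarrow> F differentiable (at x)"
    and diff2: "\<And>v. (\<lambda>x. frechet_derivative F (at x) v) differentiable (at (p, p))"
    and unit: "\<And>z. z \<in> ball p \<rho> \<Longrightarrow> F (z, p) = z" "\<And>z. z \<in> ball p \<rho> \<Longrightarrow> F (p, z) = z"
  obtains r C where "r > 0" "r \<le> \<rho>" "C \<ge> 0"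
    "\<And>z y. norm (z - p) < r \<Longrightarrow> norm (y - p) < r \<Longrightarrow>
       norm (F (z, y) - z - y + p) \<le> C * (norm (z - p) + norm (y - p)) * norm (z - p)"
proof -
  define F' where "F' x = frechet_derivative F (at x)" for x
  have F': "(F has_derivative F' x) (at x)" if "x \<in> ball p \<rho> \<times> ball p \<rho>" for x
    unfolding F'_def using diff[OF that] frechet_derivative_works by blast
  have pp: "(p, p) \<in> ball p \<rho> \<times> ball p \<rho>" using \<rho> by simp
  have "\<forall>v. \<exists>K d. K \<ge> 0 \<and> d > 0 \<and> (\<forall>x. norm (x - (p, p)) < d \<longrightarrow> norm (F' x v - F' (p, p) v) \<le> K * norm (x - (p, p)))"
    using differentiable_imp_pointwise_Lipschitz[OF diff2] unfolding F'_def by metis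
  then obtain K d where K: "\<And>v. K v \<ge> (0::real)" and d: "\<And>v. d v > (0::real)"
    and Kd: "\<And>v x. norm (x - (p, p)) < d v \<Longrightarrow> norm (F' x v - F' (p, p) v) \<le> K v * norm (x - (p, p))"
    by metis
  \<comment> \<open>Pointwise Lipschitz constants are known for each direction separately; summing
    them over the basis controls the operator norm.\<close>
  define C where "C = (\<Sum>b\<in>Basis. K b)"
  have C: "C \<ge> 0" unfolding C_def by (intro sum_nonneg K)
  define e where "e = Min (insert \<rho> (d ` (Basis :: ('e \<times> 'e) set)))"
  have e: "e > 0" "e \<le> \<rho>"
    unfolding e_def using \<rho> d by auto
  have ed: "e \<le> d b" if "b \<in> Basis" for b
    unfolding e_def using that by (intro Min_le) auto
  have sub: "cball (p, p) s \<subseteq> ball p \<rho> \<times> ball p \<rho>" if "s < e" for s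
  proof
    fix x assume "x \<in> cball (p, p) s"
    then have "dist (p, p) x < \<rho>" using that e by simp
    moreover have "dist p (fst x) \<le> dist (p, p) x" "dist p (snd x) \<le> dist (p, p) x"
      using dist_fst_le[of "(p, p)" x] dist_snd_le[of "(p, p)" x] by simp_all
    ultimately show "x \<in> ball p \<rho> \<times> ball p \<rho>" by (auto simp: mem_Times_iff)
  qed
  have on: "onorm (F' x - F' (p, p)) \<le> C * s" if x: "x \<in> cball (p, p) s" and s: "s < e" for x s
  proof (rule onorm_le)
    fix v
    have xs: "norm (x - (p, p)) \<le> s" using x by (simp add: dist_norm norm_minus_commute)
    have "x \<in> ball p \<rho> \<times> ball p \<rho>" using x sub[OF s] by blast
    then have lin: "linear (F' x)" "linear (F' (p, p))"
      using F' pp has_derivative_linear by blast+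
    have "(F' x - F' (p, p)) v = (\<Sum>b\<in>Basis. (v \<bullet> b) *\<^sub>R (F' x b - F' (p, p) b))"
      using linear_Basis_expansion[OF lin(1), of v] linear_Basis_expansion[OF lin(2), of v]
      by (simp only: fun_diff_def sum_subtractf scaleR_diff_right)
    also have "norm \<dots> \<le> (\<Sum>b\<in>Basis. norm v * (K b * s))"
    proof (rule sum_norm_le)
      fix b :: "'e \<times> 'e" assume b: "b \<in> Basis"
      have "norm (F' x b - F' (p, p) b) \<le> K b * norm (x - (p, p))"
        using xs s ed[OF b] by (intro Kd) linarith
      also have "\<dots> \<le> K b * s" using xs K by (intro mult_left_mono) auto
      finally have "norm (F' x b - F' (p, p) b) \<le> K b * s" .
      then show "norm ((v \<bullet> b) *\<^sub>R (F' x b - F' (p, p) b)) \<le> norm v * (K b * s)"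
        using Basis_le_norm[OF b, of v] by (auto intro!: mult_mono)
    qed
    also have "\<dots> = C * s * norm v"
      by (simp add: C_def sum_distrib_right sum_distrib_left mult_ac)
    finally show "norm ((F' x - F' (p, p)) v) \<le> C * s * norm v" .
  qed
  \<comment> \<open>Since \<open>F (z, p) = z\<close>, the derivative in the first slot is the
    identity; this is the linear term to be subtracted.\<close>
  have part: "F' (p, p) (w, 0) = w" for w
  proof -
    have "((\<lambda>z. F (z, p)) has_derivative (\<lambda>w. F' (p, p) (w, 0))) (at p)"
      by (rule has_derivative_compose[where f="\<lambda>z. (z, p)" and g=F, OF _ F'[OF pp]])
        (auto intro!: derivative_eq_intros)
    then have "((\<lambda>z. z) has_derivative (\<lambda>w. F' (p, p) (w, 0))) (at p)"
      by (rule has_derivative_transform_within_open[where s="ball p \<rho>"]) (use \<rho> unit in auto)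
    then have "(\<lambda>w. F' (p, p) (w, 0)) = (\<lambda>w. w)"
      using has_derivative_unique has_derivative_ident by blast
    then show ?thesis by meson
  qed
  show thesis
  \<comment> \<open>Half of \<open>e\<close>, because the closed ball around \<open>(p, p)\<close>
    that contains the segment has radius \<open>s\<close>, the sum of the two norms.\<close>
  proof (rule that[of "e/2" C])
    show "0 < e/2" "e/2 \<le> \<rho>" "0 \<le> C" using e C by auto
    fix z y assume z: "norm (z - p) < e/2" and y: "norm (y - p) < e/2"
    define s where "s = norm (z - p) + norm (y - p)"
    have s: "s < e" using z y by (simp add: s_def)
    have n: "dist (p, p) (a, b) \<le> norm (a - p) + norm (b - p)" for a b :: 'e
      using norm_Pair_le[of "p - a" "p - b"] by (simp add: dist_norm norm_minus_commute)
    have mem: "(p, y) \<in> cball (p, p) s" "(z, y) \<in> cball (p, p) s" "(p, p) \<in> cball (p, p) s"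
      using order.trans[OF n[of p y], of s] n[of z y] by (simp_all add: s_def)
    have seg: "(p, y) + t *\<^sub>R ((z, y) - (p, y)) \<in> cball (p, p) s" if "t \<in> {0..1}" for t :: real
    proof -
      have "(1 - t) *\<^sub>R (p, y) + t *\<^sub>R (z, y) \<in> cball (p, p) s"
        using convexD[OF convex_cball mem(1,2), of "1 - t" t] that by simp
      then show ?thesis by (simp add: algebra_simps)
    qed
    have "norm (F (z, y) - F (p, y) - F' (p, p) ((z, y) - (p, y))) \<le> norm ((z, y) - (p, y)) * (C * s)"
    proof (rule differentiable_bound_linearization[where S="cball (p, p) s" and f'=F' and f=F
          and a="(p, y)" and b="(z, y)" and ?x0.0="(p, p)" and B="C * s"])
      show "(p, y) + t *\<^sub>R ((z, y) - (p, y)) \<in> cball (p, p) s" if "t \<in> {0..1}" for t :: real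
        using that by (rule seg)
      show "onorm (F' x - F' (p, p)) \<le> C * s" if "x \<in> cball (p, p) s" for x
        using that s by (rule on)
      show "(p, p) \<in> cball (p, p) s" by (rule mem(3))
      show "(F has_derivative F' x) (at x within cball (p, p) s)" if "x \<in> cball (p, p) s" for x
        using that sub[OF s] by (intro has_derivative_at_withinI[OF F']) blast
    qed
    moreover have "F (p, y) = y" using y e by (intro unit) (simp add: dist_norm norm_minus_commute)
    ultimately show "norm (F (z, y) - z - y + p) \<le> C * (norm (z - p) + norm (y - p)) * norm (z - p)"
    proof -
      have "F (z, y) - z - y + p = F (z, y) - y - (z - p)" by (simp add: algebra_simps)
      moreover have "(z, y) - (p, y) = (z - p, 0)" by simp
      moreover have "norm (z - p, 0 :: 'e) = norm (z - p)" by (simp add: norm_Pair)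
      ultimately show ?thesis
        using \<open>norm (F (z, y) - F (p, y) - F' (p, p) ((z, y) - (p, y))) \<le> _\<close> \<open>F (p, y) = y\<close>
        by (simp only: part s_def mult.commute)
    qed
  qed
qed

text \<open>
  A chart centred at the identity in which multiplication is addition up to a quadratic error. The
  error vanishes with the first factor because \<open>\<phi> (\<one> \<otimes> y) = \<phi> y\<close>, and \<open>r\<close> is so small that the
  error is at most a quarter of the first factor.
\<close>

locale local_coordinates = topological_abelian_group G T
  for G :: "('a, 'm) monoid_scheme" (structure) and T +
  fixes U :: "'a set" and \<phi> :: "'a \<Rightarrow> 'e::euclidean_space" and r C :: real
  assumes openU: "openin T U" and oneU: "\<one> \<in> U" and \<phi>_one: "\<phi> \<one> = 0" and inj: "inj_on \<phi> U"
    and ball_sub: "ball 0 r \<subseteq> \<phi> ` U"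
    and open_image: "\<And>V. openin T V \<Longrightarrow> V \<subseteq> U \<Longrightarrow> open (\<phi> ` V)"
    and open_vimage: "\<And>S. open S \<Longrightarrow> openin T {x \<in> U. \<phi> x \<in> S}"
    and r: "r > 0" and C: "C \<ge> 0" and Cr: "8 * C * r \<le> 1"
    and mult_in: "\<And>z y. z \<in> U \<Longrightarrow> y \<in> U \<Longrightarrow> norm (\<phi> z) < r \<Longrightarrow> norm (\<phi> y) < r \<Longrightarrow> z \<otimes> y \<in> U"
    and est: "\<And>z y. z \<in> U \<Longrightarrow> y \<in> U \<Longrightarrow> norm (\<phi> z) < r \<Longrightarrow> norm (\<phi> y) < r \<Longrightarrow>
       norm (\<phi> (z \<otimes> y) - \<phi> z - \<phi> y) \<le> C * (norm (\<phi> z) + norm (\<phi> y)) * norm (\<phi> z)"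
begin

definition B :: "real \<Rightarrow> 'a set" where "B s = {x \<in> U. norm (\<phi> x) < s}"

definition \<psi> :: "'e \<Rightarrow> 'a" where "\<psi> = inv_into U \<phi>"

lemma U_carrier: "x \<in> U \<Longrightarrow> x \<in> carrier G"
  using openin_subset[OF openU] top by auto

lemma B_carrier: "x \<in> B s \<Longrightarrow> x \<in> carrier G"
  by (simp add: B_def U_carrier)

lemma B_mono: "s \<le> t \<Longrightarrow> B s \<subseteq> B t"
  by (auto simp: B_def)

lemma openB: "openin T (B s)"
proof -
  have "B s = {x \<in> U. \<phi> x \<in> ball 0 s}" by (auto simp: B_def)
  then show ?thesis using open_vimage[of "ball 0 s"] by simp
qed

lemma one_B: "s > 0 \<Longrightarrow> \<one> \<in> B s"
  by (simp add: B_def oneU \<phi>_one)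

lemma \<psi>: assumes "norm v < r" shows "\<psi> v \<in> U" "\<phi> (\<psi> v) = v"
proof -
  have "v \<in> \<phi> ` U" using assms ball_sub by auto
  then show "\<psi> v \<in> U" "\<phi> (\<psi> v) = v" by (auto simp: \<psi>_def inv_into_into f_inv_into_f)
qed

lemma est4:
  assumes "z \<in> B r" "y \<in> B r"
  shows "norm (\<phi> (z \<otimes> y) - \<phi> z - \<phi> y) \<le> norm (\<phi> z) / 4"
proof -
  have "norm (\<phi> (z \<otimes> y) - \<phi> z - \<phi> y) \<le> C * (norm (\<phi> z) + norm (\<phi> y)) * norm (\<phi> z)"
    using assms by (intro est) (auto simp: B_def)
  also have "\<dots> \<le> C * (r + r) * norm (\<phi> z)"
    using assms C by (intro mult_right_mono mult_left_mono add_mono) (auto simp: B_def)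
  also have "\<dots> \<le> (1/4) * norm (\<phi> z)" using Cr by (intro mult_right_mono) (auto simp: algebra_simps)
  finally show ?thesis by simp
qed

lemma est_diff:
  assumes "z \<in> B r" "y \<in> B r"
  shows "norm (\<phi> (z \<otimes> y) - \<phi> y) \<le> 2 * norm (\<phi> z)"
proof -
  have "norm (\<phi> (z \<otimes> y) - \<phi> y) \<le> norm (\<phi> (z \<otimes> y) - \<phi> z - \<phi> y) + norm (\<phi> z)"
    using norm_triangle_ineq[of "\<phi> (z \<otimes> y) - \<phi> z - \<phi> y" "\<phi> z"] by simp
  also have "\<dots> \<le> norm (\<phi> z) / 4 + norm (\<phi> z)" using est4[OF assms] by simp
  also have "\<dots> \<le> 2 * norm (\<phi> z)" by simp
  finally show ?thesis .
qed

text \<open>Converse of \<open>est_diff\<close>. With \<open>z\<close> the quotient, the coordinate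
  difference is \<open>\<phi> z\<close> up to a quarter of its norm, which can be absorbed on the
  left.\<close>

lemma est_quotient:
  assumes "x \<in> U" "y \<in> B r" "x \<otimes> inv y \<in> B r"
  shows "norm (\<phi> (x \<otimes> inv y)) \<le> 2 * norm (\<phi> x - \<phi> y)"
proof -
  define z where "z = x \<otimes> inv y"
  have c: "x \<in> carrier G" "y \<in> carrier G" using assms U_carrier by (auto simp: B_def)
  then have "x = z \<otimes> y" by (simp add: z_def m_assoc)
  then have "norm (\<phi> x - \<phi> z - \<phi> y) \<le> norm (\<phi> z) / 4"
    using est4[of z y] assms by (simp add: z_def)
  moreover have "norm (\<phi> z) \<le> norm (\<phi> x - \<phi> y) + norm (\<phi> x - \<phi> z - \<phi> y)"
    using norm_triangle_ineq4[of "\<phi> x - \<phi> y" "\<phi> x - \<phi> z - \<phi> y"] by simp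
  ultimately have "norm (\<phi> z) \<le> norm (\<phi> x - \<phi> y) + norm (\<phi> z) / 4" by linarith
  then show ?thesis using norm_ge_zero[of "\<phi> z"] unfolding z_def by linarith
qed

text \<open>The three claims need each other: membership in the chart allows the product estimate,
  this gives the quadratic error, and the quadratic error gives the norm bound that keeps the next
  factor inside \<open>B r\<close>.\<close>

lemma est_pow:
  assumes "x \<in> U" "real m * norm (\<phi> x) < r / 4"
  shows "x [^] m \<in> U \<and> norm (\<phi> (x [^] m) - real m *\<^sub>R \<phi> x) \<le> 2 * C * (real m * norm (\<phi> x))\<^sup>2 \<and>
    norm (\<phi> (x [^] m)) \<le> 2 * (real m * norm (\<phi> x))"
  using assms(2)
proof (induction m)
  case 0
  then show ?case by (simp add: oneU \<phi>_one)
next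
  case (Suc m)
  define a where "a = norm (\<phi> x)"
  have a: "a \<ge> 0" by (simp add: a_def)
  have Sm: "real m * a + a < r / 4" using Suc.prems by (simp add: a_def algebra_simps)
  have ma: "0 \<le> real m * a" using a by simp
  have IH: "x [^] m \<in> U" "norm (\<phi> (x [^] m) - real m *\<^sub>R \<phi> x) \<le> 2 * C * (real m * a)\<^sup>2"
    "norm (\<phi> (x [^] m)) \<le> 2 * (real m * a)"
  proof -
    have "real m * norm (\<phi> x) < r / 4" using Sm a unfolding a_def by linarith
    from Suc.IH[OF this] show "x [^] m \<in> U" "norm (\<phi> (x [^] m) - real m *\<^sub>R \<phi> x) \<le> 2 * C * (real m * a)\<^sup>2"
      "norm (\<phi> (x [^] m)) \<le> 2 * (real m * a)" by (simp_all add: a_def)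
  qed
  have xB: "x \<in> B r" "x [^] m \<in> B r"
  proof -
    have "a < r" "2 * (real m * a) < r" using Sm ma a r by linarith+
    then show "x \<in> B r" "x [^] m \<in> B r" using assms(1) IH(1,3) by (auto simp: B_def a_def)
  qed
  have xc: "x \<in> carrier G" using assms(1) U_carrier by simp
  have comm: "x [^] Suc m = x \<otimes> x [^] m" using xc by (simp add: m_comm)
  have inU: "x [^] Suc m \<in> U" unfolding comm using xB by (intro mult_in) (auto simp: B_def)
  have "norm (\<phi> (x [^] Suc m) - \<phi> x - \<phi> (x [^] m)) \<le> C * (norm (\<phi> x) + norm (\<phi> (x [^] m))) * norm (\<phi> x)"
    unfolding comm using xB by (intro est) (auto simp: B_def)
  also have "\<dots> \<le> C * (a + 2 * (real m * a)) * a"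
    using IH C unfolding a_def by (intro mult_right_mono mult_left_mono add_mono) auto
  finally have 1: "norm (\<phi> (x [^] Suc m) - \<phi> x - \<phi> (x [^] m)) \<le> C * (a + 2 * (real m * a)) * a" .
  have eq: "\<phi> (x [^] Suc m) - real (Suc m) *\<^sub>R \<phi> x =
    (\<phi> (x [^] Suc m) - \<phi> x - \<phi> (x [^] m)) + (\<phi> (x [^] m) - real m *\<^sub>R \<phi> x)"
    by (simp add: algebra_simps)
  have "norm (\<phi> (x [^] Suc m) - real (Suc m) *\<^sub>R \<phi> x) \<le> C * (a + 2 * (real m * a)) * a + 2 * C * (real m * a)\<^sup>2"
    unfolding eq by (rule norm_triangle_mono[OF 1 IH(2)])
  \<comment> \<open>The new error \<open>C * (1 + 2 * m) * a^2\<close> is half of the growth of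
    \<open>2 * C * (m * a)^2\<close> from \<open>m\<close> to \<open>m + 1\<close>.\<close>
  also have "\<dots> \<le> 2 * C * (real (Suc m) * a)\<^sup>2"
  proof -
    have "2 * C * (real (Suc m) * a)\<^sup>2 - (C * (a + 2 * (real m * a)) * a + 2 * C * (real m * a)\<^sup>2) =
      C * (a\<^sup>2 + 2 * (real m * a\<^sup>2))" by (simp add: power2_eq_square algebra_simps)
    moreover have "0 \<le> C * (a\<^sup>2 + 2 * (real m * a\<^sup>2))" using C by simp
    ultimately show ?thesis by linarith
  qed
  finally have 2: "norm (\<phi> (x [^] Suc m) - real (Suc m) *\<^sub>R \<phi> x) \<le> 2 * C * (real (Suc m) * a)\<^sup>2" .
  have "2 * C * (real (Suc m) * a)\<^sup>2 \<le> real (Suc m) * a"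
  proof -
    have "2 * C * (real (Suc m) * a) \<le> 2 * C * (r / 4)"
      using Sm C by (intro mult_left_mono) (auto simp: algebra_simps)
    also have "\<dots> \<le> 1" using Cr by simp
    finally have "2 * C * (real (Suc m) * a) * (real (Suc m) * a) \<le> 1 * (real (Suc m) * a)"
      using a by (intro mult_right_mono) auto
    then show ?thesis by (simp add: power2_eq_square mult.assoc)
  qed
  moreover have "norm (\<phi> (x [^] Suc m)) \<le> norm (\<phi> (x [^] Suc m) - real (Suc m) *\<^sub>R \<phi> x) + norm (real (Suc m) *\<^sub>R \<phi> x)"
    by (metis diff_add_cancel norm_triangle_ineq)
  moreover have "norm (real (Suc m) *\<^sub>R \<phi> x) = real (Suc m) * a" by (simp add: a_def)
  ultimately have "norm (\<phi> (x [^] Suc m)) \<le> 2 * (real (Suc m) * a)" using 2 by linarith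
  then show ?case using inU 2 by (simp add: a_def)
qed

text \<open>Continuity of division gives a neighbourhood of the identity; openness of the chart
  shrinks it to a coordinate ball. The cap \<open>r / 4\<close> is the range of
  \<open>est_pow\<close>.\<close>

lemma division_radius:
  obtains s where "s > 0" "s \<le> r / 4" "\<And>x y. x \<in> B s \<Longrightarrow> y \<in> B s \<Longrightarrow> x \<otimes> inv y \<in> B r"
proof -
  have "(case (\<one>, \<one>) of (x, y) \<Rightarrow> x \<otimes> inv y) \<in> B r" using one_B[OF r] by simp
  then obtain W where W: "openin T W" "\<one> \<in> W" "\<And>x y. x \<in> W \<Longrightarrow> y \<in> W \<Longrightarrow> (case (x, y) of (x, y) \<Rightarrow> x \<otimes> inv y) \<in> B r"
    using openin_nbhd_pair[OF continuous_div openB] by metis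
  have "open (\<phi> ` (W \<inter> U))" using W openU by (intro open_image) auto
  moreover have "0 \<in> \<phi> ` (W \<inter> U)" using W oneU \<phi>_one by (metis IntI image_eqI)
  ultimately obtain e where e: "e > 0" "ball 0 e \<subseteq> \<phi> ` (W \<inter> U)"
    by (meson open_contains_ball)
  have sub: "B e \<subseteq> W"
  proof
    fix x assume x: "x \<in> B e"
    then have "\<phi> x \<in> \<phi> ` (W \<inter> U)" using e by (auto simp: B_def)
    then show "x \<in> W" using inj x by (auto simp: B_def dest: inj_onD)
  qed
  show thesis
  proof (rule that[of "min e (r / 4)"])
    fix x y assume "x \<in> B (min e (r / 4))" "y \<in> B (min e (r / 4))"
    then show "x \<otimes> inv y \<in> B r" using W(3)[of x y] sub B_mono[of "min e (r/4)" e] by auto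
  qed (use e r in auto)
qed

end

lemma convergent_of_geometric_increments:
  fixes a :: "nat \<Rightarrow> 'e::banach"
  assumes "\<And>n. norm (a (Suc n) - a n) \<le> K * (1/2) ^ n"
  shows "convergent a"
proof -
  have "summable (\<lambda>n. K * (1/2) ^ n :: real)" by (intro summable_mult summable_geometric) simp
  then have "summable (\<lambda>n. a (Suc n) - a n)"
    by (rule summable_comparison_test'[where N=0]) (use assms in auto)
  then have "convergent (\<lambda>n. \<Sum>k<n. a (Suc k) - a k)" by (simp add: summable_iff_convergent)
  then have "convergent (\<lambda>n. a n - a 0)" by (simp add: sum_lessThan_telescope)
  then have "convergent (\<lambda>n. (a n - a 0) + a 0)" by (intro convergent_add convergent_const)
  then show ?thesis by simp
qed

locale local_exponential = local_coordinates G T U \<phi> r C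
  for G :: "('a, 'm) monoid_scheme" (structure) and T U and \<phi> :: "'a \<Rightarrow> 'e::euclidean_space" and r C +
  fixes s :: real
  assumes s: "s > 0" "s \<le> r / 4"
    and quotient_in: "\<And>x y. x \<in> B s \<Longrightarrow> y \<in> B s \<Longrightarrow> x \<otimes> inv y \<in> B r"
begin

lemma sr: "s < r" using s by simp

lemma B_s_r: "x \<in> B s \<Longrightarrow> x \<in> B r"
  using sr by (auto simp: B_def)

lemma est_quotient_s: "x \<in> B s \<Longrightarrow> y \<in> B s \<Longrightarrow> norm (\<phi> (x \<otimes> inv y)) \<le> 2 * norm (\<phi> x - \<phi> y)"
  using quotient_in[of x y] B_s_r[of y] by (intro est_quotient) (auto simp: B_def)

lemma mult_bound:
  assumes "x \<in> B r" "y \<in> B r"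
  shows "x \<otimes> y \<in> U" "norm (\<phi> (x \<otimes> y)) \<le> 2 * norm (\<phi> x) + norm (\<phi> y)"
proof -
  show "x \<otimes> y \<in> U" using assms by (intro mult_in) (auto simp: B_def)
  show "norm (\<phi> (x \<otimes> y)) \<le> 2 * norm (\<phi> x) + norm (\<phi> y)"
    using est_diff[OF assms] norm_triangle_ineq[of "\<phi> (x \<otimes> y) - \<phi> y" "\<phi> y"] by simp
qed

text \<open>The two products differ by the factor \<open>x \<otimes> inv x'\<close>. One factor 2
  comes from \<open>est_quotient_s\<close>, the other from \<open>est_diff\<close>.\<close>

lemma mult_Lipschitz:
  assumes x: "x \<in> B s" "x' \<in> B s" and y: "y \<in> B s"
  shows "norm (\<phi> (x \<otimes> y) - \<phi> (x' \<otimes> y)) \<le> 4 * norm (\<phi> x - \<phi> x')"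
proof -
  have c: "x \<in> carrier G" "x' \<in> carrier G" "y \<in> carrier G" using assms B_carrier by auto
  define a where "a = x \<otimes> inv x'"
  have a: "a \<in> B r" unfolding a_def by (rule quotient_in[OF x])
  have "x \<otimes> y = a \<otimes> (x' \<otimes> y)" using c by (simp add: a_def m_assoc) (simp add: m_assoc[symmetric])
  moreover have "x' \<otimes> y \<in> B r"
    using mult_bound[of x' y] x y s by (auto simp: B_s_r) (auto simp: B_def)
  ultimately have "norm (\<phi> (x \<otimes> y) - \<phi> (x' \<otimes> y)) \<le> 2 * norm (\<phi> a)"
    using est_diff[OF a, of "x' \<otimes> y"] by simp
  also have "\<dots> \<le> 4 * norm (\<phi> x - \<phi> x')"
    using est_quotient_s[OF x] by (simp add: a_def)
  finally show ?thesis .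
qed

text \<open>A quarter of \<open>s\<close>: powers of size up to \<open>2 * norm v\<close>, and
  products of two elements of size below \<open>\<delta>\<close>, whose size is below
  \<open>3 * \<delta>\<close>, all stay in \<open>B s\<close>.\<close>

definition \<delta> :: real where "\<delta> = s / 4"

text \<open>The approximants \<open>(exp (v / 2\<^sup>n))\<^bsup>2\<^sup>n\<^esup>\<close> with the chart in place of \<open>exp\<close>.\<close>

definition \<xi> :: "'e \<Rightarrow> nat \<Rightarrow> 'a" where
  "\<xi> v n = \<psi> ((1/2) ^ n *\<^sub>R v) [^] (2 ^ n :: nat)"

lemma \<delta>: "\<delta> > 0" "\<delta> < r / 4" "4 * \<delta> = s"
  using s by (auto simp: \<delta>_def)

lemma norm_half: "norm ((1/2::real) ^ n *\<^sub>R v) = (1/2) ^ n * norm v"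
  by simp

lemma half_le: "(1/2::real) ^ n * norm v \<le> norm v"
  using power_le_one[of "1/2::real" n] mult_right_mono[of "(1/2::real) ^ n" 1 "norm v"] by simp

lemma \<psi>_half:
  assumes "norm v < \<delta>"
  shows "\<psi> ((1/2) ^ n *\<^sub>R v) \<in> B s" "\<phi> (\<psi> ((1/2) ^ n *\<^sub>R v)) = (1/2) ^ n *\<^sub>R v"
proof -
  have lt: "norm ((1/2::real) ^ n *\<^sub>R v) < \<delta>" using half_le[of n v] assms unfolding norm_half by linarith
  then have "norm ((1/2::real) ^ n *\<^sub>R v) < r" "norm ((1/2::real) ^ n *\<^sub>R v) < s"
    using \<delta> r by linarith+
  with \<psi>[of "(1/2) ^ n *\<^sub>R v"]
  show "\<psi> ((1/2) ^ n *\<^sub>R v) \<in> B s" "\<phi> (\<psi> ((1/2) ^ n *\<^sub>R v)) = (1/2) ^ n *\<^sub>R v"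
    by (simp_all add: B_def)
qed

lemma two_half: "(2::real) ^ n * (1/2) ^ n = 1"
  by (simp add: power_divide)

lemma \<xi>:
  assumes v: "norm v < \<delta>"
  shows "\<xi> v n \<in> B s" "norm (\<phi> (\<xi> v n) - v) \<le> 2 * C * (norm v)\<^sup>2" "norm (\<phi> (\<xi> v n)) \<le> 2 * norm v"
proof -
  let ?x = "\<psi> ((1/2) ^ n *\<^sub>R v)"
  have x: "?x \<in> U" "\<phi> ?x = (1/2) ^ n *\<^sub>R v" using \<psi>_half[OF v, of n] by (auto simp: B_def)
  have m: "real (2 ^ n) * norm (\<phi> ?x) = norm v"
    using two_half[of n] unfolding x(2) norm_half by (simp only: of_nat_power of_nat_numeral mult.assoc[symmetric])
  have m': "real (2 ^ n) *\<^sub>R \<phi> ?x = v"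
    using two_half[of n] unfolding x(2) by (simp only: of_nat_power of_nat_numeral scaleR_scaleR scaleR_one)
  have "norm v < r / 4" using v \<delta> by simp
  from est_pow[OF x(1), of "2 ^ n", unfolded m m', OF this]
  have *: "\<xi> v n \<in> U" "norm (\<phi> (\<xi> v n) - v) \<le> 2 * C * (norm v)\<^sup>2" "norm (\<phi> (\<xi> v n)) \<le> 2 * norm v"
    by (auto simp: \<xi>_def)
  show "norm (\<phi> (\<xi> v n) - v) \<le> 2 * C * (norm v)\<^sup>2" "norm (\<phi> (\<xi> v n)) \<le> 2 * norm v" by fact+
  show "\<xi> v n \<in> B s" using * v \<delta> by (auto simp: B_def)
qed

text \<open>The source of convergence: raising to the power \<open>2^n\<close> multiplies the size
  by at most \<open>2 * 2^n\<close>, so a discrepancy of order \<open>4^-n\<close> ends at order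
  \<open>2^-n\<close>.\<close>

lemma pow_small:
  assumes w: "w \<in> U" "norm (\<phi> w) \<le> K * ((1/2) ^ n)\<^sup>2" and K: "K < r / 4"
  shows "w [^] (2 ^ n :: nat) \<in> B r" "norm (\<phi> (w [^] (2 ^ n :: nat))) \<le> 2 * K * (1/2) ^ n"
proof -
  have "real (2 ^ n) * norm (\<phi> w) \<le> 2 ^ n * (K * ((1/2) ^ n)\<^sup>2)"
    using w(2) by (intro mult_mono) auto
  also have "\<dots> = (2 ^ n * (1/2) ^ n) * K * (1/2) ^ n" by (simp add: power2_eq_square)
  also have "\<dots> = K * (1/2) ^ n" by (simp only: two_half mult_1)
  finally have *: "real (2 ^ n) * norm (\<phi> w) \<le> K * (1/2) ^ n" .
  have "0 \<le> K"
  proof (rule ccontr)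
    assume "\<not> 0 \<le> K"
    then have "K * ((1/2) ^ n)\<^sup>2 < 0" by (intro mult_neg_pos) auto
    with w(2) norm_ge_zero[of "\<phi> w"] show False by linarith
  qed
  then have "K * (1/2) ^ n \<le> K * 1" by (intro mult_left_mono power_le_one) auto
  with * K have lt: "real (2 ^ n) * norm (\<phi> w) < r / 4" by linarith
  from est_pow[OF w(1) lt]
  have in_U: "w [^] (2 ^ n :: nat) \<in> U" and le: "norm (\<phi> (w [^] (2 ^ n :: nat))) \<le> 2 * (real (2 ^ n) * norm (\<phi> w))"
    by blast+
  then show "w [^] (2 ^ n :: nat) \<in> B r" using lt r by (simp add: B_def)
  show "norm (\<phi> (w [^] (2 ^ n :: nat))) \<le> 2 * K * (1/2) ^ n" using le * by linarith
qed

text \<open>Absorbs quadratic terms into linear ones: \<open>norm v < r / 4\<close> and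
  \<open>8 * C * r \<le> 1\<close>.\<close>

lemma C_small: "norm v < \<delta> \<Longrightarrow> norm u < \<delta> \<Longrightarrow> 16 * (C * norm v * norm u) \<le> norm u"
proof -
  assume v: "norm v < \<delta>" and u: "norm u < \<delta>"
  have "C * norm v \<le> C * (r / 4)" using v \<delta> C by (intro mult_left_mono) auto
  then have "16 * (C * norm v) \<le> 1" using Cr by simp
  then have "16 * (C * norm v) * norm u \<le> 1 * norm u" by (rule mult_right_mono) simp
  then show ?thesis by simp
qed

text \<open>Squaring the point at \<open>v / 2^(n+1)\<close> nearly gives the point at
  \<open>v / 2^n\<close>; the quotient \<open>w\<close> is of order \<open>4^-n\<close>, and its
  power \<open>2^n\<close> is the quotient of consecutive approximants.\<close>

lemma \<xi>_increment:
  assumes v: "norm v < \<delta>"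
  shows "norm (\<phi> (\<xi> v (Suc n)) - \<phi> (\<xi> v n)) \<le> 16 * C * (norm v)\<^sup>2 * (1/2) ^ n"
proof -
  let ?x = "\<psi> ((1/2) ^ n *\<^sub>R v)" and ?y = "\<psi> ((1/2) ^ Suc n *\<^sub>R v)"
  note x = \<psi>_half[OF v, of n] and y = \<psi>_half[OF v, of "Suc n"]
  have c: "?x \<in> carrier G" "?y \<in> carrier G" using x(1) y(1) B_carrier by auto
  have nv: "norm v < r / 4" using v \<delta> by linarith
  have two: "real 2 * norm (\<phi> ?y) = (1/2) ^ n * norm v" "real 2 *\<^sub>R \<phi> ?y = (1/2) ^ n *\<^sub>R v"
    unfolding y(2) by simp_all
  have "real 2 * norm (\<phi> ?y) < r / 4" unfolding two using half_le[of n v] nv by linarith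
  from est_pow[OF _ this] y(1)
  have yy: "?y [^] (2::nat) \<in> U" "norm (\<phi> (?y [^] (2::nat)) - (1/2) ^ n *\<^sub>R v) \<le> 2 * C * ((1/2) ^ n * norm v)\<^sup>2"
    "norm (\<phi> (?y [^] (2::nat))) \<le> 2 * ((1/2) ^ n * norm v)"
    unfolding two by (auto simp: B_def)
  have yB: "?y [^] (2::nat) \<in> B s"
    using yy half_le[of n v] v \<delta> by (simp add: B_def)
  define w where "w = ?y [^] (2::nat) \<otimes> inv ?x"
  have w: "w \<in> U" unfolding w_def using quotient_in[OF yB x(1)] by (simp add: B_def)
  have "norm (\<phi> w) \<le> 2 * norm (\<phi> (?y [^] (2::nat)) - (1/2) ^ n *\<^sub>R v)"
    unfolding w_def using est_quotient_s[OF yB x(1)] by (simp only: x(2))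
  also have "\<dots> \<le> (4 * C * (norm v)\<^sup>2) * ((1/2) ^ n)\<^sup>2"
    using yy(2) by (simp add: power_mult_distrib mult_ac)
  finally have wn: "norm (\<phi> w) \<le> (4 * C * (norm v)\<^sup>2) * ((1/2) ^ n)\<^sup>2" .
  have K: "4 * C * (norm v)\<^sup>2 < r / 4"
  proof -
    have "4 * C * (norm v)\<^sup>2 = 4 * (C * norm v * norm v)" by (simp add: power2_eq_square)
    then show ?thesis using C_small[OF v v] nv norm_ge_zero[of v] by linarith
  qed
  note p = pow_small[OF w wn K]
  have wc: "w \<in> carrier G" using w U_carrier by simp
  \<comment> \<open>Commutativity enters here: the power of \<open>w \<otimes> ?x\<close> splits,
    and \<open>w\<close> is raised to its power on its own.\<close>
  have "\<xi> v (Suc n) = w [^] (2 ^ n :: nat) \<otimes> \<xi> v n"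
  proof -
    have "\<xi> v (Suc n) = (?y [^] (2::nat)) [^] (2 ^ n :: nat)"
      using c by (simp add: \<xi>_def nat_pow_pow)
    also have "?y [^] (2::nat) = w \<otimes> ?x" using c by (simp add: w_def m_assoc)
    also have "(w \<otimes> ?x) [^] (2 ^ n :: nat) = w [^] (2 ^ n :: nat) \<otimes> ?x [^] (2 ^ n :: nat)"
      using c wc by (simp add: nat_pow_distrib)
    finally show ?thesis by (simp add: \<xi>_def)
  qed
  then have "norm (\<phi> (\<xi> v (Suc n)) - \<phi> (\<xi> v n)) \<le> 2 * norm (\<phi> (w [^] (2 ^ n :: nat)))"
    using est_diff[OF p(1) B_s_r[OF \<xi>(1)[OF v]], of n] by simp
  also have "\<dots> \<le> 16 * C * (norm v)\<^sup>2 * (1/2) ^ n" using p(2) by simp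
  finally show ?thesis .
qed

text \<open>The limit is taken in coordinates and pulled back; the bound \<open>2 * norm v\<close>
  on the approximants keeps it in the range where \<open>\<psi>\<close> inverts the chart.\<close>

definition lexp :: "'e \<Rightarrow> 'a" where
  "lexp v = \<psi> (lim (\<lambda>n. \<phi> (\<xi> v n)))"

lemma lexp:
  assumes v: "norm v < \<delta>"
  shows "lexp v \<in> B s" "(\<lambda>n. \<phi> (\<xi> v n)) \<longlonglongrightarrow> \<phi> (lexp v)"
    "norm (\<phi> (lexp v) - v) \<le> 2 * C * (norm v)\<^sup>2" "norm (\<phi> (lexp v)) \<le> 2 * norm v"
proof -
  define l where "l = lim (\<lambda>n. \<phi> (\<xi> v n))"
  have l: "(\<lambda>n. \<phi> (\<xi> v n)) \<longlonglongrightarrow> l"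
    unfolding l_def using convergent_of_geometric_increments[OF \<xi>_increment[OF v]]
    by (simp add: convergent_LIMSEQ_iff)
  have "norm l \<le> 2 * norm v"
    by (rule LIMSEQ_le_const2[OF tendsto_norm[OF l]]) (use \<xi>(3)[OF v] in auto)
  moreover have d: "norm (l - v) \<le> 2 * C * (norm v)\<^sup>2"
    by (rule LIMSEQ_le_const2[OF tendsto_norm[OF tendsto_diff[OF l tendsto_const]]]) (use \<xi>(2)[OF v] in auto)
  moreover have "norm l < s" using \<open>norm l \<le> 2 * norm v\<close> v \<delta> by linarith
  moreover from this have "lexp v \<in> U" "\<phi> (lexp v) = l"
    using \<psi>[of l] sr by (auto simp: lexp_def l_def)
  ultimately show "lexp v \<in> B s" "(\<lambda>n. \<phi> (\<xi> v n)) \<longlonglongrightarrow> \<phi> (lexp v)"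
    "norm (\<phi> (lexp v) - v) \<le> 2 * C * (norm v)\<^sup>2" "norm (\<phi> (lexp v)) \<le> 2 * norm v"
    using l by (auto simp: B_def)
qed

text \<open>Same mechanism as for the increments. Now \<open>w\<close> measures the failure of
  \<open>\<psi>\<close> to be additive at scale \<open>2^-n\<close>, again of order
  \<open>4^-n\<close> by the product estimate.\<close>

lemma \<xi>_add:
  assumes u: "norm u < \<delta>" and v: "norm v < \<delta>" and uv: "norm (u + v) < \<delta>"
  shows "(\<lambda>n. \<phi> (\<xi> u n \<otimes> \<xi> v n) - \<phi> (\<xi> (u + v) n)) \<longlonglongrightarrow> 0"
proof -
  define K where "K = 2 * C * (norm u + norm v) * norm u"
  have K: "K < r / 4"
  proof -
    have "K = 2 * (C * norm u * norm u) + 2 * (C * norm v * norm u)" by (simp add: K_def algebra_simps)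
    moreover have "norm u < r / 4" using u \<delta> by linarith
    ultimately show ?thesis using C_small[OF u u] C_small[OF v u] norm_ge_zero[of u] by linarith
  qed
  have bound: "norm (\<phi> (\<xi> u n \<otimes> \<xi> v n) - \<phi> (\<xi> (u + v) n)) \<le> 4 * K * (1/2) ^ n" for n
  proof -
    let ?x = "\<psi> ((1/2) ^ n *\<^sub>R u)" and ?y = "\<psi> ((1/2) ^ n *\<^sub>R v)" and ?z = "\<psi> ((1/2) ^ n *\<^sub>R (u + v))"
    note x = \<psi>_half[OF u, of n] and y = \<psi>_half[OF v, of n] and z = \<psi>_half[OF uv, of n]
    have c: "?x \<in> carrier G" "?y \<in> carrier G" "?z \<in> carrier G" using x(1) y(1) z(1) B_carrier by auto
    have nx: "norm (\<phi> ?x) = (1/2) ^ n * norm u" and ny: "norm (\<phi> ?y) = (1/2) ^ n * norm v"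
      unfolding x(2) y(2) by simp_all
    have xy: "?x \<otimes> ?y \<in> B s"
      using mult_bound[OF B_s_r[OF x(1)] B_s_r[OF y(1)]] half_le[of n u] half_le[of n v] u v \<delta>
      unfolding nx ny by (simp add: B_def)
    have "norm (\<phi> (?x \<otimes> ?y) - \<phi> ?x - \<phi> ?y) \<le> C * (norm (\<phi> ?x) + norm (\<phi> ?y)) * norm (\<phi> ?x)"
      using B_s_r[OF x(1)] B_s_r[OF y(1)] by (intro est) (auto simp: B_def)
    then have e: "norm (\<phi> (?x \<otimes> ?y) - \<phi> ?z) \<le> C * ((1/2) ^ n * norm u + (1/2) ^ n * norm v) * ((1/2) ^ n * norm u)"
      unfolding nx ny unfolding x(2) y(2) z(2) by (simp add: scaleR_add_right diff_diff_eq)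
    define w where "w = (?x \<otimes> ?y) \<otimes> inv ?z"
    have w: "w \<in> U" unfolding w_def using quotient_in[OF xy z(1)] by (simp add: B_def)
    have wc: "w \<in> carrier G" using w U_carrier by simp
    have "norm (\<phi> w) \<le> 2 * (C * ((1/2) ^ n * norm u + (1/2) ^ n * norm v) * ((1/2) ^ n * norm u))"
      unfolding w_def using est_quotient_s[OF xy z(1)] e by linarith
    also have "\<dots> = K * ((1/2) ^ n)\<^sup>2" by (simp add: K_def power2_eq_square algebra_simps)
    finally have wn: "norm (\<phi> w) \<le> K * ((1/2) ^ n)\<^sup>2" .
    note p = pow_small[OF w wn K]
    have "\<xi> u n \<otimes> \<xi> v n = w [^] (2 ^ n :: nat) \<otimes> \<xi> (u + v) n"
    proof -
      have "\<xi> u n \<otimes> \<xi> v n = (?x \<otimes> ?y) [^] (2 ^ n :: nat)"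
        using c by (simp add: \<xi>_def nat_pow_distrib)
      also have "?x \<otimes> ?y = w \<otimes> ?z" using c by (simp add: w_def m_assoc)
      also have "(w \<otimes> ?z) [^] (2 ^ n :: nat) = w [^] (2 ^ n :: nat) \<otimes> ?z [^] (2 ^ n :: nat)"
        using c wc by (simp add: nat_pow_distrib)
      finally show ?thesis by (simp add: \<xi>_def)
    qed
    then have "norm (\<phi> (\<xi> u n \<otimes> \<xi> v n) - \<phi> (\<xi> (u + v) n)) \<le> 2 * norm (\<phi> (w [^] (2 ^ n :: nat)))"
      using est_diff[OF p(1) B_s_r[OF \<xi>(1)[OF uv]], of n] by simp
    also have "\<dots> \<le> 4 * K * (1/2) ^ n" using p(2) by simp
    finally show ?thesis .
  qed
  have "(\<lambda>n. 4 * K * (1/2) ^ n) \<longlonglongrightarrow> 4 * K * 0"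
    by (intro tendsto_mult tendsto_const LIMSEQ_power_zero) simp
  then show ?thesis
    by (intro Lim_null_comparison[OF always_eventually, rule_format, OF bound]) simp
qed

lemma lexp_add:
  assumes u: "norm u < \<delta>" and v: "norm v < \<delta>" and uv: "norm (u + v) < \<delta>"
  shows "lexp (u + v) = lexp u \<otimes> lexp v"
proof -
  have c: "lexp u \<in> carrier G" "lexp v \<in> carrier G" "\<xi> v n \<in> carrier G" for n
    using lexp(1)[OF u] lexp(1)[OF v] \<xi>(1)[OF v] B_carrier by auto
  have "norm (\<phi> (\<xi> u n \<otimes> \<xi> v n) - \<phi> (lexp u \<otimes> lexp v)) \<le>
      4 * norm (\<phi> (\<xi> u n) - \<phi> (lexp u)) + 4 * norm (\<phi> (\<xi> v n) - \<phi> (lexp v))" for n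
  proof -
    have "norm (\<phi> (\<xi> u n \<otimes> \<xi> v n) - \<phi> (lexp u \<otimes> \<xi> v n)) \<le> 4 * norm (\<phi> (\<xi> u n) - \<phi> (lexp u))"
      by (intro mult_Lipschitz lexp(1) \<xi>(1) u v)
    moreover have "norm (\<phi> (\<xi> v n \<otimes> lexp u) - \<phi> (lexp v \<otimes> lexp u)) \<le> 4 * norm (\<phi> (\<xi> v n) - \<phi> (lexp v))"
      by (intro mult_Lipschitz lexp(1) \<xi>(1) u v)
    \<comment> \<open>\<open>mult_Lipschitz\<close> concerns the first factor only; commutativity
      transfers it to the second.\<close>
    moreover have "\<xi> v n \<otimes> lexp u = lexp u \<otimes> \<xi> v n" "lexp v \<otimes> lexp u = lexp u \<otimes> lexp v"
      using c by (auto simp: m_comm)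
    ultimately show ?thesis
      using norm_triangle_ineq[of "\<phi> (\<xi> u n \<otimes> \<xi> v n) - \<phi> (lexp u \<otimes> \<xi> v n)"
          "\<phi> (lexp u \<otimes> \<xi> v n) - \<phi> (lexp u \<otimes> lexp v)"] by simp
  qed
  moreover have "(\<lambda>n. 4 * norm (\<phi> (\<xi> u n) - \<phi> (lexp u)) + 4 * norm (\<phi> (\<xi> v n) - \<phi> (lexp v))) \<longlonglongrightarrow> 0"
    using lexp(2)[OF u] lexp(2)[OF v]
    by (intro tendsto_add_zero tendsto_mult_right_zero tendsto_norm_zero) (simp_all add: LIM_zero)
  ultimately have "(\<lambda>n. \<phi> (\<xi> u n \<otimes> \<xi> v n) - \<phi> (lexp u \<otimes> lexp v)) \<longlonglongrightarrow> 0"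
    by (rule Lim_null_comparison[OF always_eventually, rule_format])
  then have 1: "(\<lambda>n. \<phi> (\<xi> u n \<otimes> \<xi> v n)) \<longlonglongrightarrow> \<phi> (lexp u \<otimes> lexp v)" by (rule LIM_zero_cancel)
  have "(\<lambda>n. \<phi> (\<xi> u n \<otimes> \<xi> v n) - \<phi> (\<xi> (u + v) n) + \<phi> (\<xi> (u + v) n)) \<longlonglongrightarrow> 0 + \<phi> (lexp (u + v))"
    by (intro tendsto_add \<xi>_add lexp(2) u v uv)
  then have "\<phi> (lexp (u + v)) = \<phi> (lexp u \<otimes> lexp v)"
    using LIMSEQ_unique[OF 1] by simp
  moreover have "lexp (u + v) \<in> U" "lexp u \<otimes> lexp v \<in> U"
    using lexp(1)[OF uv] mult_bound[OF B_s_r[OF lexp(1)[OF u]] B_s_r[OF lexp(1)[OF v]]] by (auto simp: B_def)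
  ultimately show ?thesis using inj by (auto dest: inj_onD)
qed

text \<open>The coordinate of the identity is 0, so \<open>v\<close> is no longer than the quadratic
  error, which is at most an eighth of \<open>norm v\<close>.\<close>

lemma lexp_eq_one:
  assumes v: "norm v < \<delta>" and "lexp v = \<one>"
  shows "v = 0"
proof -
  have "norm v \<le> 2 * C * (norm v)\<^sup>2" using lexp(3)[OF v] assms(2) \<phi>_one by simp
  also have "\<dots> = 2 * (C * norm v * norm v)" by (simp add: power2_eq_square)
  finally have "norm v \<le> 0" using C_small[OF v v] by linarith
  then show ?thesis by simp
qed

end

section \<open>Extension of the exponential map to the whole model space\<close>

context local_exponential
begin

lemma half_power_small: "\<exists>k. (1/2::real) ^ k * norm v < \<delta>"
proof -
  have "(\<lambda>k. (1/2::real) ^ k * norm v) \<longlonglongrightarrow> 0 * norm v"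
    by (intro tendsto_mult tendsto_const LIMSEQ_power_zero) simp
  then have "eventually (\<lambda>k. (1/2::real) ^ k * norm v < \<delta>) sequentially"
    by (intro order_tendstoD) (auto simp: \<delta>)
  then show ?thesis by (auto simp: eventually_sequentially)
qed

text \<open>Any exponent \<open>k\<close> that brings \<open>v / 2^k\<close> into the local domain
  gives the same value; \<open>gexp_eq\<close> removes the choice.\<close>

definition gexp :: "'e \<Rightarrow> 'a" where
  "gexp v = (let k = SOME k. (1/2::real) ^ k * norm v < \<delta> in lexp ((1/2) ^ k *\<^sub>R v) [^] (2 ^ k :: nat))"

lemma lexp_carrier: "norm v < \<delta> \<Longrightarrow> lexp v \<in> carrier G"
  using lexp(1) B_carrier by blast

lemma lexp_halve:
  assumes "norm v < \<delta>"
  shows "lexp v = lexp ((1/2) ^ k *\<^sub>R v) [^] (2 ^ k :: nat)"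
proof (induction k)
  case 0
  then show ?case using lexp_carrier[OF assms] by simp
next
  case (Suc k)
  let ?w = "(1/2) ^ k *\<^sub>R v" and ?h = "(1/2) ^ Suc k *\<^sub>R v"
  have w: "norm ?w < \<delta>" using half_le[of k v] assms unfolding norm_half by linarith
  have h: "norm ?h < \<delta>" using half_le[of "Suc k" v] assms unfolding norm_half by linarith
  have sum: "?h + ?h = ?w" by (simp add: scaleR_add_left[symmetric])
  have "lexp ?w = lexp ?h \<otimes> lexp ?h"
    using lexp_add[OF h h] w by (simp only: sum)
  also have "\<dots> = lexp ?h [^] (2::nat)" using lexp_carrier[OF h] by (simp add: numeral_2_eq_2)
  finally have "lexp ?w [^] (2 ^ k :: nat) = lexp ?h [^] (2 * 2 ^ k :: nat)"
    using lexp_carrier[OF h] by (simp add: nat_pow_pow)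
  with Suc.IH show ?case by simp
qed

text \<open>Two admissible exponents \<open>k\<close> and \<open>j\<close> are both compared with
  \<open>k + j\<close>, by repeated halving.\<close>

lemma gexp_eq:
  assumes "(1/2::real) ^ k * norm v < \<delta>"
  shows "gexp v = lexp ((1/2) ^ k *\<^sub>R v) [^] (2 ^ k :: nat)"
proof -
  define j where "j = (SOME k. (1/2::real) ^ k * norm v < \<delta>)"
  have j: "(1/2::real) ^ j * norm v < \<delta>" unfolding j_def by (rule someI_ex[OF half_power_small])
  have *: "lexp ((1/2) ^ a *\<^sub>R v) [^] (2 ^ a :: nat) = lexp ((1/2) ^ (a + b) *\<^sub>R v) [^] (2 ^ (a + b) :: nat)"
    if "(1/2::real) ^ a * norm v < \<delta>" for a b
  proof -
    have a: "norm ((1/2::real) ^ a *\<^sub>R v) < \<delta>" using that by simp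
    have ab: "norm ((1/2::real) ^ (a + b) *\<^sub>R v) < \<delta>"
      using half_le[of b "(1/2) ^ a *\<^sub>R v"] a by (simp add: power_add mult_ac)
    have "lexp ((1/2) ^ a *\<^sub>R v) = lexp ((1/2) ^ (a + b) *\<^sub>R v) [^] (2 ^ b :: nat)"
      using lexp_halve[OF a, of b] by (simp add: power_add mult_ac)
    then show ?thesis using lexp_carrier[OF ab] by (simp add: nat_pow_pow power_add mult_ac)
  qed
  have "gexp v = lexp ((1/2) ^ j *\<^sub>R v) [^] (2 ^ j :: nat)" by (simp add: gexp_def j_def Let_def)
  also have "\<dots> = lexp ((1/2) ^ (k + j) *\<^sub>R v) [^] (2 ^ (k + j) :: nat)"
    using *[OF j, of k] by (simp add: add.commute)
  also have "\<dots> = lexp ((1/2) ^ k *\<^sub>R v) [^] (2 ^ k :: nat)" using *[OF assms, of j] by simp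
  finally show ?thesis .
qed

lemma gexp_local: "norm v < \<delta> \<Longrightarrow> gexp v = lexp v"
  using gexp_eq[of 0 v] lexp_carrier by simp

lemma gexp_carrier: "gexp v \<in> carrier G"
proof -
  obtain k where k: "(1/2::real) ^ k * norm v < \<delta>" using half_power_small by blast
  show ?thesis unfolding gexp_eq[OF k] using k by (intro nat_pow_closed lexp_carrier) simp
qed

lemma gexp_add: "gexp (u + v) = gexp u \<otimes> gexp v"
proof -
  \<comment> \<open>One exponent for \<open>u\<close>, \<open>v\<close> and \<open>u + v\<close>;
    the outer \<open>norm\<close> is the absolute value on the reals.\<close>
  obtain k where k: "(1/2::real) ^ k * norm (norm u + norm v) < \<delta>" using half_power_small[of "norm u + norm v"] by auto
  have le: "(1/2::real) ^ k * norm x < \<delta>" if "norm x \<le> norm u + norm v" for x :: 'e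
  proof -
    have "(1/2::real) ^ k * norm x \<le> (1/2::real) ^ k * norm (norm u + norm v)"
      using that by (intro mult_left_mono) auto
    with k show ?thesis by linarith
  qed
  have lu: "(1/2::real) ^ k * norm u < \<delta>" and lv: "(1/2::real) ^ k * norm v < \<delta>"
    and luv: "(1/2::real) ^ k * norm (u + v) < \<delta>"
    by (intro le; simp add: norm_triangle_ineq)+
  have "lexp ((1/2) ^ k *\<^sub>R (u + v)) = lexp ((1/2) ^ k *\<^sub>R u) \<otimes> lexp ((1/2) ^ k *\<^sub>R v)"
    using lu lv luv unfolding scaleR_add_right norm_half[symmetric] by (intro lexp_add) auto
  then show ?thesis
    unfolding gexp_eq[OF lu] gexp_eq[OF lv] gexp_eq[OF luv]
    using lu lv by (simp add: nat_pow_distrib lexp_carrier)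
qed

lemma gexp_0: "gexp 0 = \<one>"
  using gexp_add[of 0 0] gexp_carrier[of 0] by (simp add: l_cancel_one')

lemma gexp_minus: "gexp (- v) = inv (gexp v)"
  using gexp_add[of "- v" v] gexp_carrier by (simp add: gexp_0 inv_equality[symmetric])

lemma gexp_kernel_discrete: "norm v < \<delta> \<Longrightarrow> gexp v = \<one> \<Longrightarrow> v = 0"
  using gexp_local lexp_eq_one by metis

text \<open>Additivity moves the question to 0, where the coordinate of \<open>lexp\<close> is at
  most \<open>2 * norm v\<close>; hence the radius \<open>e / 2\<close>.\<close>

lemma gexp_continuous: "continuous_map euclidean T gexp"
  unfolding continuous_map_def
proof (intro conjI allI impI)
  show "gexp \<in> topspace euclidean \<rightarrow> topspace T" using gexp_carrier top by auto
  fix O' assume O: "openin T O'"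
  have "open {v. gexp v \<in> O'}"
    unfolding open_contains_ball
  proof (intro ballI)
    fix v assume v: "v \<in> {v. gexp v \<in> O'}"
    define N where "N = {x \<in> carrier G. gexp v \<otimes> x \<in> O'} \<inter> U"
    have N: "openin T N" unfolding N_def
      using openin_translate_vimage[OF gexp_carrier O] openU by blast
    have "open (\<phi> ` N)" using N by (intro open_image) (auto simp: N_def)
    moreover have "0 \<in> \<phi> ` N"
      using v oneU \<phi>_one gexp_carrier by (intro image_eqI[of _ _ \<one>]) (auto simp: N_def)
    ultimately obtain e where e: "e > 0" "ball 0 e \<subseteq> \<phi> ` N" by (meson open_contains_ball)
    show "\<exists>e>0. ball v e \<subseteq> {v. gexp v \<in> O'}"
    proof (intro exI conjI subsetI)
      show "min (e / 2) \<delta> > 0" using e \<delta> by simp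
      fix w assume "w \<in> ball v (min (e / 2) \<delta>)"
      then have d: "norm (w - v) < \<delta>" "norm (w - v) < e / 2" by (auto simp: dist_norm norm_minus_commute)
      have "norm (\<phi> (lexp (w - v))) < e" using lexp(4)[OF d(1)] d(2) by linarith
      then have "\<phi> (lexp (w - v)) \<in> \<phi> ` N" using e by auto
      moreover have "lexp (w - v) \<in> U" using lexp(1)[OF d(1)] by (simp add: B_def)
      ultimately have "lexp (w - v) \<in> N" using inj by (auto simp: N_def dest: inj_onD)
      then have "gexp v \<otimes> gexp (w - v) \<in> O'" using gexp_local[OF d(1)] by (simp add: N_def)
      then show "w \<in> {v. gexp v \<in> O'}" by (simp add: gexp_add[symmetric])
    qed
  qed
  then show "openin euclidean {x \<in> topspace euclidean. gexp x \<in> O'}" by simp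
qed

lemma gexp_vimage_open: "openin T V \<Longrightarrow> open {v. gexp v \<in> V}"
  using gexp_continuous by (simp add: continuous_map_def)

text \<open>Invariance of domain, applied to \<open>gexp\<close> read in the chart, a continuous map
  of the model space into itself. Injectivity needs \<open>e \<le> \<delta> / 2\<close>, so that
  differences stay where the kernel is trivial.\<close>

lemma gexp_ball_open:
  assumes e: "0 < e" "e \<le> \<delta> / 2"
  shows "openin T (gexp ` ball 0 e)"
proof -
  let ?f = "\<lambda>v. \<phi> (gexp v)"
  have U: "gexp v \<in> U" if "v \<in> ball 0 e" for v
  proof -
    have "norm v < \<delta>" using that e \<delta> by simp
    then show ?thesis using lexp(1) gexp_local by (auto simp: B_def)
  qed
  have "continuous_on (ball 0 e) ?f"
    unfolding continuous_on_open_vimage[OF open_ball]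
  proof (intro allI impI)
    fix S :: "'e set" assume "open S"
    then have "open (ball 0 e \<inter> {v. gexp v \<in> {x \<in> U. \<phi> x \<in> S}})"
      by (intro open_Int open_ball gexp_vimage_open open_vimage)
    moreover have "?f -` S \<inter> ball 0 e = ball 0 e \<inter> {v. gexp v \<in> {x \<in> U. \<phi> x \<in> S}}"
      using U by auto
    ultimately show "open (?f -` S \<inter> ball 0 e)" by simp
  qed
  moreover have "inj_on ?f (ball 0 e)"
  proof (rule inj_onI)
    fix u v assume uv: "u \<in> ball 0 e" "v \<in> ball 0 e" "?f u = ?f v"
    then have "gexp u = gexp v" using inj U by (auto dest: inj_onD)
    then have "gexp (u + - v) = \<one>" using gexp_carrier by (simp only: gexp_add gexp_minus) simp
    moreover have "norm (u + - v) < \<delta>"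
      using uv e norm_triangle_ineq[of u "- v"] by simp
    ultimately have "u + - v = 0" by (intro gexp_kernel_discrete)
    then show "u = v" by simp
  qed
  ultimately have "open (?f ` ball 0 e)" by (intro invariance_of_domain open_ball)
  then have "openin T {x \<in> U. \<phi> x \<in> ?f ` ball 0 e}" by (rule open_vimage)
  also have "{x \<in> U. \<phi> x \<in> ?f ` ball 0 e} = gexp ` ball 0 e"
    using U inj by (auto dest!: inj_onD)
  finally show ?thesis .
qed

lemma gexp_open: "open S \<Longrightarrow> openin T (gexp ` S)"
proof (subst openin_subopen, intro ballI)
  fix x assume S: "open S" and "x \<in> gexp ` S"
  then obtain v where v: "v \<in> S" "x = gexp v" by auto
  obtain e where e: "e > 0" "ball v e \<subseteq> S" using S v by (meson open_contains_ball)
  define d where "d = min e (\<delta> / 2)"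
  have d: "d > 0" "d \<le> \<delta> / 2" "d \<le> e" using e \<delta> by (auto simp: d_def)
  have "(\<lambda>y. gexp v \<otimes> y) ` gexp ` ball 0 d \<subseteq> gexp ` S"
  proof clarify
    fix w :: 'e assume "w \<in> ball 0 d"
    then have "v + w \<in> S" using e d by (auto simp: dist_norm)
    then show "gexp v \<otimes> gexp w \<in> gexp ` S" unfolding gexp_add[symmetric] by (rule imageI)
  qed
  moreover have "x \<in> (\<lambda>y. gexp v \<otimes> y) ` gexp ` ball 0 d"
    using d gexp_carrier by (intro image_eqI[of _ _ "gexp 0"] imageI) (auto simp: gexp_0 v)
  ultimately show "\<exists>O'. openin T O' \<and> x \<in> O' \<and> O' \<subseteq> gexp ` S"
    using openin_translate[OF gexp_carrier gexp_ball_open[OF d(1,2)]] by blast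
qed

text \<open>The range is an open subgroup. Its complement is a union of cosets, hence open too, and
  connectedness leaves only the whole group.\<close>

lemma gexp_surj:
  assumes "connected_space T"
  shows "range gexp = carrier G"
proof -
  have o: "openin T (range gexp)" using gexp_open[OF open_UNIV] .
  have "openin T (topspace T - range gexp)"
  proof (subst openin_subopen, intro ballI)
    fix x assume x: "x \<in> topspace T - range gexp"
    then have xc: "x \<in> carrier G" using top by simp
    have "(\<lambda>y. x \<otimes> y) ` range gexp \<subseteq> topspace T - range gexp"
    proof clarify
      fix v
      show "x \<otimes> gexp v \<in> topspace T - range gexp"
      proof (intro DiffI notI)
        show "x \<otimes> gexp v \<in> topspace T" using xc gexp_carrier top by simp
        assume "x \<otimes> gexp v \<in> range gexp"
        then obtain w where "x \<otimes> gexp v = gexp w" by auto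
        then have "x = gexp w \<otimes> inv (gexp v)" using xc gexp_carrier by (simp add: inv_solve_right)
        also have "\<dots> = gexp (w + - v)" by (simp only: gexp_add gexp_minus)
        finally show False using x by auto
      qed
    qed
    moreover have "x \<in> (\<lambda>y. x \<otimes> y) ` range gexp"
      using xc gexp_0 by (intro image_eqI[of _ _ "gexp 0"] rangeI) simp
    ultimately show "\<exists>O'. openin T O' \<and> x \<in> O' \<and> O' \<subseteq> topspace T - range gexp"
      using openin_translate[OF xc o] by blast
  qed
  then have "closedin T (range gexp)" using o openin_subset by (auto simp: closedin_def)
  with o have "range gexp = {} \<or> range gexp = topspace T"
    using assms unfolding connected_space_clopen_in by blast
  then show ?thesis using top by auto
qed

end

theorem (in local_coordinates) exists_exponential:
  assumes "connected_space T"
  obtains E :: "'e \<Rightarrow> 'a" and \<delta> where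
    "\<And>u v. E (u + v) = E u \<otimes> E v" "continuous_map euclidean T E"
    "\<And>S. open S \<Longrightarrow> openin T (E ` S)" "range E = carrier G"
    "\<delta> > 0" "\<And>v. norm v < \<delta> \<Longrightarrow> E v = \<one> \<Longrightarrow> v = 0"
proof -
  obtain s where s: "s > 0" "s \<le> r / 4" "\<And>x y. x \<in> B s \<Longrightarrow> y \<in> B s \<Longrightarrow> x \<otimes> inv y \<in> B r"
    using division_radius by blast
  interpret local_exponential G T U \<phi> r C s by unfold_locales (use s in auto)
  show thesis
    by (rule that[OF gexp_add gexp_continuous gexp_open gexp_surj[OF assms] \<delta>(1) gexp_kernel_discrete])
qed

section \<open>From a smooth atlas to local coordinates\<close>

lemma chart_open_maps:
  assumes "is_chart T (U, \<phi>)"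
  shows "openin T U" "inj_on \<phi> U"
    "\<And>V. openin T V \<Longrightarrow> V \<subseteq> U \<Longrightarrow> open (\<phi> ` V)"
    "\<And>S. open S \<Longrightarrow> openin T {x \<in> U. \<phi> x \<in> S}"
proof -
  have U: "openin T U" and o: "open (\<phi> ` U)"
    and h: "homeomorphic_map (subtopology T U) (top_of_set (\<phi> ` U)) \<phi>"
    using assms by (auto simp: is_chart_def)
  have ts: "topspace (subtopology T U) = U" using openin_subset[OF U] by auto
  show "openin T U" by (rule U)
  show "inj_on \<phi> U" using homeomorphic_imp_injective_map[OF h] ts by simp
  show "open (\<phi> ` V)" if "openin T V" "V \<subseteq> U" for V
  proof -
    have "openin (subtopology T U) V" using that by (simp add: openin_open_subtopology[OF U])
    then have "openin (top_of_set (\<phi> ` U)) (\<phi> ` V)"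
      using homeomorphic_imp_open_map[OF h] by (simp add: open_map_def)
    then show ?thesis using o openin_open_trans by blast
  qed
  show "openin T {x \<in> U. \<phi> x \<in> S}" if "open S" for S
  proof -
    have "openin (top_of_set (\<phi> ` U)) (\<phi> ` U \<inter> S)" using that by (simp add: openin_open_Int)
    then have "openin (subtopology T U) {x \<in> U. \<phi> x \<in> \<phi> ` U \<inter> S}"
      using openin_continuous_map_preimage[OF homeomorphic_imp_continuous_map[OF h]] unfolding ts by blast
    moreover have "{x \<in> U. \<phi> x \<in> \<phi> ` U \<inter> S} = {x \<in> U. \<phi> x \<in> S}" by auto
    ultimately show ?thesis by (simp add: openin_open_subtopology[OF U])
  qed
qed

text \<open>Multiplication is read in a chart around the identity, where the unit laws become
  \<open>F (z, p) = z\<close> and \<open>F (p, z) = z\<close>; translating \<open>p\<close> to 0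
  centres the chart.\<close>

lemma (in topological_abelian_group) local_coordinates_of_atlas:
  fixes A :: "('a, 'e::euclidean_space) chart set"
  assumes atlas: "smooth_atlas T A"
    and smooth: "smooth_map (prod_topology T T) (prod_atlas A A) T A (\<lambda>(x, y). x \<otimes> y)"
  obtains U and \<phi> :: "'a \<Rightarrow> 'e" and r C where "local_coordinates G T U \<phi> r C"
proof -
  have "\<one> \<in> (\<Union>c\<in>A. fst c)" using atlas top by (simp add: smooth_atlas_def)
  then obtain U \<phi> where c: "(U, \<phi>) \<in> A" and one: "\<one> \<in> U" by auto
  have "is_chart T (U, \<phi>)" using atlas c by (auto simp: smooth_atlas_def)
  note chart = chart_open_maps[OF this]
  define p where "p = \<phi> \<one>"
  have "(case (\<one>, \<one>) of (x, y) \<Rightarrow> x \<otimes> y) \<in> U" using one by simp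
  then obtain W0 where W0: "openin T W0" "\<one> \<in> W0"
      "\<And>x y. x \<in> W0 \<Longrightarrow> y \<in> W0 \<Longrightarrow> (case (x, y) of (x, y) \<Rightarrow> x \<otimes> y) \<in> U"
    by (rule openin_nbhd_pair[OF cmult chart(1)]) blast
  \<comment> \<open>Products of two points of \<open>W\<close> stay in the chart domain, so
    multiplication can be read in coordinates on all of \<open>W \<times> W\<close>.\<close>
  define W where "W = W0 \<inter> U"
  have W: "openin T W" "\<one> \<in> W" "W \<subseteq> U" "\<And>x y. x \<in> W \<Longrightarrow> y \<in> W \<Longrightarrow> x \<otimes> y \<in> U"
    using W0 chart(1) one by (auto simp: W_def)
  have "open (\<phi> ` W)" using W by (intro chart(3))
  moreover have "p \<in> \<phi> ` W" using W by (simp add: p_def)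
  ultimately obtain \<rho> where \<rho>: "\<rho> > 0" "ball p \<rho> \<subseteq> \<phi> ` W" by (meson open_contains_ball)
  have inW: "x \<in> W" if "x \<in> U" "\<phi> x \<in> ball p \<rho>" for x
  proof -
    have "\<phi> x \<in> \<phi> ` W" using that \<rho> by blast
    then show ?thesis using that W(3) chart(2) by (auto dest: inj_onD)
  qed
  define F where "F = \<phi> \<circ> (\<lambda>(x, y). x \<otimes> y) \<circ> inv_into (U \<times> U) (map_prod \<phi> \<phi>)"
  define S where "S = map_prod \<phi> \<phi> ` {x \<in> U \<times> U. (case x of (x, y) \<Rightarrow> x \<otimes> y) \<in> U}"
  have "(U \<times> U, map_prod \<phi> \<phi>) \<in> prod_atlas A A" using c by (auto simp: prod_atlas_def)
  then have sm: "smooth_on S F"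
    using smooth c unfolding smooth_map_def S_def F_def by blast
  have Feq: "F (\<phi> a, \<phi> b) = \<phi> (a \<otimes> b)" if "a \<in> U" "b \<in> U" for a b
  proof -
    have "inv_into (U \<times> U) (map_prod \<phi> \<phi>) (map_prod \<phi> \<phi> (a, b)) = (a, b)"
      using that by (intro inv_into_f_f map_prod_inj_on chart(2)) auto
    then show ?thesis by (simp add: F_def)
  qed
  have inS: "ball p \<rho> \<times> ball p \<rho> \<subseteq> S"
  proof
    fix z assume "z \<in> ball p \<rho> \<times> ball p \<rho>"
    then have "fst z \<in> \<phi> ` W" "snd z \<in> \<phi> ` W" using \<rho>(2) by (auto simp: mem_Times_iff)
    then obtain a b where ab: "a \<in> W" "b \<in> W" "z = map_prod \<phi> \<phi> (a, b)" by (cases z) auto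
    then show "z \<in> S" unfolding S_def using W(3,4) by (intro image_eqI[of _ _ "(a, b)"]) auto
  qed
  \<comment> \<open>Two derivatives: \<open>F\<close> is differentiable on \<open>S\<close>, and so
    are its directional derivatives.\<close>
  have "Ck_on (Suc (Suc 0)) S F" using sm unfolding smooth_on_def by blast
  then have d1: "\<And>x. x \<in> S \<Longrightarrow> F differentiable (at x)"
    and d2: "\<And>x v. x \<in> S \<Longrightarrow> (\<lambda>x. frechet_derivative F (at x) v) differentiable (at x)"
    by auto
  have unit: "F (z, p) = z" "F (p, z) = z" if z: "z \<in> ball p \<rho>" for z
  proof -
    obtain a where a: "a \<in> W" "z = \<phi> a" using z \<rho>(2) by blast
    then have "a \<in> U" "a \<in> carrier G" using W(3) openin_subset[OF chart(1)] top by auto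
    then show "F (z, p) = z" "F (p, z) = z" using one by (simp_all add: a p_def Feq)
  qed
  have ppS: "(p, p) \<in> S" using inS \<rho>(1) by auto
  obtain r' C where r': "r' > 0" "r' \<le> \<rho>" "C \<ge> 0"
    "\<And>z y. norm (z - p) < r' \<Longrightarrow> norm (y - p) < r' \<Longrightarrow>
       norm (F (z, y) - z - y + p) \<le> C * (norm (z - p) + norm (y - p)) * norm (z - p)"
    by (rule local_product_estimate[OF \<rho>(1) d1[OF subsetD[OF inS]] d2[OF ppS] unit]) blast+
  \<comment> \<open>The second bound yields \<open>8 * C * r \<le> 1\<close>; the denominator has
    \<open>C + 1\<close> because \<open>C\<close> may be 0.\<close>
  define r where "r = min r' (1 / (8 * (C + 1)))"
  define \<phi>0 where "\<phi>0 x = \<phi> x - p" for x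
  have r: "r > 0" "r \<le> r'" "r \<le> 1 / (8 * (C + 1))" using r' by (auto simp: r_def)
  have mem: "\<phi> z \<in> ball p \<rho>" if "norm (\<phi>0 z) < r" for z
    using that r r' by (simp add: \<phi>0_def dist_norm norm_minus_commute)
  have "local_coordinates G T U \<phi>0 r C"
  proof unfold_locales
    show "openin T U" "\<one> \<in> U" by (rule chart(1) one)+
    show "\<phi>0 \<one> = 0" by (simp add: \<phi>0_def p_def)
    show "inj_on \<phi>0 U" using chart(2) by (auto simp: \<phi>0_def inj_on_def)
    show "ball 0 r \<subseteq> \<phi>0 ` U"
    proof
      fix v :: 'e assume "v \<in> ball 0 r"
      then have "v + p \<in> ball p \<rho>" using r r' by (simp add: dist_norm)
      then obtain x where "x \<in> W" "v + p = \<phi> x" using \<rho>(2) by blast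
      then show "v \<in> \<phi>0 ` U" using W(3) by (intro image_eqI[of _ _ x]) (auto simp: \<phi>0_def algebra_simps)
    qed
    show "open (\<phi>0 ` V)" if "openin T V" "V \<subseteq> U" for V
      using open_translation_subtract[OF chart(3)[OF that], of p] by (simp add: \<phi>0_def image_image)
    show "openin T {x \<in> U. \<phi>0 x \<in> S}" if "open S" for S
    proof -
      have "{x \<in> U. \<phi>0 x \<in> S} = {x \<in> U. \<phi> x \<in> (\<lambda>v. p + v) ` S}"
        by (auto simp: \<phi>0_def image_iff intro!: bexI[of _ "\<phi> _ - p"])
      then show ?thesis using chart(4)[OF open_translation[OF that, of p]] by simp
    qed
    show "0 < r" "0 \<le> C" by (rule r r')+
    have "8 * C * r \<le> 8 * (C + 1) * (1 / (8 * (C + 1)))"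
      using r r' by (intro mult_mono) auto
    also have "\<dots> = 1" using r' by simp
    finally show "8 * C * r \<le> 1" .
    fix z y assume zy: "z \<in> U" "y \<in> U" "norm (\<phi>0 z) < r" "norm (\<phi>0 y) < r"
    then show "z \<otimes> y \<in> U" by (intro W(4) inW mem)
    show "norm (\<phi>0 (z \<otimes> y) - \<phi>0 z - \<phi>0 y) \<le> C * (norm (\<phi>0 z) + norm (\<phi>0 y)) * norm (\<phi>0 z)"
      using r'(4)[of "\<phi> z" "\<phi> y"] zy r Feq[OF zy(1,2)] by (simp add: \<phi>0_def algebra_simps)
  qed
  then show thesis by (rule that)
qed

section \<open>Discrete subgroups of Euclidean space\<close>

definition int_span :: "'a::real_vector set \<Rightarrow> 'a set" where
  "int_span B = {\<Sum>b\<in>B. of_int (k b) *\<^sub>R b | k :: 'a \<Rightarrow> int. True}"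

locale discrete_subgroup =
  fixes L :: "'e::euclidean_space set" and \<delta> :: real
  assumes zero: "0 \<in> L" and add: "\<And>x y. x \<in> L \<Longrightarrow> y \<in> L \<Longrightarrow> x + y \<in> L"
    and minus: "\<And>x. x \<in> L \<Longrightarrow> - x \<in> L"
    and \<delta>: "\<delta> > 0" and discrete: "\<And>v. v \<in> L \<Longrightarrow> norm v < \<delta> \<Longrightarrow> v = 0"
begin

lemma diff: "x \<in> L \<Longrightarrow> y \<in> L \<Longrightarrow> x - y \<in> L"
  using add[OF _ minus] by simp

lemma nat_multiple: "x \<in> L \<Longrightarrow> real n *\<^sub>R x \<in> L"
  by (induction n) (auto simp: zero add scaleR_add_left)

lemma int_multiple: assumes "x \<in> L" shows "of_int k *\<^sub>R x \<in> L"
proof (cases "k \<ge> 0")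
  case True
  then show ?thesis using nat_multiple[OF assms, of "nat k"] by simp
next
  case False
  then show ?thesis using minus[OF nat_multiple[OF assms, of "nat (- k)"]] by simp
qed

lemma sum_in: "finite A \<Longrightarrow> (\<And>a. a \<in> A \<Longrightarrow> f a \<in> L) \<Longrightarrow> sum f A \<in> L"
  by (induction A rule: finite_induct) (auto simp: zero add)

lemma int_span_sub: "finite B \<Longrightarrow> B \<subseteq> L \<Longrightarrow> int_span B \<subseteq> L"
  unfolding int_span_def by (auto intro!: sum_in int_multiple)

text \<open>An infinite bounded part would accumulate, producing two distinct elements closer than
  \<open>\<delta>\<close>.\<close>

lemma finite_bounded_part: "finite (L \<inter> cball 0 R)"
proof (rule ccontr)
  assume inf: "infinite (L \<inter> cball 0 R)"
  have "compact (cball 0 R :: 'e set)" by simp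
  then obtain x where x: "x islimpt (L \<inter> cball 0 R)"
    using compact_eq_Bolzano_Weierstrass[of "cball 0 R :: 'e set"] inf by blast
  obtain y where y: "y \<in> L" "y \<noteq> x" "dist y x < \<delta> / 2"
    using x \<delta> unfolding islimpt_approachable by (metis IntD1 half_gt_zero)
  \<comment> \<open>Choosing \<open>z\<close> strictly nearer to the limit point than
    \<open>y\<close> keeps the two distinct.\<close>
  have "min (\<delta> / 2) (dist y x) > 0" using y \<delta> by simp
  then obtain z where z: "z \<in> L" "z \<noteq> x" "dist z x < min (\<delta> / 2) (dist y x)"
    using x unfolding islimpt_approachable by blast
  have "dist y z \<le> dist y x + dist z x" by (rule dist_triangle2)
  then have "norm (y - z) < \<delta>" using y z by (simp add: dist_norm)
  then have "y = z" using discrete[OF diff[OF y(1) z(1)]] by simp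
  then show False using z by simp
qed

text \<open>
  Adding a new direction \<open>b\<close>: among the lattice vectors whose \<open>b\<close>-coefficient lies in \<open>(0, 1]\<close> one
  with minimal coefficient completes the integral basis. The minimum exists because reducing the
  other coefficients modulo 1 leaves only finitely many candidates.
\<close>

lemma refine_independent:
  assumes "finite B" "independent B" "B \<subseteq> L"
  shows "\<exists>C. finite C \<and> independent C \<and> C \<subseteq> L \<and> span C = span B \<and> L \<inter> span B \<subseteq> int_span C"
  using assms
proof (induction B rule: finite_induct)
  case empty
  show ?case by (rule exI[of _ "{}"]) (auto simp: int_span_def independent_empty)
next
  case (insert b B)
  have b: "b \<notin> span B" and iB: "independent B" and bL: "b \<in> L" and BL: "B \<subseteq> L"
    using insert by (auto simp: independent_insert)
  obtain C where C: "finite C" "independent C" "C \<subseteq> L" "span C = span B" "L \<inter> span B \<subseteq> int_span C"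
    using insert.IH iB BL by blast
  \<comment> \<open>The \<open>b\<close>-coefficient modulo \<open>span B\<close> is well defined
    because \<open>b\<close> lies outside that span.\<close>
  have uniq: "s = t" if "x - s *\<^sub>R b \<in> span B" "x - t *\<^sub>R b \<in> span B" for x s t
  proof (rule ccontr)
    assume "s \<noteq> t"
    have "(x - s *\<^sub>R b) - (x - t *\<^sub>R b) \<in> span B" using that by (rule span_diff)
    then have "(t - s) *\<^sub>R b \<in> span B" by (simp add: algebra_simps)
    then have "(1 / (t - s)) *\<^sub>R ((t - s) *\<^sub>R b) \<in> span B" by (rule span_scale)
    with \<open>s \<noteq> t\<close> b show False by simp
  qed
  \<comment> \<open>Bounds a reduced vector: \<open>b\<close> with coefficient at most 1, and each
    \<open>c\<close> with a fractional coefficient.\<close>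
  define R where "R = norm b + (\<Sum>c\<in>C. norm c)"
  define Q where "Q = {t. 0 < t \<and> t \<le> 1 \<and> (\<exists>x\<in>L. x - t *\<^sub>R b \<in> span B)}"
  have "1 \<in> Q" using bL by (auto simp: Q_def span_zero intro!: bexI[of _ b])
  have red: "\<exists>x\<in>L \<inter> cball 0 R. x - t *\<^sub>R b \<in> span B" if t: "t \<in> Q" for t
  proof -
    obtain x where x: "x \<in> L" "x - t *\<^sub>R b \<in> span C" using t C(4) by (auto simp: Q_def)
    obtain a where a: "x - t *\<^sub>R b = (\<Sum>c\<in>C. a c *\<^sub>R c)" using x(2) C(1) by (auto simp: span_finite)
    define y where "y = x - (\<Sum>c\<in>C. of_int \<lfloor>a c\<rfloor> *\<^sub>R c)"
    have yL: "y \<in> L" unfolding y_def using C by (intro diff x sum_in int_multiple) auto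
    have y: "y - t *\<^sub>R b = (\<Sum>c\<in>C. frac (a c) *\<^sub>R c)"
      using a by (simp add: y_def frac_def sum_subtractf scaleR_diff_left algebra_simps)
    have "norm (\<Sum>c\<in>C. frac (a c) *\<^sub>R c) \<le> (\<Sum>c\<in>C. norm c)"
    proof (rule sum_norm_le)
      fix c
      have "\<bar>frac (a c)\<bar> * norm c \<le> 1 * norm c"
        using frac_ge_0[of "a c"] frac_lt_1[of "a c"] by (intro mult_right_mono) auto
      then show "norm (frac (a c) *\<^sub>R c) \<le> norm c" by simp
    qed
    moreover have "norm (t *\<^sub>R b) \<le> norm b"
      using t mult_right_mono[of t 1 "norm b"] by (auto simp: Q_def)
    ultimately have "norm y \<le> R"
      using norm_triangle_ineq[of "y - t *\<^sub>R b" "t *\<^sub>R b"] unfolding R_def y[symmetric] diff_add_cancel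
      by linarith
    moreover have "y - t *\<^sub>R b \<in> span B"
      unfolding y C(4)[symmetric] by (intro span_sum span_scale span_base)
    ultimately show ?thesis using yL by auto
  qed
  \<comment> \<open>A vector determines its \<open>b\<close>-coefficient, so \<open>Q\<close> lies
    in the image of a finite set.\<close>
  have "Q \<subseteq> (\<lambda>x. THE t. x - t *\<^sub>R b \<in> span B) ` (L \<inter> cball 0 R)"
  proof
    fix t assume "t \<in> Q"
    then obtain x where x: "x \<in> L \<inter> cball 0 R" "x - t *\<^sub>R b \<in> span B" using red by blast
    then have "(THE t. x - t *\<^sub>R b \<in> span B) = t" using uniq by (intro the_equality) auto
    then show "t \<in> (\<lambda>x. THE t. x - t *\<^sub>R b \<in> span B) ` (L \<inter> cball 0 R)" using x by blast
  qed
  then have finQ: "finite Q" using finite_bounded_part finite_surj by blast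
  define t0 where "t0 = Min Q"
  have "t0 \<in> Q" unfolding t0_def using finQ \<open>1 \<in> Q\<close> by (intro Min_in) auto
  then obtain x0 where x0: "x0 \<in> L" "x0 - t0 *\<^sub>R b \<in> span B" and t0: "0 < t0" "t0 \<le> 1"
    by (auto simp: Q_def)
  have x0C: "x0 \<notin> span C"
  proof
    assume "x0 \<in> span C"
    then have "x0 - 0 *\<^sub>R b \<in> span B" using C(4) by simp
    then have "t0 = 0" using uniq[OF x0(2)] by simp
    with t0 show False by simp
  qed
  have x0C': "x0 \<notin> C" using x0C span_base by blast
  \<comment> \<open>As \<open>t0\<close> is not 0, \<open>b\<close> can be recovered from
    \<open>x0\<close> modulo \<open>span B\<close>.\<close>
  have sp: "span (insert x0 C) = span (insert b B)"
  proof (rule span_eq[THEN iffD2], intro conjI)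
    have bs: "b \<in> span (insert b B)" and sub: "span B \<subseteq> span (insert b B)"
      by (auto intro: span_base span_mono[THEN subsetD, of B])
    have "(x0 - t0 *\<^sub>R b) + t0 *\<^sub>R b \<in> span (insert b B)"
      by (intro span_add span_scale bs subsetD[OF sub x0(2)])
    then show "insert x0 C \<subseteq> span (insert b B)" using C(4) sub span_superset[of C] by auto
    have xs: "x0 \<in> span (insert x0 C)" and sub': "span B \<subseteq> span (insert x0 C)"
      using C(4) by (auto intro: span_base span_mono[THEN subsetD, of C])
    have "(1 / t0) *\<^sub>R (x0 - (x0 - t0 *\<^sub>R b)) \<in> span (insert x0 C)"
      by (intro span_diff span_scale xs subsetD[OF sub' x0(2)])
    then have "b \<in> span (insert x0 C)" using t0 by simp
    then show "insert b B \<subseteq> span (insert x0 C)" using sub' span_superset[of B] by auto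
  qed
  have "L \<inter> span (insert b B) \<subseteq> int_span (insert x0 C)"
  proof
    fix x assume x: "x \<in> L \<inter> span (insert b B)"
    then obtain t where t: "x - t *\<^sub>R b \<in> span B" by (auto simp: span_insert)
    \<comment> \<open>Division with remainder by \<open>t0\<close>: a nonzero remainder
      \<open>s\<close> would be an element of \<open>Q\<close> below the minimum.\<close>
    define k where "k = \<lfloor>t / t0\<rfloor>"
    define y where "y = x - of_int k *\<^sub>R x0"
    define s where "s = t - of_int k * t0"
    have yL: "y \<in> L" unfolding y_def using x x0 by (intro diff int_multiple) auto
    have "y - s *\<^sub>R b = (x - t *\<^sub>R b) - of_int k *\<^sub>R (x0 - t0 *\<^sub>R b)"
      by (simp add: y_def s_def algebra_simps)
    also have "\<dots> \<in> span B" by (intro span_diff span_scale t x0)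
    finally have ys: "y - s *\<^sub>R b \<in> span B" .
    have s: "0 \<le> s" "s < t0"
    proof -
      have "of_int k \<le> t / t0" "t / t0 < of_int k + 1" by (auto simp: k_def)
      then show "0 \<le> s" "s < t0" using t0 by (simp_all add: s_def field_simps)
    qed
    have "s = 0"
    proof (rule ccontr)
      assume "s \<noteq> 0"
      then have "s \<in> Q" using s t0 yL ys by (auto simp: Q_def)
      then have "t0 \<le> s" unfolding t0_def using finQ by (intro Min_le)
      with s show False by simp
    qed
    then have "y \<in> L \<inter> span B" using ys yL by simp
    then obtain m where m: "y = (\<Sum>c\<in>C. of_int (m c) *\<^sub>R c)" using C(5) by (auto simp: int_span_def)
    have "x = (\<Sum>c\<in>insert x0 C. of_int ((m(x0 := k)) c) *\<^sub>R c)"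
    proof -
      have "(\<Sum>c\<in>C. of_int ((m(x0 := k)) c) *\<^sub>R c) = (\<Sum>c\<in>C. of_int (m c) *\<^sub>R c)"
        using x0C' by (intro sum.cong) auto
      then show ?thesis using C(1) x0C' m by (simp add: y_def algebra_simps)
    qed
    then show "x \<in> int_span (insert x0 C)" unfolding int_span_def by blast
  qed
  moreover have "independent (insert x0 C)" using C(2) x0C by (simp add: independent_insert)
  ultimately show ?case using C x0 sp by (intro exI[of _ "insert x0 C"]) auto
qed

lemma exists_basis:
  obtains C where "finite C" "independent C" "L = int_span C"
proof -
  obtain B where B: "B \<subseteq> L" "independent B" "L \<subseteq> span B"
    using maximal_independent_subset[of L] by blast
  have "finite B" using B(2) independent_imp_finite by blast
  from refine_independent[OF this B(2,1)]
  obtain C where C: "finite C" "independent C" "C \<subseteq> L" "L \<inter> span B \<subseteq> int_span C"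
    by (elim exE conjE)
  have "L = int_span C" using C(4) B(3) int_span_sub[OF C(1,3)] by blast
  from that[OF C(1,2) this] show thesis .
qed

text \<open>An integral basis of the subgroup is extended to a basis of the space and matched with
  the standard one; \<open>I\<close> collects the directions that are sent to lattice
  generators.\<close>

lemma exists_adapted_coordinates:
  obtains \<psi> :: "'e \<Rightarrow> 'e" and I where "linear \<psi>" "surj \<psi>" "I \<subseteq> Basis"
    "\<And>x. \<psi> x \<in> L \<longleftrightarrow> (\<forall>i\<in>I. x \<bullet> i \<in> \<int>) \<and> (\<forall>i\<in>Basis - I. x \<bullet> i = 0)"
proof -
  obtain C where C: "finite C" "independent C" "L = int_span C" by (rule exists_basis)
  obtain B where B: "C \<subseteq> B" "independent B" "UNIV \<subseteq> span B"
    by (rule maximal_independent_subset_extend[OF subset_UNIV C(2)]) (rule that)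
  have fB: "finite B" using B(2) independent_imp_finite by blast
  have "card B = DIM('e)"
    using B(2,3) by (metis basis_card_eq_dim dim_UNIV subset_UNIV)
  then obtain \<beta> where \<beta>: "bij_betw \<beta> (Basis :: 'e set) B"
    using finite_same_card_bij[OF finite_Basis fB] by auto
  define \<psi> where "\<psi> x = (\<Sum>i\<in>Basis. (x \<bullet> i) *\<^sub>R \<beta> i)" for x :: 'e
  have lin: "linear \<psi>"
    by (rule linearI) (simp_all add: \<psi>_def inner_add_left scaleR_add_left sum.distrib scaleR_sum_right)
  have \<psi>c: "\<psi> (\<Sum>i\<in>Basis. a (\<beta> i) *\<^sub>R i) = (\<Sum>b\<in>B. a b *\<^sub>R b)" for a
  proof -
    have "\<psi> (\<Sum>i\<in>Basis. a (\<beta> i) *\<^sub>R i) = (\<Sum>i\<in>Basis. a (\<beta> i) *\<^sub>R \<beta> i)"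
      unfolding \<psi>_def by (intro sum.cong refl) simp
    also have "\<dots> = (\<Sum>b\<in>B. a b *\<^sub>R b)" by (rule sum.reindex_bij_betw[OF \<beta>])
    finally show ?thesis .
  qed
  have surj: "surj \<psi>"
    unfolding surj_def
  proof
    fix y
    have "y \<in> span B" using B(3) by auto
    then obtain a where "y = (\<Sum>b\<in>B. a b *\<^sub>R b)" using fB by (auto simp: span_finite)
    then show "\<exists>x. y = \<psi> x" using \<psi>c by metis
  qed
  have inj: "inj \<psi>" using lin surj linear_surjective_imp_injective by blast
  define I where "I = {i \<in> Basis. \<beta> i \<in> C}"
  have mem: "\<psi> x \<in> L \<longleftrightarrow> (\<forall>i\<in>I. x \<bullet> i \<in> \<int>) \<and> (\<forall>i\<in>Basis - I. x \<bullet> i = 0)" for x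
  proof
    assume "\<psi> x \<in> L"
    then obtain k where k: "\<psi> x = (\<Sum>c\<in>C. of_int (k c) *\<^sub>R c)" using C by (auto simp: int_span_def)
    define a where "a b = (if b \<in> C then real_of_int (k b) else 0)" for b
    have "(\<Sum>b\<in>B. a b *\<^sub>R b) = (\<Sum>c\<in>C. a c *\<^sub>R c)"
      using fB B(1) by (intro sum.mono_neutral_right) (auto simp: a_def)
    also have "\<dots> = \<psi> x" unfolding k by (intro sum.cong) (auto simp: a_def)
    finally have "\<psi> x = \<psi> (\<Sum>i\<in>Basis. a (\<beta> i) *\<^sub>R i)" by (simp add: \<psi>c)
    then have x: "x = (\<Sum>i\<in>Basis. a (\<beta> i) *\<^sub>R i)" using inj by (auto dest: injD)
    have "x \<bullet> i = a (\<beta> i)" if "i \<in> Basis" for i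
      using that by (subst x) simp
    then show "(\<forall>i\<in>I. x \<bullet> i \<in> \<int>) \<and> (\<forall>i\<in>Basis - I. x \<bullet> i = 0)"
      by (auto simp: I_def a_def)
  next
    assume *: "(\<forall>i\<in>I. x \<bullet> i \<in> \<int>) \<and> (\<forall>i\<in>Basis - I. x \<bullet> i = 0)"
    have CL: "C \<subseteq> L"
    proof
      fix c assume c: "c \<in> C"
      have "c = (\<Sum>b\<in>C. of_int (if b = c then 1 else 0) *\<^sub>R b)"
        using C(1) c by (simp add: if_distrib[of of_int] if_distrib[of "\<lambda>r. r *\<^sub>R _"] cong: if_cong)
      then show "c \<in> L" unfolding C(3) int_span_def
        by (intro CollectI exI[of _ "\<lambda>b. if b = c then 1 else 0"] conjI TrueI)
    qed
    show "\<psi> x \<in> L" unfolding \<psi>_def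
    proof (rule sum_in)
      fix i :: 'e assume i: "i \<in> Basis"
      show "(x \<bullet> i) *\<^sub>R \<beta> i \<in> L"
      proof (cases "i \<in> I")
        case True
        then have "x \<bullet> i \<in> \<int>" using * by blast
        then obtain k where "x \<bullet> i = of_int k" by (rule Ints_cases)
        moreover have "\<beta> i \<in> L" using True CL by (auto simp: I_def)
        ultimately show ?thesis using int_multiple by simp
      next
        case False
        then show ?thesis using * i zero by simp
      qed
    qed simp
  qed
  have "I \<subseteq> Basis" by (auto simp: I_def)
  from that[OF lin surj this mem] show thesis .
qed

end

section \<open>Grid approximations\<close>

text \<open>The power of the integers modulo \<open>N\<close> indexed by \<open>A\<close>; residues
  in the range from 0 to \<open>N - 1\<close> and the value 0 outside \<open>A\<close> give every
  element exactly one representative.\<close>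

definition grid_group :: "'e set \<Rightarrow> int \<Rightarrow> ('e \<Rightarrow> int) monoid" where
  "grid_group A N = \<lparr>carrier = {f. (\<forall>i\<in>A. 0 \<le> f i \<and> f i < N) \<and> (\<forall>i. i \<notin> A \<longrightarrow> f i = 0)},
     mult = (\<lambda>f g i. (f i + g i) mod N), one = (\<lambda>i. 0)\<rparr>"

lemma finite_grid_group: "finite A \<Longrightarrow> finite (carrier (grid_group A N))"
  using finite_set_of_finite_funs[of A "{0..<N}" 0]
  by (rule finite_subset[rotated]) (auto simp: grid_group_def)

lemma comm_group_grid_group:
  assumes N: "N > 0"
  shows "comm_group (grid_group A N)"
proof (rule comm_groupI)
  fix f assume f: "f \<in> carrier (grid_group A N)"
  have "(\<lambda>i. (- f i) mod N) \<in> carrier (grid_group A N)"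
    using f N by (auto simp: grid_group_def)
  moreover have "(\<lambda>i. (- f i) mod N) \<otimes>\<^bsub>grid_group A N\<^esub> f = \<one>\<^bsub>grid_group A N\<^esub>"
    by (simp add: grid_group_def mod_simps)
  ultimately show "\<exists>g\<in>carrier (grid_group A N). g \<otimes>\<^bsub>grid_group A N\<^esub> f = \<one>\<^bsub>grid_group A N\<^esub>" by blast
  show "\<one>\<^bsub>grid_group A N\<^esub> \<otimes>\<^bsub>grid_group A N\<^esub> f = f"
  proof
    fix i
    show "(\<one>\<^bsub>grid_group A N\<^esub> \<otimes>\<^bsub>grid_group A N\<^esub> f) i = f i"
      using f N by (cases "i \<in> A") (auto simp: grid_group_def)
  qed
qed (use N in \<open>auto simp: grid_group_def mod_simps add_ac\<close>)

text \<open>All finite groups of the sequence have to live on one fixed type; a finite group is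
  copied to the naturals along any injection.\<close>

lemma comm_group_transport_nat:
  fixes K :: "'b monoid"
  assumes K: "comm_group K" "finite (carrier K)"
  obtains H :: "nat monoid" and h where "comm_group H" "finite (carrier H)" "inj_on h (carrier K)"
    "h \<in> carrier K \<rightarrow> carrier H"
    "\<And>x y. x \<in> carrier K \<Longrightarrow> y \<in> carrier K \<Longrightarrow> h (x \<otimes>\<^bsub>K\<^esub> y) = h x \<otimes>\<^bsub>H\<^esub> h y"
proof -
  interpret K: comm_group K by fact
  obtain h :: "'b \<Rightarrow> nat" where h: "inj_on h (carrier K)"
    using finite_imp_inj_to_nat_seg[OF K(2)] by blast
  define g where "g = inv_into (carrier K) h"
  have gh: "g (h x) = x" if "x \<in> carrier K" for x using h that by (simp add: g_def)
  define H where "H = \<lparr>carrier = h ` carrier K, mult = (\<lambda>a b. h (g a \<otimes>\<^bsub>K\<^esub> g b)), one = h \<one>\<^bsub>K\<^esub>\<rparr>"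
  show thesis
  proof (rule that[of H h])
    show "comm_group H"
    proof (rule comm_groupI)
      fix a assume "a \<in> carrier H"
      then obtain x where x: "x \<in> carrier K" "a = h x" by (auto simp: H_def)
      then show "\<exists>b\<in>carrier H. b \<otimes>\<^bsub>H\<^esub> a = \<one>\<^bsub>H\<^esub>"
        by (intro bexI[of _ "h (inv\<^bsub>K\<^esub> x)"]) (auto simp: H_def gh)
    qed (auto simp: H_def gh K.m_ac)
    show "finite (carrier H)" using K(2) by (simp add: H_def)
  qed (use h in \<open>auto simp: H_def gh\<close>)
qed

text \<open>The bound records closeness up to \<open>m\<close> full turns. The exact identity for
  the floors determines \<open>m\<close>, which allows it to be shown 0 in directions that do not
  wrap around.\<close>

lemma floor_mod_diff:
  fixes a b :: real
  assumes "\<lfloor>a\<rfloor> mod N = \<lfloor>b\<rfloor> mod N"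
  obtains m where "\<bar>a - b - of_int m * of_int N\<bar> < 1" "\<lfloor>a\<rfloor> - \<lfloor>b\<rfloor> = m * N"
proof -
  have "N dvd \<lfloor>a\<rfloor> - \<lfloor>b\<rfloor>" using assms by (simp add: mod_eq_dvd_iff)
  then obtain m where m: "\<lfloor>a\<rfloor> - \<lfloor>b\<rfloor> = m * N" by (auto simp: dvd_def mult.commute)
  have "real_of_int \<lfloor>a\<rfloor> - real_of_int \<lfloor>b\<rfloor> = of_int m * of_int N"
    using arg_cong[OF m, of real_of_int] by simp
  moreover have "of_int \<lfloor>a\<rfloor> \<le> a" "a < of_int \<lfloor>a\<rfloor> + 1" "of_int \<lfloor>b\<rfloor> \<le> b" "b < of_int \<lfloor>b\<rfloor> + 1" by auto
  ultimately have "\<bar>a - b - of_int m * of_int N\<bar> < 1" by linarith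
  then show thesis using that m by blast
qed

locale exponential_coordinates = haar_measure_group G T \<mu>
  for G :: "('a, 'm) monoid_scheme" (structure) and T \<mu> +
  fixes E :: "'e::euclidean_space \<Rightarrow> 'a" and I :: "'e set"
  assumes E_add: "\<And>u v. E (u + v) = E u \<otimes> E v"
    and E_cont: "continuous_map euclidean T E"
    and E_open: "\<And>S. open S \<Longrightarrow> openin T (E ` S)"
    and E_range: "range E = carrier G"
    and I: "I \<subseteq> Basis"
    and E_kernel: "\<And>x. E x = \<one> \<longleftrightarrow> (\<forall>i\<in>I. x \<bullet> i \<in> \<int>) \<and> (\<forall>i\<in>Basis - I. x \<bullet> i = 0)"
begin

lemma E_carrier: "E v \<in> carrier G"
  using E_range by blast

lemma E_compact: "compact S \<Longrightarrow> compactin T (E ` S)"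
  by (rule image_compactin[OF _ E_cont]) simp

lemma E_eq_iff: "E u = E v \<longleftrightarrow> E (u - v) = \<one>"
proof -
  have "E u = E v \<longleftrightarrow> E (u - v) \<otimes> E v = \<one> \<otimes> E v" using E_add[of "u - v" v] E_carrier by simp
  also have "\<dots> \<longleftrightarrow> E (u - v) = \<one>" using E_carrier by (intro right_cancel) auto
  finally show ?thesis .
qed

text \<open>Images of closed balls are compact, hence of finite Haar measure, and they exhaust the
  group.\<close>

lemma sigma_finite: "sigma_finite_measure \<mu>"
proof
  have "(\<Union>n::nat. E ` cball 0 (real n)) = space \<mu>"
  proof -
    have "(\<Union>n::nat. cball 0 (real n)) = (UNIV :: 'e set)" by (auto intro: real_arch_simple)
    then show ?thesis using E_range by (simp add: space_mu flip: image_UN)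
  qed
  moreover have "E ` cball 0 (real n) \<in> sets \<mu> \<and> emeasure \<mu> (E ` cball 0 (real n)) \<noteq> \<infinity>" for n
    using compact_in_sets[OF E_compact[OF compact_cball]] compact_finite[OF E_compact[OF compact_cball]]
    by (metis less_irrefl)
  ultimately show "\<exists>A. countable A \<and> A \<subseteq> sets \<mu> \<and> \<Union> A = space \<mu> \<and> (\<forall>a\<in>A. emeasure \<mu> a \<noteq> \<infinity>)"
    by (intro exI[of _ "range (\<lambda>n. E ` cball 0 (real n))"]) auto
qed

text \<open>
  Coordinates in \<open>I\<close> have period 1 and are cut into \<open>4\<^sup>n\<close> steps; the others are cut into steps of
  length \<open>2\<^sup>-\<^sup>n\<close>, so that \<open>4\<^sup>n\<close> of them cover a window of length \<open>2\<^sup>n\<close>. Reduction modulo \<open>4\<^sup>n\<close>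
  wraps around exactly in the first case and only outside the window in the second.
\<close>

definition scale :: "nat \<Rightarrow> 'e \<Rightarrow> real" where
  "scale n i = (if i \<in> I then 4 ^ n else 2 ^ n)"

definition label :: "nat \<Rightarrow> 'e \<Rightarrow> 'e \<Rightarrow> int" where
  "label n v i = (if i \<in> Basis then \<lfloor>scale n i * (v \<bullet> i)\<rfloor> mod 4 ^ n else 0)"

abbreviation grid :: "nat \<Rightarrow> ('e \<Rightarrow> int) monoid" where
  "grid n \<equiv> grid_group Basis (4 ^ n)"

lemma scale_ge: "scale n i \<ge> 2 ^ n"
  unfolding scale_def using power_mono[of "2::real" 4 n] by auto

lemma scale_pos: "scale n i > 0"
  using scale_ge[of n i] by (smt (verit) zero_less_power)

lemma label_in_grid: "label n v \<in> carrier (grid n)"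
  by (auto simp: grid_group_def label_def)

text \<open>An integer shift \<open>m\<close> in a periodic direction changes the scaled coordinate
  by \<open>m * 4^n\<close>, which disappears modulo \<open>4^n\<close>; other coordinates do not
  change. Labels therefore descend to the group.\<close>

lemma label_cong:
  assumes "E u = E v"
  shows "label n u = label n v"
proof
  fix i
  have ker: "\<forall>i\<in>I. (u - v) \<bullet> i \<in> \<int>" "\<forall>i\<in>Basis - I. (u - v) \<bullet> i = 0"
    using assms E_eq_iff E_kernel by auto
  show "label n u i = label n v i"
  proof (cases "i \<in> Basis")
    case i: True
    show ?thesis
    proof (cases "i \<in> I")
      case True
      then have "(u - v) \<bullet> i \<in> \<int>" using ker by blast
      then obtain m where "(u - v) \<bullet> i = of_int m" by (rule Ints_cases)
      then have "scale n i * (u \<bullet> i) = scale n i * (v \<bullet> i) + of_int (m * 4 ^ n)"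
        using True by (simp add: scale_def inner_diff_left algebra_simps)
      then have "\<lfloor>scale n i * (u \<bullet> i)\<rfloor> = \<lfloor>scale n i * (v \<bullet> i)\<rfloor> + m * 4 ^ n" by linarith
      then show ?thesis using i by (simp add: label_def)
    next
      case False
      then have "u \<bullet> i = v \<bullet> i" using ker i by (simp add: inner_diff_left)
      then show ?thesis by (simp add: label_def)
    qed
  qed (simp add: label_def)
qed

definition cell :: "nat \<Rightarrow> ('e \<Rightarrow> int) \<Rightarrow> 'e set" where
  "cell n g = {v. \<forall>i\<in>Basis. \<lfloor>scale n i * (v \<bullet> i)\<rfloor> = g i}"

text \<open>Half-open boxes are countable unions of compact ones, whose images under \<open>E\<close> are compact.\<close>

lemma cell_in_sets: "E ` cell n g \<in> sets \<mu>"
proof -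
  \<comment> \<open>Closed boxes, with the open upper face pulled in by \<open>1 / (m + 1)\<close>
    in scaled coordinates.\<close>
  define C where "C m = {v. \<forall>i\<in>Basis. of_int (g i) \<le> scale n i * (v \<bullet> i) \<and>
    scale n i * (v \<bullet> i) \<le> of_int (g i) + 1 - inverse (real (Suc m))}" for m
  have cpt: "compact (C m)" for m
  proof -
    define a where "a = (\<Sum>i\<in>Basis. (of_int (g i) / scale n i) *\<^sub>R i :: 'e)"
    define b where "b = (\<Sum>i\<in>Basis. ((of_int (g i) + 1 - inverse (real (Suc m))) / scale n i) *\<^sub>R i :: 'e)"
    have ab: "a \<bullet> i = of_int (g i) / scale n i" "b \<bullet> i = (of_int (g i) + 1 - inverse (real (Suc m))) / scale n i"
      if "i \<in> Basis" for i
      using that by (simp_all add: a_def b_def)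
    have "v \<in> C m \<longleftrightarrow> v \<in> cbox a b" for v
      unfolding C_def mem_box mem_Collect_eq using scale_pos[of n]
      by (intro ball_cong refl) (simp only: ab, simp add: pos_divide_le_eq pos_le_divide_eq mult.commute)
    then have "C m = cbox a b" by blast
    then show ?thesis by (simp add: compact_cbox)
  qed
  have "cell n g = (\<Union>m. C m)"
  proof (intro equalityI subsetI)
    fix v assume v: "v \<in> cell n g"
    define e where "e i = of_int (g i) + 1 - scale n i * (v \<bullet> i)" for i
    have fl: "of_int (g i) \<le> scale n i * (v \<bullet> i)" "e i > 0" if "i \<in> Basis" for i
      using v that unfolding cell_def e_def mem_Collect_eq by (auto simp: floor_eq_iff)
    \<comment> \<open>The least scaled distance to an upper face, positive since there are finitely
      many directions; it decides which \<open>C m\<close> contains \<open>v\<close>.\<close>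
    define e0 where "e0 = Min (e ` Basis)"
    have "e0 > 0" unfolding e0_def using fl(2) by (subst Min_gr_iff) auto
    then obtain m where m: "inverse (real (Suc m)) < e0" using reals_Archimedean by blast
    have "e0 \<le> e i" if "i \<in> Basis" for i unfolding e0_def using that by (intro Min_le) auto
    with m fl have "v \<in> C m" unfolding C_def e_def by force
    then show "v \<in> (\<Union>m. C m)" by blast
  next
    fix v assume "v \<in> (\<Union>m. C m)"
    then obtain m where m: "v \<in> C m" by blast
    show "v \<in> cell n g"
      unfolding cell_def mem_Collect_eq
    proof
      fix i :: 'e assume "i \<in> Basis"
      then have "of_int (g i) \<le> scale n i * (v \<bullet> i)"
        "scale n i * (v \<bullet> i) \<le> of_int (g i) + 1 - inverse (real (Suc m))"
        using m by (auto simp: C_def)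
      moreover have "inverse (real (Suc m)) > 0" by simp
      ultimately show "\<lfloor>scale n i * (v \<bullet> i)\<rfloor> = g i"
        by (intro floor_eq_iff[THEN iffD2] conjI) linarith+
    qed
  qed
  then have "E ` cell n g = (\<Union>m. E ` C m)" by blast
  also have "\<dots> \<in> sets \<mu>" using compact_in_sets[OF E_compact[OF cpt]] by blast
  finally show ?thesis .
qed

lemma label_measurable:
  fixes q :: "'a \<Rightarrow> 'b" and h :: "('e \<Rightarrow> int) \<Rightarrow> 'b"
  assumes q: "\<And>v. q (E v) = h (label n v)"
  shows "q -` {c} \<inter> carrier G \<in> sets \<mu>"
proof -
  \<comment> \<open>Cells are indexed by floors before reduction; taking these extensional on the
    finite set \<open>Basis\<close> leaves only countably many.\<close>
  define red where "red g i = (if i \<in> Basis then g i mod 4 ^ n else 0)" for g :: "'e \<Rightarrow> int" and i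
  define X where "X = {g \<in> Basis \<rightarrow>\<^sub>E UNIV. h (red g) = c}"
  have "q -` {c} \<inter> carrier G = (\<Union>g\<in>X. E ` cell n g)"
  proof (intro equalityI subsetI)
    fix x assume x: "x \<in> q -` {c} \<inter> carrier G"
    then obtain v where v: "x = E v" using E_range by auto
    define g where "g = restrict (\<lambda>i. \<lfloor>scale n i * (v \<bullet> i)\<rfloor>) Basis"
    have "red g = label n v" by (auto simp: red_def label_def g_def)
    then have "g \<in> X" using x q[of v] v by (auto simp: X_def g_def)
    moreover have "v \<in> cell n g" by (simp add: cell_def g_def)
    ultimately show "x \<in> (\<Union>g\<in>X. E ` cell n g)" using v by blast
  next
    fix x assume "x \<in> (\<Union>g\<in>X. E ` cell n g)"
    then obtain g v where g: "g \<in> X" "v \<in> cell n g" "x = E v" by blast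
    then have "label n v = red g" by (auto simp: red_def label_def cell_def)
    then show "x \<in> q -` {c} \<inter> carrier G" using g q[of v] E_carrier by (simp add: X_def)
  qed
  also have "\<dots> \<in> sets \<mu>"
  proof (rule sets.countable_UN')
    have "countable (Basis \<rightarrow>\<^sub>E (UNIV :: int set) :: ('e \<Rightarrow> int) set)"
      by (intro countable_PiE) auto
    then show "countable X" by (rule countable_subset[rotated]) (auto simp: X_def)
  qed (auto intro: cell_in_sets)
  finally show ?thesis .
qed

text \<open>Images of open balls are open and cover the group, so finitely many cover a compact
  set.\<close>

lemma compact_bounded_lift:
  assumes K: "compactin T K"
  obtains R where "R > 0" "K \<subseteq> E ` ball 0 R"
proof -
  have "K \<subseteq> \<Union> (range (\<lambda>n::nat. E ` ball 0 (real n)))"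
  proof
    fix x assume "x \<in> K"
    then have "x \<in> carrier G" using compactin_subset_topspace[OF K] top by auto
    then obtain v where v: "x = E v" using E_range by auto
    obtain n :: nat where "norm v < real n" using reals_Archimedean2 by blast
    then have "v \<in> ball 0 (real n)" by simp
    then show "x \<in> \<Union> (range (\<lambda>n::nat. E ` ball 0 (real n)))" using v by blast
  qed
  moreover have "\<And>S. S \<in> range (\<lambda>n::nat. E ` ball 0 (real n)) \<Longrightarrow> openin T S" using E_open by auto
  ultimately obtain F where F: "finite F" "F \<subseteq> range (\<lambda>n::nat. E ` ball 0 (real n))" "K \<subseteq> \<Union> F"
    using compactinD[OF K] by metis
  then obtain A where A: "finite A" "F = (\<lambda>n::nat. E ` ball 0 (real n)) ` A"
    by (metis finite_subset_image)
  define R where "R = real (Suc (Max (insert 0 A)))"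
  have "ball 0 (real n) \<subseteq> ball (0::'e) R" if "n \<in> A" for n
  proof -
    have "n \<le> Max (insert 0 A)" using A(1) that by (intro Max_ge) auto
    then have "real n \<le> R" by (simp add: R_def)
    then show ?thesis by (rule subset_ball)
  qed
  then have "K \<subseteq> E ` ball 0 R" using F(3) A(2) by blast
  moreover have "R > 0" by (simp add: R_def)
  ultimately show thesis using that by blast
qed

lemma closed_lift:
  assumes "compactin T K"
  shows "closed {v. E v \<in> K}"
proof -
  have "closedin T K" using haus assms by (rule compactin_imp_closedin)
  from closedin_continuous_map_preimage[OF E_cont this] show ?thesis by simp
qed

text \<open>Points with equal labels have lifts that differ, up to a kernel element, by at most
  \<open>(1/2)^n\<close> in each coordinate. The lifts of two disjoint compact sets, one of them cut
  to a bounded part, are a positive distance \<open>d\<close> apart.\<close>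

lemma label_separates:
  assumes K: "compactin T K" and L: "compactin T L" and KL: "K \<inter> L = {}"
  shows "eventually (\<lambda>n. \<forall>u v. E u \<in> K \<longrightarrow> E v \<in> L \<longrightarrow> label n u \<noteq> label n v) sequentially"
proof -
  obtain R where R: "R > 0" "K \<subseteq> E ` ball 0 R" by (rule compact_bounded_lift[OF K])
  obtain R' where R': "R' > 0" "L \<subseteq> E ` ball 0 R'" by (rule compact_bounded_lift[OF L])
  \<comment> \<open>Only the lift of \<open>K\<close> is cut to a compact set. That of
    \<open>L\<close> stays whole, so that it also contains the point \<open>v + z\<close> obtained
    by a kernel shift.\<close>
  define K' where "K' = {v. E v \<in> K} \<inter> cball 0 R"
  have "compact K'" unfolding K'_def using closed_lift[OF K] by (intro closed_Int_compact) auto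
  moreover have "closed {v. E v \<in> L}" by (rule closed_lift[OF L])
  moreover have "K' \<inter> {v. E v \<in> L} = {}" using KL by (auto simp: K'_def)
  ultimately obtain d where d: "d > 0" "\<And>x y. x \<in> K' \<Longrightarrow> E y \<in> L \<Longrightarrow> d \<le> dist x y"
    using separate_compact_closed[of K' "{v. E v \<in> L}"] by auto
  have "eventually (\<lambda>n::nat. R + R' + 1 \<le> 2 ^ n) sequentially"
  proof -
    obtain n0 where n0: "R + R' + 1 < 2 ^ n0" using real_arch_pow[of 2 "R + R' + 1"] by auto
    show ?thesis
    proof (rule eventually_sequentiallyI[of n0])
      fix n assume "n0 \<le> n"
      then have "(2::real) ^ n0 \<le> 2 ^ n" by (rule power_increasing) simp
      with n0 show "R + R' + 1 \<le> 2 ^ n" by linarith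
    qed
  qed
  moreover have "(\<lambda>n. real DIM('e) * (1/2) ^ n) \<longlonglongrightarrow> real DIM('e) * 0"
    by (intro tendsto_mult tendsto_const LIMSEQ_power_zero) simp
  then have "eventually (\<lambda>n. real DIM('e) * (1/2) ^ n < d) sequentially"
    by (intro order_tendstoD) (use d in auto)
  ultimately show ?thesis
  proof eventually_elim
    case (elim n)
    show ?case
    proof (intro allI impI notI)
      fix u0 v0 assume uv0: "E u0 \<in> K" "E v0 \<in> L" and eq0: "label n u0 = label n v0"
      obtain u where u: "u \<in> ball 0 R" "E u = E u0" using R uv0 by force
      obtain v where v: "v \<in> ball 0 R'" "E v = E v0" using R' uv0 by force
      have eq: "label n u = label n v" using eq0 label_cong[OF u(2)] label_cong[OF v(2)] by simp
      have "\<exists>m::int. \<bar>(u - v) \<bullet> i - of_int m\<bar> \<le> (1/2) ^ n \<and> (i \<notin> I \<longrightarrow> m = 0)" if i: "i \<in> Basis" for i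
      proof -
        have "\<lfloor>scale n i * (u \<bullet> i)\<rfloor> mod 4 ^ n = \<lfloor>scale n i * (v \<bullet> i)\<rfloor> mod 4 ^ n"
          using fun_cong[OF eq, of i] i by (simp add: label_def)
        then obtain m where m: "\<bar>scale n i * (u \<bullet> i) - scale n i * (v \<bullet> i) - of_int m * of_int (4 ^ n)\<bar> < 1"
            "\<lfloor>scale n i * (u \<bullet> i)\<rfloor> - \<lfloor>scale n i * (v \<bullet> i)\<rfloor> = m * 4 ^ n"
          by (rule floor_mod_diff)
        show ?thesis
        proof (cases "i \<in> I")
          case True
          have "scale n i * \<bar>(u - v) \<bullet> i - of_int m\<bar> = \<bar>scale n i * ((u - v) \<bullet> i - of_int m)\<bar>"
            using scale_pos[of n i] by (simp add: abs_mult)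
          also have "\<dots> = \<bar>scale n i * (u \<bullet> i) - scale n i * (v \<bullet> i) - of_int m * of_int (4 ^ n)\<bar>"
            using True by (simp add: scale_def inner_diff_left algebra_simps)
          finally have "scale n i * \<bar>(u - v) \<bullet> i - of_int m\<bar> < 1" using m by simp
          moreover have "2 ^ n * \<bar>(u - v) \<bullet> i - of_int m\<bar> \<le> scale n i * \<bar>(u - v) \<bullet> i - of_int m\<bar>"
            using scale_ge by (intro mult_right_mono) auto
          ultimately have "2 ^ n * \<bar>(u - v) \<bullet> i - of_int m\<bar> \<le> 1" by linarith
          then have "\<bar>(u - v) \<bullet> i - of_int m\<bar> \<le> (1/2) ^ n" by (simp add: power_divide field_simps)
          then show ?thesis using True by blast
        next
          case False
          have "\<bar>u \<bullet> i\<bar> < R" "\<bar>v \<bullet> i\<bar> < R'"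
            using Basis_le_norm[OF i, of u] Basis_le_norm[OF i, of v] u v by auto
          then have "\<bar>u \<bullet> i - v \<bullet> i\<bar> < R + R'" by linarith
          then have "2 ^ n * \<bar>u \<bullet> i - v \<bullet> i\<bar> \<le> 2 ^ n * (R + R')" by (intro mult_left_mono) auto
          moreover have "2 ^ n * \<bar>u \<bullet> i - v \<bullet> i\<bar> = \<bar>2 ^ n * (u \<bullet> i) - 2 ^ n * (v \<bullet> i)\<bar>"
            by (simp add: abs_mult right_diff_distrib[symmetric])
          \<comment> \<open>The floors differ by less than one full turn \<open>4^n\<close>, which
            makes \<open>m\<close> equal to 0; the spare 1 in \<open>R + R' + 1\<close> pays for the
            rounding.\<close>
          moreover have "2 ^ n * (R + R') + 1 \<le> (4::real) ^ n"
          proof -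
            have "(1::real) \<le> 2 ^ n" by simp
            then have "2 ^ n * (R + R') + 1 \<le> 2 ^ n * (R + R' + 1)" by (simp add: algebra_simps)
            also have "\<dots> \<le> 2 ^ n * 2 ^ n" using elim by (intro mult_left_mono) auto
            also have "\<dots> = (4::real) ^ n" by (simp flip: power_mult_distrib)
            finally show ?thesis .
          qed
          ultimately have "\<bar>2 ^ n * (u \<bullet> i) - 2 ^ n * (v \<bullet> i)\<bar> + 1 \<le> (4::real) ^ n" by linarith
          moreover have "\<bar>real_of_int (\<lfloor>2 ^ n * (u \<bullet> i)\<rfloor> - \<lfloor>2 ^ n * (v \<bullet> i)\<rfloor>)\<bar> < \<bar>2 ^ n * (u \<bullet> i) - 2 ^ n * (v \<bullet> i)\<bar> + 1"
            by linarith
          moreover have "real_of_int (\<lfloor>2 ^ n * (u \<bullet> i)\<rfloor> - \<lfloor>2 ^ n * (v \<bullet> i)\<rfloor>) = of_int m * 4 ^ n"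
            using m(2) False by (simp add: scale_def)
          ultimately have "\<bar>of_int m * 4 ^ n\<bar> < (4::real) ^ n" by linarith
          then have "\<bar>of_int m\<bar> < (1::real)" by (simp add: abs_mult)
          then have m0: "m = 0" by simp
          then have "\<bar>2 ^ n * (u \<bullet> i) - 2 ^ n * (v \<bullet> i)\<bar> < 1" using m(1) False by (simp add: scale_def)
          then have "2 ^ n * \<bar>(u - v) \<bullet> i\<bar> \<le> 1"
            by (simp add: abs_mult right_diff_distrib[symmetric] inner_diff_left)
          then have "\<bar>(u - v) \<bullet> i\<bar> \<le> (1/2) ^ n" by (simp add: power_divide field_simps)
          then show ?thesis by (intro exI[of _ 0]) simp
        qed
      qed
      then obtain m :: "'e \<Rightarrow> int" where m: "\<And>i. i \<in> Basis \<Longrightarrow> \<bar>(u - v) \<bullet> i - of_int (m i)\<bar> \<le> (1/2) ^ n"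
          "\<And>i. i \<in> Basis \<Longrightarrow> i \<notin> I \<Longrightarrow> m i = 0"
        by metis
      \<comment> \<open>The kernel element that absorbs the full turns.\<close>
      define z where "z = (\<Sum>i\<in>Basis. of_int (m i) *\<^sub>R i :: 'e)"
      have z: "z \<bullet> i = of_int (m i)" if "i \<in> Basis" for i using that by (simp add: z_def)
      have "E z = \<one>" unfolding E_kernel using I z m(2) by auto
      then have "E (v + z) = E v" using E_add[of v z] E_carrier by simp
      then have "d \<le> dist u (v + z)"
        using u v uv0 by (intro d) (auto simp: K'_def)
      also have "\<dots> \<le> (\<Sum>i\<in>Basis. \<bar>(u - (v + z)) \<bullet> i\<bar>)" unfolding dist_norm by (rule norm_le_l1)
      also have "\<dots> \<le> (\<Sum>i\<in>(Basis::'e set). (1/2) ^ n)"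
        using m(1) z by (intro sum_mono) (simp add: inner_diff_left inner_add_left algebra_simps)
      also have "\<dots> = real DIM('e) * (1/2) ^ n" by simp
      finally show False using elim by linarith
    qed
  qed
qed

text \<open>The lower corner of the grid cell of \<open>u\<close>. Its scaled coordinates are
  integers, and a floor commutes with adding an integer, so labels add exactly when this point is
  one of the summands.\<close>

definition corner :: "nat \<Rightarrow> 'e \<Rightarrow> 'e" where
  "corner n u = (\<Sum>i\<in>Basis. (of_int \<lfloor>scale n i * (u \<bullet> i)\<rfloor> / scale n i) *\<^sub>R i)"

lemma label_corner_add: "label n (corner n u + v) = label n u \<otimes>\<^bsub>grid n\<^esub> label n v"
proof
  fix i
  show "label n (corner n u + v) i = (label n u \<otimes>\<^bsub>grid n\<^esub> label n v) i"
  proof (cases "i \<in> Basis")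
    case True
    have "scale n i * ((corner n u + v) \<bullet> i) = of_int \<lfloor>scale n i * (u \<bullet> i)\<rfloor> + scale n i * (v \<bullet> i)"
      using True scale_pos[of n i] by (simp add: corner_def inner_add_left distrib_left)
    then have "\<lfloor>scale n i * ((corner n u + v) \<bullet> i)\<rfloor> = \<lfloor>scale n i * (u \<bullet> i)\<rfloor> + \<lfloor>scale n i * (v \<bullet> i)\<rfloor>"
      by simp
    then show ?thesis using True by (simp add: label_def grid_group_def mod_simps)
  qed (simp add: label_def grid_group_def)
qed

lemma corner_tendsto: "(\<lambda>n. corner n u) \<longlonglongrightarrow> u"
proof (rule Lim_null[THEN iffD2], rule Lim_null_comparison)
  have "norm (corner n u - u) \<le> real DIM('e) * (1/2) ^ n" for n
  proof -
    have "norm (corner n u - u) \<le> (\<Sum>i\<in>Basis. \<bar>(corner n u - u) \<bullet> i\<bar>)" by (rule norm_le_l1)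
    also have "\<dots> \<le> (\<Sum>i\<in>(Basis::'e set). (1/2) ^ n)"
    proof (rule sum_mono)
      fix i :: 'e assume i: "i \<in> Basis"
      have "2 ^ n * \<bar>(corner n u - u) \<bullet> i\<bar> \<le> scale n i * \<bar>(corner n u - u) \<bullet> i\<bar>"
        using scale_ge by (intro mult_right_mono) auto
      also have "\<dots> = \<bar>scale n i * ((corner n u - u) \<bullet> i)\<bar>" using scale_pos[of n i] by (simp add: abs_mult)
      also have "\<dots> = \<bar>of_int \<lfloor>scale n i * (u \<bullet> i)\<rfloor> - scale n i * (u \<bullet> i)\<bar>"
        using i scale_pos[of n i] by (simp add: corner_def inner_diff_left right_diff_distrib)
      also have "\<dots> \<le> 1" by linarith
      finally show "\<bar>(corner n u - u) \<bullet> i\<bar> \<le> (1/2) ^ n" by (simp add: power_divide field_simps)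
    qed
    finally show ?thesis by simp
  qed
  then show "eventually (\<lambda>n. norm (corner n u - u) \<le> real DIM('e) * (1/2) ^ n) sequentially" by simp
  have "(\<lambda>n. real DIM('e) * (1/2) ^ n) \<longlonglongrightarrow> real DIM('e) * 0"
    by (intro tendsto_mult tendsto_const LIMSEQ_power_zero) simp
  then show "(\<lambda>n. real DIM('e) * (1/2) ^ n) \<longlonglongrightarrow> 0" by simp
qed

theorem embeds_in_ultraproduct:
  "\<exists>(H :: nat \<Rightarrow> nat monoid) (D :: nat filter).
     (\<forall>n. comm_group (H n) \<and> finite (carrier (H n))) \<and> ultrafilter D \<and>
     metrically_embeds (L1_conv G \<mu>) (ultraproduct D (\<lambda>n. l1_conv (H n)))"
proof -
  have "\<forall>n. \<exists>(H :: nat monoid) h. comm_group H \<and> finite (carrier H) \<and> inj_on h (carrier (grid n)) \<and>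
     h \<in> carrier (grid n) \<rightarrow> carrier H \<and>
     (\<forall>x\<in>carrier (grid n). \<forall>y\<in>carrier (grid n). h (x \<otimes>\<^bsub>grid n\<^esub> y) = h x \<otimes>\<^bsub>H\<^esub> h y)"
  proof
    fix n
    have K: "comm_group (grid n)" "finite (carrier (grid n))"
      by (auto intro: comm_group_grid_group finite_grid_group)
    show "\<exists>(H :: nat monoid) h. comm_group H \<and> finite (carrier H) \<and> inj_on h (carrier (grid n)) \<and>
     h \<in> carrier (grid n) \<rightarrow> carrier H \<and>
     (\<forall>x\<in>carrier (grid n). \<forall>y\<in>carrier (grid n). h (x \<otimes>\<^bsub>grid n\<^esub> y) = h x \<otimes>\<^bsub>H\<^esub> h y)"
      by (rule comm_group_transport_nat[OF K]) blast
  qed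
  then obtain H :: "nat \<Rightarrow> nat monoid" and h where H: "\<And>n. comm_group (H n)" "\<And>n. finite (carrier (H n))"
    and h: "\<And>n. inj_on (h n) (carrier (grid n))" "\<And>n. h n \<in> carrier (grid n) \<rightarrow> carrier (H n)"
      "\<And>n x y. x \<in> carrier (grid n) \<Longrightarrow> y \<in> carrier (grid n) \<Longrightarrow> h n (x \<otimes>\<^bsub>grid n\<^esub> y) = h n x \<otimes>\<^bsub>H n\<^esub> h n y"
    by metis
  \<comment> \<open>An arbitrary lift is used; \<open>label_cong\<close> makes the label independent
    of it.\<close>
  define q where "q n x = h n (label n (inv_into UNIV E x))" for n x
  have q: "q n (E v) = h n (label n v)" for n v
  proof -
    have "E (inv_into UNIV E (E v)) = E v" by (rule f_inv_into_f) simp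
    then show ?thesis unfolding q_def using label_cong by metis
  qed
  have lift: "\<exists>v. x = E v" if "x \<in> carrier G" for x using that E_range by auto
  interpret A: finite_approximation G T \<mu> H q
  proof (intro finite_approximation.intro finite_approximation_axioms.intro)
    show "haar_group G T \<mu>"
      by (intro haar_group.intro haar_group_axioms.intro haar_measure_group_axioms sigma_finite)
    show "group (H n)" "finite (carrier (H n))" for n
      using H by (auto intro: comm_group.axioms)
    show "q n \<in> carrier G \<rightarrow> carrier (H n)" for n
      using h(2)[of n] label_in_grid lift q by (metis Pi_iff)
    show "q n \<in> measurable \<mu> (count_space UNIV)" for n
      unfolding measurable_count_space_eq2_countable space_mu
      using label_measurable[of "q n" "h n" n, OF q] by simp
    show "eventually (\<lambda>n. \<forall>x\<in>K. \<forall>y\<in>L. q n x \<noteq> q n y) sequentially"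
      if KL: "compactin T K" "compactin T L" "K \<inter> L = {}" for K L
      using label_separates[OF KL]
    proof eventually_elim
      case (elim n)
      show ?case
      proof (intro ballI notI)
        fix x y assume xy: "x \<in> K" "y \<in> L" "q n x = q n y"
        have "x \<in> carrier G" "y \<in> carrier G"
          using xy compactin_subset_topspace[OF KL(1)] compactin_subset_topspace[OF KL(2)] top by auto
        then obtain u v where uv: "x = E u" "y = E v" using lift by blast
        then have "label n u = label n v"
          using xy(3) h(1)[of n] label_in_grid by (auto simp: q dest: inj_onD)
        then show False using elim xy uv by blast
      qed
    qed
    show "\<exists>s. limitin T s y sequentially \<and>
      (\<forall>n. s n \<in> carrier G \<and> (\<forall>x\<in>carrier G. q n (s n \<otimes> x) = q n y \<otimes>\<^bsub>H n\<^esub> q n x))"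
      if y: "y \<in> carrier G" for y
    proof -
      obtain u where u: "y = E u" using lift[OF y] by blast
      show ?thesis
      proof (intro exI[of _ "\<lambda>n. E (corner n u)"] conjI allI ballI)
        have "limitin euclidean (\<lambda>n. corner n u) u sequentially" using corner_tendsto by simp
        from continuous_map_limit[OF E_cont this] show "limitin T (\<lambda>n. E (corner n u)) y sequentially"
          by (simp add: o_def u)
        fix n
        show "E (corner n u) \<in> carrier G" by (rule E_carrier)
        fix x assume "x \<in> carrier G"
        then obtain v where v: "x = E v" using lift by blast
        show "q n (E (corner n u) \<otimes> x) = q n y \<otimes>\<^bsub>H n\<^esub> q n x"
          unfolding u v q E_add[symmetric] label_corner_add by (intro h(3) label_in_grid)
      qed
    qed
  qed
  obtain D :: "nat filter" where D: "ultrafilter D" "D \<le> sequentially"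
    by (rule ultrafilter_below[OF sequentially_bot])
  have "metrically_embeds (L1_conv G \<mu>) (ultraproduct D (\<lambda>n. l1_conv (H n)))"
    using D by (intro A.L1_metrically_embeds) (auto simp: ultrafilter_def)
  with H D show ?thesis by blast
qed

end

section \<open>The trivial group, and assembly of the theorem\<close>

lemma (in haar_measure_group) embeds_trivial:
  assumes triv: "carrier G = {\<one>}"
  shows "\<exists>(H :: nat \<Rightarrow> nat monoid) (D :: nat filter).
     (\<forall>n. comm_group (H n) \<and> finite (carrier (H n))) \<and> ultrafilter D \<and>
     metrically_embeds (L1_conv G \<mu>) (ultraproduct D (\<lambda>n. l1_conv (H n)))"
proof -
  define H :: "nat \<Rightarrow> nat monoid" where "H n = \<lparr>carrier = {0}, mult = (\<lambda>_ _. 0), one = 0\<rparr>" for n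
  have H: "comm_group (H n)" "finite (carrier (H n))" for n
    by (auto simp: H_def intro!: comm_groupI)
  interpret A: finite_approximation G T \<mu> H "\<lambda>n x. 0"
  proof (intro finite_approximation.intro finite_approximation_axioms.intro)
    have "compactin T {\<one>}" by (simp add: top)
    then have "emeasure \<mu> (space \<mu>) \<noteq> \<infinity>" using compact_finite space_mu triv by fastforce
    then have "sigma_finite_measure \<mu>"
      by unfold_locales (auto intro!: exI[of _ "{space \<mu>}"])
    then show "haar_group G T \<mu>"
      by (intro haar_group.intro haar_group_axioms.intro haar_measure_group_axioms)
    show "group (H n)" "finite (carrier (H n))" for n
      using H by (auto intro: comm_group.axioms)
    show "(\<lambda>x. 0) \<in> carrier G \<rightarrow> carrier (H n)" for n by (simp add: H_def)
    show "(\<lambda>x. 0) \<in> measurable \<mu> (count_space UNIV)" by simp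
    show "eventually (\<lambda>n. \<forall>x\<in>K. \<forall>y\<in>L. (0::nat) \<noteq> 0) sequentially"
      if KL: "compactin T K" "compactin T L" "K \<inter> L = {}" for K L
    proof -
      have "K \<subseteq> {\<one>}" "L \<subseteq> {\<one>}"
        using compactin_subset_topspace[OF KL(1)] compactin_subset_topspace[OF KL(2)] top triv by simp_all
      \<comment> \<open>Disjoint subsets of a single point cannot both be nonempty, so the constant
        map separates them vacuously.\<close>
      with KL(3) have "K = {} \<or> L = {}" by auto
      then show ?thesis by auto
    qed
    show "\<exists>s. limitin T s y sequentially \<and>
      (\<forall>n. s n \<in> carrier G \<and> (\<forall>x\<in>carrier G. 0 = 0 \<otimes>\<^bsub>H n\<^esub> 0))" if y: "y \<in> carrier G" for y
      using y by (intro exI[of _ "\<lambda>n. y"]) (auto simp: H_def top)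
  qed
  obtain D :: "nat filter" where D: "ultrafilter D" "D \<le> sequentially"
    by (rule ultrafilter_below[OF sequentially_bot])
  have "metrically_embeds (L1_conv G \<mu>) (ultraproduct D (\<lambda>n. l1_conv (H n)))"
    using D by (intro A.L1_metrically_embeds) (auto simp: ultrafilter_def)
  with H D show ?thesis by blast
qed

text \<open>Composing \<open>E\<close> with the linear coordinates adapted to its kernel turns the
  kernel into the integer points of a coordinate subspace, as the grid construction
  requires.\<close>

lemma (in haar_measure_group) embeds_of_discrete_kernel:
  fixes E :: "'e::euclidean_space \<Rightarrow> 'a"
  assumes E: "\<And>u v. E (u + v) = E u \<otimes> E v" "continuous_map euclidean T E"
    "\<And>S. open S \<Longrightarrow> openin T (E ` S)" "range E = carrier G"
    and \<delta>: "\<delta> > 0" "\<And>v. norm v < \<delta> \<Longrightarrow> E v = \<one> \<Longrightarrow> v = 0"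
  shows "\<exists>(H :: nat \<Rightarrow> nat monoid) (D :: nat filter).
     (\<forall>n. comm_group (H n) \<and> finite (carrier (H n))) \<and> ultrafilter D \<and>
     metrically_embeds (L1_conv G \<mu>) (ultraproduct D (\<lambda>n. l1_conv (H n)))"
proof -
  have Ec: "E v \<in> carrier G" for v using E(4) by blast
  have E0: "E 0 = \<one>" using E(1)[of 0 0] Ec[of 0] by (simp add: l_cancel_one')
  interpret L: discrete_subgroup "{v. E v = \<one>}" \<delta>
  proof
    fix x assume "x \<in> {v. E v = \<one>}"
    then show "- x \<in> {v. E v = \<one>}" using E(1)[of x "- x"] Ec by (simp add: E0)
  qed (use E0 E(1) \<delta> in auto)
  obtain \<psi> :: "'e \<Rightarrow> 'e" and I where \<psi>: "linear \<psi>" "surj \<psi>" and I: "I \<subseteq> Basis"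
    and ker: "\<And>x. \<psi> x \<in> {v. E v = \<one>} \<longleftrightarrow> (\<forall>i\<in>I. x \<bullet> i \<in> \<int>) \<and> (\<forall>i\<in>Basis - I. x \<bullet> i = 0)"
    by (rule L.exists_adapted_coordinates) blast
  interpret X: exponential_coordinates G T \<mu> "\<lambda>v. E (\<psi> v)" I
  proof (intro exponential_coordinates.intro exponential_coordinates_axioms.intro haar_measure_group_axioms)
    show "E (\<psi> (u + v)) = E (\<psi> u) \<otimes> E (\<psi> v)" for u v by (simp add: linear_add[OF \<psi>(1)] E(1))
    have "continuous_map euclidean euclidean \<psi>"
      using linear_continuous_on[OF \<psi>(1)[unfolded linear_conv_bounded_linear], of UNIV] by simp
    from continuous_map_compose[OF this E(2)] show "continuous_map euclidean T (\<lambda>v. E (\<psi> v))" by (simp add: o_def)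
    show "openin T ((\<lambda>v. E (\<psi> v)) ` S)" if "open S" for S
      using E(3)[OF open_surjective_linear_image[OF that \<psi>]] by (simp add: image_image)
    have "range (\<lambda>v. E (\<psi> v)) = E ` range \<psi>" by (simp add: image_image)
    then show "range (\<lambda>v. E (\<psi> v)) = carrier G" using \<psi>(2) E(4) by simp
    show "I \<subseteq> Basis" by (rule I)
    show "E (\<psi> x) = \<one> \<longleftrightarrow> (\<forall>i\<in>I. x \<bullet> i \<in> \<int>) \<and> (\<forall>i\<in>Basis - I. x \<bullet> i = 0)" for x
      using ker[of x] by simp
  qed
  show ?thesis by (rule X.embeds_in_ultraproduct)
qed

theorem theorem5p8:
  fixes G :: "('a, 'm) monoid_scheme" and T :: "'a topology" and \<mu> :: "'a measure"
  assumes "lie_group TYPE('e::euclidean_space) G T"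
    and "comm_group G"
    and "connected_space T"
    and "left_haar_measure G T \<mu>"
  shows "\<exists>(H :: nat \<Rightarrow> nat monoid) (D :: nat filter).
           (\<forall>n. comm_group (H n) \<and> finite (carrier (H n))) \<and>
           ultrafilter D \<and>
           metrically_embeds (L1_conv G \<mu>) (ultraproduct D (\<lambda>n. l1_conv (H n)))"
proof -
  interpret comm_group G by fact
  have top: "topspace T = carrier G" and haus: "Hausdorff_space T" and sc: "second_countable T"
    and cases: "T = discrete_topology (carrier G) \<or>
      (\<exists>A :: ('a, 'e) chart set. smooth_atlas T A \<and>
         smooth_map (prod_topology T T) (prod_atlas A A) T A (\<lambda>(x, y). x \<otimes>\<^bsub>G\<^esub> y) \<and>
         smooth_map T A T A (\<lambda>x. inv\<^bsub>G\<^esub> x))"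
    using assms(1) unfolding lie_group_def by blast+
  from cases show ?thesis
  proof
    assume T: "T = discrete_topology (carrier G)"
    interpret haar_measure_group G T \<mu>
    proof
      show "continuous_map (prod_topology T T) T (\<lambda>(x, y). x \<otimes>\<^bsub>G\<^esub> y)" "continuous_map T T (\<lambda>x. inv\<^bsub>G\<^esub> x)"
        unfolding T by (auto simp flip: prod_topology_discrete_topology)
    qed (rule top haus sc assms(4))+
    \<comment> \<open>A connected discrete space has at most one point.\<close>
    have "carrier G = {\<one>\<^bsub>G\<^esub>}"
      using assms(3) one_closed unfolding T connected_space_discrete_topology by auto
    then show ?thesis by (rule embeds_trivial)
  next
    assume "\<exists>A :: ('a, 'e) chart set. smooth_atlas T A \<and>
         smooth_map (prod_topology T T) (prod_atlas A A) T A (\<lambda>(x, y). x \<otimes>\<^bsub>G\<^esub> y) \<and>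
         smooth_map T A T A (\<lambda>x. inv\<^bsub>G\<^esub> x)"
    then obtain A :: "('a, 'e) chart set" where A: "smooth_atlas T A"
      "smooth_map (prod_topology T T) (prod_atlas A A) T A (\<lambda>(x, y). x \<otimes>\<^bsub>G\<^esub> y)"
      "smooth_map T A T A (\<lambda>x. inv\<^bsub>G\<^esub> x)" by blast
    interpret haar_measure_group G T \<mu>
    proof
      show "continuous_map (prod_topology T T) T (\<lambda>(x, y). x \<otimes>\<^bsub>G\<^esub> y)" "continuous_map T T (\<lambda>x. inv\<^bsub>G\<^esub> x)"
        using A unfolding smooth_map_def by blast+
    qed (rule top haus sc assms(4))+
    obtain U and \<phi> :: "'a \<Rightarrow> 'e" and r C where lc: "local_coordinates G T U \<phi> r C"
      by (rule local_coordinates_of_atlas[OF A(1,2)])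
    obtain E :: "'e \<Rightarrow> 'a" and \<delta> where
      "\<And>u v. E (u + v) = E u \<otimes>\<^bsub>G\<^esub> E v" "continuous_map euclidean T E"
      "\<And>S. open S \<Longrightarrow> openin T (E ` S)" "range E = carrier G"
      "\<delta> > 0" "\<And>v. norm v < \<delta> \<Longrightarrow> E v = \<one>\<^bsub>G\<^esub> \<Longrightarrow> v = 0"
      using local_coordinates.exists_exponential[OF lc assms(3)] by blast
    then show ?thesis by (rule embeds_of_discrete_kernel)
  qed
qed

end
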